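(* Consider the sparse normal means model: one observes $X=(X_1,\ldots,X_n)$ with $X_i=\theta_i+\varepsilon_i$, $\varepsilon_i$ i.i.d. $\mathcal{N}(0,1)$, with $P_\theta,E_\theta$ the law of $X$ and expectation under $\theta$, $\ell_0[s_n]=\{\theta\in\mathbb{R}^n:\#\{i:\theta_i\ne0\}\le s_n\}$, and $r_n=2s_n\log(n/s_n)$. Let $\Pi_\alpha=\bigotimes_{i=1}^n((1-\alpha)\delta_0+\alpha G)$ with $G$ the standard Cauchy distribution (density $\gamma(x)=\frac1{\pi(1+x^2)}$), and let $\hat\alpha$ maximise over $[\alpha_n,1]$ the log-marginal likelihood $\ell_n(\alpha)=\sum_{i=1}^n\log((1-\alpha)\phi(X_i)+\alpha g(X_i))$, with $\phi$ the standard normal density, $g=\phi*\gamma$, $t(\alpha_n)=\sqrt{2\log n}$. For $n\ge3$ and $A\ge0$ set $t_n^2=2\log n-5\log\log n$, $t_A=\sqrt{2(1+A)\log n}$, $\hat t=t(\hat\alpha)$, $\alpha_A=t^{-1}(t_A)$, and define the modified estimator $\hat\alpha_A=\hat\alpha$ if $\hat t\le t_n$ and $\hat\alpha_A=\alpha_A$ if $\hat t>t_n$. Fix $A>0$. Then there exist $C,c_0>0$ and $N_0>0$ such that for any $n\ge N_0$ and any $s_n$ with $1\le s_n\le c_0n$, \[ \sup_{\theta_0\in\ell_0[s_n]}E_{\theta_0}\int\|\theta-\theta_0\|^2\,d\Pi_{\hat\alpha_A}(\theta\mid X)\le Cr_n. \]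
   Context: For fixed $\alpha$, the posterior is $\Pi_\alpha[\cdot\mid X]=\bigotimes_{i=1}^n((1-a(X_i))\delta_0+a(X_i)G_{X_i})$ with $a(x)=\frac{\alpha g(x)}{(1-\alpha)\phi(x)+\alpha g(x)}$ and $G_x$ of density $\gamma_x(u)=\phi(x-u)\gamma(u)/g(x)$; $\Pi_{\hat\alpha_A}[\cdot\mid X]$ is this with $\alpha=\hat\alpha_A$. The threshold $t(\alpha)>0$ is the posterior median threshold for fixed $\alpha$: the coordinatewise posterior median of $\theta_i$ is $0$ iff $|X_i|\le t(\alpha)$; $t(\cdot)$ is continuous and strictly decreasing, hence invertible. $\|\cdot\|$ is the Euclidean norm. *)

theory Defs
  imports "HOL-Probability.Probability"
begin

definition phi :: "real \<Rightarrow> real" where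
  "phi x = std_normal_density x"

definition cauchy_dens :: "real \<Rightarrow> real" where
  "cauchy_dens x = 1 / (pi * (1 + x\<^sup>2))"

definition gmarg :: "real \<Rightarrow> real" where
  "gmarg x = (LINT u|lborel. phi (x - u) * cauchy_dens u)"

definition post_weight :: "real \<Rightarrow> real \<Rightarrow> real" where
  "post_weight \<alpha> x = \<alpha> * gmarg x / ((1 - \<alpha>) * phi x + \<alpha> * gmarg x)"

definition G_post :: "real \<Rightarrow> real measure" where
  "G_post x = density lborel (\<lambda>u. ennreal (phi (x - u) * cauchy_dens u / gmarg x))"

definition post_coord :: "real \<Rightarrow> real \<Rightarrow> real measure" where
  "post_coord \<alpha> x = measure_of UNIV (sets borel)
     (\<lambda>A. ennreal (1 - post_weight \<alpha> x) * indicator A 0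
          + ennreal (post_weight \<alpha> x) * emeasure (G_post x) A)"

definition posterior :: "nat \<Rightarrow> real \<Rightarrow> (nat \<Rightarrow> real) \<Rightarrow> (nat \<Rightarrow> real) measure" where
  "posterior n \<alpha> X = PiM {..<n} (\<lambda>i. post_coord \<alpha> (X i))"

definition is_median :: "real measure \<Rightarrow> real \<Rightarrow> bool" where
  "is_median \<mu> m \<longleftrightarrow> measure \<mu> {..m} \<ge> 1/2 \<and> measure \<mu> {m..} \<ge> 1/2"

text \<open>Posterior median threshold t(alpha): the posterior median of theta_i is 0 iff |X_i| <= t(alpha).\<close>
definition thr :: "real \<Rightarrow> real" where
  "thr \<alpha> = Sup {x. 0 \<le> x \<and> is_median (post_coord \<alpha> x) 0}"

definition thr_inv :: "real \<Rightarrow> real" where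
  "thr_inv y = (THE \<alpha>. 0 < \<alpha> \<and> \<alpha> \<le> 1 \<and> thr \<alpha> = y)"

definition loglik :: "nat \<Rightarrow> (nat \<Rightarrow> real) \<Rightarrow> real \<Rightarrow> real" where
  "loglik n X \<alpha> = (\<Sum>i<n. ln ((1 - \<alpha>) * phi (X i) + \<alpha> * gmarg (X i)))"

definition alpha_low :: "nat \<Rightarrow> real" where
  "alpha_low n = thr_inv (sqrt (2 * ln (real n)))"

definition t_n :: "nat \<Rightarrow> real" where
  "t_n n = sqrt (2 * ln (real n) - 5 * ln (ln (real n)))"

definition t_A :: "real \<Rightarrow> nat \<Rightarrow> real" where
  "t_A A n = sqrt (2 * (1 + A) * ln (real n))"

definition alpha_A :: "real \<Rightarrow> nat \<Rightarrow> real" where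
  "alpha_A A n = thr_inv (t_A A n)"

definition alpha_mod :: "real \<Rightarrow> nat \<Rightarrow> real \<Rightarrow> real" where
  "alpha_mod A n ahat = (if thr ahat \<le> t_n n then ahat else alpha_A A n)"

definition is_mmle :: "nat \<Rightarrow> ((nat \<Rightarrow> real) \<Rightarrow> real) \<Rightarrow> bool" where
  "is_mmle n ahat \<longleftrightarrow>
     ahat \<in> borel_measurable (PiM {..<n} (\<lambda>_. lborel)) \<and>
     (\<forall>X \<in> space (PiM {..<n} (\<lambda>_. lborel)).
        alpha_low n \<le> ahat X \<and> ahat X \<le> 1 \<and>
        (\<forall>\<alpha>. alpha_low n \<le> \<alpha> \<and> \<alpha> \<le> 1 \<longrightarrow> loglik n X \<alpha> \<le> loglik n X (ahat X)))"

definition data_law :: "nat \<Rightarrow> (nat \<Rightarrow> real) \<Rightarrow> (nat \<Rightarrow> real) measure" where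
  "data_law n \<theta> = PiM {..<n} (\<lambda>i. density lborel (\<lambda>x. ennreal (normal_density (\<theta> i) 1 x)))"

definition ell0 :: "nat \<Rightarrow> nat \<Rightarrow> (nat \<Rightarrow> real) set" where
  "ell0 n s = {\<theta>. card {i \<in> {..<n}. \<theta> i \<noteq> 0} \<le> s}"

definition rate :: "nat \<Rightarrow> nat \<Rightarrow> real" where
  "rate n s = 2 * real s * ln (real n / real s)"

end

theory Submission
  imports Defs "HOL-Real_Asymp.Real_Asymp"
begin

text \<open>
  The posterior median at \<open>x \<ge> 0\<close> vanishes iff \<open>H x \<le> (1 - \<alpha>) / \<alpha>\<close>, where \<open>H\<close> is \<open>1 / phi x\<close> times the
  difference of the parts of \<open>gmarg x\<close> coming from positive and negative means. Hence the threshold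
  inverts \<open>t \<mapsto> 1 / (1 + H t)\<close>, and \<open>1 / \<alpha>\<close> is of order \<open>exp (t\<^sup>2 / 2) / (1 + t\<^sup>2)\<close>.

  \<^emph>\<open>Signals.\<close> The risk of a coordinate is at most a constant times
  \<open>1 + (X\<^sub>i - \<theta>\<^sub>i)\<^sup>2 + min (X\<^sub>i\<^sup>2) (t\<^sup>2)\<close>. Optimality of the estimated weight bounds the sum of the posterior
  weights by \<open>2 n \<alpha>\<close>, and each of them dominates \<open>\<alpha> exp (min (X\<^sub>i\<^sup>2) (t\<^sup>2) / 4)\<close>. So the average of these
  exponentials is bounded for every data set, and convexity of \<open>exp\<close> bounds the truncated squares
  over at most \<open>s\<close> coordinates by \<open>s ln (n / s)\<close>. Passing from the estimate to the modified one
  changes the squared threshold by a factor of at most \<open>2 (1 + A)\<close>.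

  \<^emph>\<open>Noise.\<close> The risk of a coordinate is at most a constant times \<open>a(X\<^sub>i) (1 + X\<^sub>i\<^sup>2)\<close>, whose mean is of
  order \<open>\<alpha> L\<close> with \<open>L\<^sup>2 = ln (1 / \<alpha>)\<close>. The score has mean below \<open>- c / L\<close> and second moment at
  most of order \<open>1 / (\<alpha> L)\<close>, so by concavity of the likelihood and Chernoff's bound the estimate exceeds
  a multiple of \<open>(s / n) sqrt (ln (n / s))\<close> while its threshold is below \<open>t_n\<close> only with probability
  \<open>exp (- c (ln n)\<^sup>2)\<close>. Below that level the risk is of order \<open>s ln (n / s)\<close>, and the default weight
  \<open>alpha_A\<close> contributes \<open>o(1)\<close>.
\<close>

subsection \<open>Gaussian density and its convolution with the Cauchy density\<close>

lemma phi_alt: "phi x = exp (- x\<^sup>2 / 2) / sqrt (2 * pi)"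
  by (simp add: phi_def std_normal_density_def)

lemma phi_pos [simp]: "phi x > 0"
  by (simp add: phi_alt)

lemma phi_nonneg [simp]: "phi x \<ge> 0"
  by (simp add: less_imp_le)

lemma phi_neq_0 [simp]: "phi x \<noteq> 0"
  using phi_pos[of x] by linarith

lemma phi_measurable [measurable]: "phi \<in> borel_measurable borel"
  unfolding phi_def by measurable

lemma sqrt_2pi_ge_2: "sqrt (2 * pi) \<ge> 2"
  by (rule real_le_rsqrt) (use pi_gt3 in simp)

lemma sqrt_2pi_le_3: "sqrt (2 * pi) \<le> 3"
  by (rule real_le_lsqrt) (use pi_less_4 in simp_all)

lemma phi_le_exp: "phi x \<le> exp (- x\<^sup>2 / 2) / 2"
  unfolding phi_alt by (rule divide_left_mono) (use sqrt_2pi_ge_2 in simp_all)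

lemma phi_ge_exp: "exp (- x\<^sup>2 / 2) / 3 \<le> phi x"
  unfolding phi_alt by (rule divide_left_mono) (use sqrt_2pi_le_3 in simp_all)

lemma phi_le_1: "phi x \<le> 1"
proof -
  have "exp (- x\<^sup>2 / 2) \<le> 1" by simp
  then show ?thesis using phi_le_exp[of x] by linarith
qed

lemma integrable_phi: "integrable lborel phi"
  unfolding phi_def by simp

lemma integral_phi: "(LINT x|lborel. phi x) = 1"
  unfolding phi_def by simp

lemma has_integral_phi_sq: "has_bochner_integral lborel (\<lambda>x. phi x * x\<^sup>2) 1"
  using std_normal_moment_even[of 1] by (simp add: phi_def)

lemma has_integral_phi_fourth: "has_bochner_integral lborel (\<lambda>x. phi x * x ^ 4) 3"
  using std_normal_moment_even[of 2] by (simp add: phi_def fact_numeral)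

lemma cauchy_dens_pos [simp]: "cauchy_dens x > 0"
  by (simp add: cauchy_dens_def pos_add_strict add_pos_nonneg)

lemma cauchy_dens_nonneg [simp]: "cauchy_dens x \<ge> 0"
  by (simp add: less_imp_le)

lemma cauchy_dens_minus [simp]: "cauchy_dens (- x) = cauchy_dens x"
  by (simp add: cauchy_dens_def)

lemma cauchy_dens_measurable [measurable]: "cauchy_dens \<in> borel_measurable borel"
  unfolding cauchy_dens_def by measurable

lemma has_integral_inverse_1_plus_square:
  "has_bochner_integral lborel (\<lambda>x::real. 1 / (1 + x\<^sup>2)) pi"
proof -
  have "integrable lborel (\<lambda>x::real. inverse (1 + x\<^sup>2))"
    using integrable_inverse_1_plus_square by (simp add: set_integrable_def)
  moreover have "(LINT x|lborel. inverse (1 + x\<^sup>2)) = pi"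
    using LBINT_inverse_1_plus_square
    by (simp add: interval_lebesgue_integral_def set_lebesgue_integral_def)
  ultimately show ?thesis
    by (simp add: has_bochner_integral_iff inverse_eq_divide)
qed

lemma has_integral_cauchy_dens: "has_bochner_integral lborel cauchy_dens 1"
proof -
  have "has_bochner_integral lborel (\<lambda>x::real. (1 / pi) * (1 / (1 + x\<^sup>2))) ((1 / pi) * pi)"
    using has_integral_inverse_1_plus_square by (intro has_bochner_integral_mult_right) auto
  then show ?thesis by (simp add: cauchy_dens_def[abs_def])
qed

text \<open>Peetre's inequality, obtained by writing the difference as a sum of squares plus 1. It
  trades decay of the Cauchy density in \<open>u\<close> for decay in \<open>x\<close>, at the price
  of a polynomial in \<open>x - u\<close> that the Gaussian factor absorbs.\<close>

lemma one_plus_square_le_mult: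
  fixes x y :: real
  shows "1 + x\<^sup>2 \<le> 2 * (1 + (x - y)\<^sup>2) * (1 + y\<^sup>2)"
proof -
  have "0 \<le> (x - 2 * y)\<^sup>2 + 2 * ((x - y) * y)\<^sup>2 + 1" by simp
  moreover have "2 * (1 + (x - y)\<^sup>2) * (1 + y\<^sup>2) - (1 + x\<^sup>2) = (x - 2 * y)\<^sup>2 + 2 * ((x - y) * y)\<^sup>2 + 1"
    by (simp add: power2_eq_square algebra_simps)
  ultimately show ?thesis by linarith
qed

lemma cauchy_dens_le: "cauchy_dens u \<le> 2 / (pi * (1 + x\<^sup>2)) * (1 + (x - u)\<^sup>2)"
proof -
  have "0 < 1 + u\<^sup>2" "0 < 1 + x\<^sup>2" by (simp_all add: add_pos_nonneg)
  then have "1 / (1 + u\<^sup>2) \<le> 2 * (1 + (x - u)\<^sup>2) / (1 + x\<^sup>2)"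
    using one_plus_square_le_mult[of x u] by (simp add: field_simps)
  then have "1 / (1 + u\<^sup>2) / pi \<le> 2 * (1 + (x - u)\<^sup>2) / (1 + x\<^sup>2) / pi"
    by (rule divide_right_mono) simp
  then show ?thesis by (simp add: cauchy_dens_def field_simps)
qed

lemma cauchy_dens_ge: "1 / (2 * pi * (1 + x\<^sup>2)) * (1 / (1 + (x - u)\<^sup>2)) \<le> cauchy_dens u"
proof -
  have *: "0 < 1 + u\<^sup>2" "0 < 1 + x\<^sup>2" "0 < 1 + (x - u)\<^sup>2" by (simp_all add: add_pos_nonneg)
  have "1 + u\<^sup>2 \<le> 2 * (1 + (x - u)\<^sup>2) * (1 + x\<^sup>2)"
    using one_plus_square_le_mult[of u x] by (simp add: power2_commute)
  then have "1 / (2 * (1 + (x - u)\<^sup>2) * (1 + x\<^sup>2)) \<le> 1 / (1 + u\<^sup>2)"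
    using * by (intro divide_left_mono) auto
  then have "1 / (2 * (1 + (x - u)\<^sup>2) * (1 + x\<^sup>2)) / pi \<le> 1 / (1 + u\<^sup>2) / pi"
    by (rule divide_right_mono) simp
  then show ?thesis by (simp add: cauchy_dens_def algebra_simps)
qed

lemma integral_reflect_shift:
  fixes f :: "real \<Rightarrow> real"
  shows "(LINT u|lborel. f (x - u)) = (LINT v|lborel. f v)"
  using lborel_integral_real_affine[of "-1" f x] by simp

lemma integrable_reflect_shift:
  fixes f :: "real \<Rightarrow> real"
  shows "integrable lborel f \<Longrightarrow> integrable lborel (\<lambda>u. f (x - u))"
  using lborel_integrable_real_affine[of f "-1" x] by simp

text \<open>Peetre's inequality pulls \<open>1 / (1 + x^2)\<close> out of the integral, and the
  substitution \<open>v = x - u\<close> leaves a Gaussian moment. The weight \<open>h = 1\<close>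
  serves for \<open>gmarg\<close>, and \<open>h v = v^2\<close> for the second moment of the slab
  posterior about \<open>x\<close>.\<close>

lemma weighted_convolution:
  fixes h :: "real \<Rightarrow> real"
  assumes [measurable]: "h \<in> borel_measurable borel" and "\<And>v. h v \<ge> 0"
    and int: "has_bochner_integral lborel (\<lambda>v. phi v * (h v * (1 + v\<^sup>2))) c"
  shows "integrable lborel (\<lambda>u. h (x - u) * (phi (x - u) * cauchy_dens u))"
    and "(LINT u|lborel. h (x - u) * (phi (x - u) * cauchy_dens u)) \<le> 2 * c / (pi * (1 + x\<^sup>2))"
proof -
  let ?k = "2 / (pi * (1 + x\<^sup>2))"
  let ?m = "\<lambda>u. ?k * (phi (x - u) * (h (x - u) * (1 + (x - u)\<^sup>2)))"
  have bound: "h (x - u) * (phi (x - u) * cauchy_dens u) \<le> ?m u" for u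
  proof -
    have "(h (x - u) * phi (x - u)) * cauchy_dens u
        \<le> (h (x - u) * phi (x - u)) * (?k * (1 + (x - u)\<^sup>2))"
      by (intro mult_left_mono cauchy_dens_le mult_nonneg_nonneg assms) simp
    then show ?thesis by (simp only: mult_ac)
  qed
  have m: "integrable lborel ?m"
    using integrable_reflect_shift[of "\<lambda>v. phi v * (h v * (1 + v\<^sup>2))" x] int
    by (auto simp: has_bochner_integral_iff)
  show i: "integrable lborel (\<lambda>u. h (x - u) * (phi (x - u) * cauchy_dens u))"
    by (rule Bochner_Integration.integrable_bound[OF m])
      (use bound assms(2) in \<open>auto simp: abs_mult intro!: AE_I2 order.trans[OF bound]\<close>)
  have "(LINT u|lborel. h (x - u) * (phi (x - u) * cauchy_dens u)) \<le> (LINT u|lborel. ?m u)"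
    by (rule integral_mono[OF i m]) (rule bound)
  also have "\<dots> = ?k * c"
    using integral_reflect_shift[of "\<lambda>v. phi v * (h v * (1 + v\<^sup>2))" x] int
    by (simp add: has_bochner_integral_iff)
  finally show "(LINT u|lborel. h (x - u) * (phi (x - u) * cauchy_dens u)) \<le> 2 * c / (pi * (1 + x\<^sup>2))"
    by simp
qed

lemma has_integral_phi_1_plus_sq: "has_bochner_integral lborel (\<lambda>v. phi v * (1 + v\<^sup>2)) 2"
proof -
  have "has_bochner_integral lborel (\<lambda>v. phi v + phi v * v\<^sup>2) (1 + 1)"
    by (intro has_bochner_integral_add has_integral_phi_sq)
      (simp add: has_bochner_integral_iff integrable_phi integral_phi)
  then show ?thesis by (simp add: algebra_simps)
qed

lemma has_integral_phi_sq_1_plus_sq: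
  "has_bochner_integral lborel (\<lambda>v. phi v * (v\<^sup>2 * (1 + v\<^sup>2))) 4"
proof -
  have "has_bochner_integral lborel (\<lambda>v. phi v * v\<^sup>2 + phi v * v ^ 4) (1 + 3)"
    by (intro has_bochner_integral_add has_integral_phi_sq has_integral_phi_fourth)
  then show ?thesis by (simp add: algebra_simps power2_eq_square power4_eq_xxxx)
qed

lemma integrable_gmarg_integrand: "integrable lborel (\<lambda>u. phi (x - u) * cauchy_dens u)"
  using weighted_convolution(1)[of "\<lambda>_. 1" 2 x] has_integral_phi_1_plus_sq by simp

lemma gmarg_le: "gmarg x \<le> 4 / (pi * (1 + x\<^sup>2))"
  using weighted_convolution(2)[of "\<lambda>_. 1" 2 x] has_integral_phi_1_plus_sq by (simp add: gmarg_def)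

lemma gmarg_le_2: "gmarg x \<le> 2 / (1 + x\<^sup>2)"
proof -
  have p: "1 + x\<^sup>2 > 0" by (simp add: add_pos_nonneg)
  have "4 / (pi * (1 + x\<^sup>2)) \<le> 4 / (2 * (1 + x\<^sup>2))"
    using pi_gt3 p by (intro divide_left_mono mult_right_mono) auto
  also have "\<dots> = 2 / (1 + x\<^sup>2)" using p by (simp add: divide_simps)
  finally show ?thesis using gmarg_le[of x] by simp
qed

text \<open>Peetre's inequality in the other direction leaves \<open>1 / (1 + v^2)\<close>, which is
  bounded below by its tangent \<open>3 / 4 - w / 4\<close> in \<open>w = v^2\<close> at
  \<open>w = 1\<close>. Only the Gaussian second moment then enters, through
  \<open>3 / 4 - 1 / 4 = 1 / 2\<close>.\<close>

lemma gmarg_ge: "1 / (4 * pi * (1 + x\<^sup>2)) \<le> gmarg x"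
proof -
  let ?k = "1 / (2 * pi * (1 + x\<^sup>2))"
  let ?q = "\<lambda>v. phi v * (3 / 4 - v\<^sup>2 / 4)"
  have "has_bochner_integral lborel (\<lambda>v. 3 / 4 * phi v - 1 / 4 * (phi v * v\<^sup>2)) (3 / 4 * 1 - 1 / 4 * 1)"
    by (intro has_bochner_integral_diff has_bochner_integral_mult_right has_integral_phi_sq)
      (simp add: has_bochner_integral_iff integrable_phi integral_phi)
  then have q: "has_bochner_integral lborel ?q (1 / 2)"
    by (simp add: algebra_simps)
  have tangent: "3 / 4 - w / 4 \<le> 1 / (1 + w)" if "w \<ge> 0" for w :: real
  proof -
    have "(3 / 4 - w / 4) * (1 + w) = 1 - (w - 1)\<^sup>2 / 4"
      by (simp add: power2_eq_square field_simps)
    then have "(3 / 4 - w / 4) * (1 + w) \<le> 1" by simp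
    then show ?thesis using that by (simp add: field_simps)
  qed
  have bound: "?k * ?q (x - u) \<le> phi (x - u) * cauchy_dens u" for u
  proof -
    have "?k * (3 / 4 - (x - u)\<^sup>2 / 4) \<le> ?k * (1 / (1 + (x - u)\<^sup>2))"
      by (intro mult_left_mono tangent) (auto simp: add_nonneg_nonneg)
    also have "\<dots> \<le> cauchy_dens u" by (rule cauchy_dens_ge)
    finally have "phi (x - u) * (?k * (3 / 4 - (x - u)\<^sup>2 / 4)) \<le> phi (x - u) * cauchy_dens u"
      by (rule mult_left_mono) simp
    then show ?thesis by (simp only: mult_ac)
  qed
  have "?k * (1 / 2) = (LINT u|lborel. ?k * ?q (x - u))"
    using q integral_reflect_shift[of ?q x] by (simp only: integral_mult_right_zero has_bochner_integral_iff)
  also have "\<dots> \<le> gmarg x"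
    unfolding gmarg_def
    using q integrable_reflect_shift[of ?q x]
    by (intro integral_mono integrable_gmarg_integrand bound) (auto simp: has_bochner_integral_iff)
  finally show ?thesis by simp
qed

lemma gmarg_ge_16: "1 / (16 * (1 + x\<^sup>2)) \<le> gmarg x"
proof -
  have p: "1 + x\<^sup>2 > 0" by (simp add: add_pos_nonneg)
  have "1 / (16 * (1 + x\<^sup>2)) \<le> 1 / (4 * pi * (1 + x\<^sup>2))"
    using pi_less_4 p by (intro divide_left_mono mult_right_mono) auto
  then show ?thesis using gmarg_ge[of x] by simp
qed

lemma gmarg_pos [simp]: "gmarg x > 0"
proof -
  have "1 / (16 * (1 + x\<^sup>2)) > 0" by (simp add: add_pos_nonneg)
  then show ?thesis using gmarg_ge_16[of x] by linarith
qed

lemma gmarg_nonneg [simp]: "gmarg x \<ge> 0"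
  by (simp add: less_imp_le)

lemma gmarg_neq_0 [simp]: "gmarg x \<noteq> 0"
  using gmarg_pos[of x] by linarith

lemma gmarg_measurable [measurable]: "gmarg \<in> borel_measurable borel"
  unfolding gmarg_def by measurable

text \<open>Tonelli's theorem: integrating out \<open>x\<close> first leaves the Cauchy density. The
  equal masses of \<open>gmarg\<close> and \<open>phi\<close> cancel later in the mean of the
  score.\<close>

lemma has_integral_gmarg: "has_bochner_integral lborel gmarg 1"
proof (rule has_bochner_integral_nn_integral)
  have shift: "(\<integral>\<^sup>+ x. ennreal (phi (x - u)) \<partial>lborel) = 1" for u
  proof -
    have "(\<integral>\<^sup>+ x. ennreal (phi (x - u)) \<partial>lborel) = (\<integral>\<^sup>+ x. ennreal (phi x) \<partial>lborel)"
      using nn_integral_real_affine[of "\<lambda>x. ennreal (phi x)" 1 "-u"] by (simp add: algebra_simps)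
    also have "\<dots> = 1"
      by (subst nn_integral_eq_integral) (auto simp: integrable_phi integral_phi)
    finally show ?thesis .
  qed
  have "(\<integral>\<^sup>+ x. ennreal (gmarg x) \<partial>lborel)
      = (\<integral>\<^sup>+ x. \<integral>\<^sup>+ u. ennreal (phi (x - u) * cauchy_dens u) \<partial>lborel \<partial>lborel)"
    unfolding gmarg_def
    by (intro nn_integral_cong, subst nn_integral_eq_integral)
      (auto intro!: integrable_gmarg_integrand AE_I2)
  also have "\<dots> = (\<integral>\<^sup>+ u. \<integral>\<^sup>+ x. ennreal (phi (x - u) * cauchy_dens u) \<partial>lborel \<partial>lborel)"
    by (rule lborel_pair.Fubini'[symmetric]) measurable
  also have "\<dots> = (\<integral>\<^sup>+ u. ennreal (cauchy_dens u) \<partial>lborel)"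
    by (intro nn_integral_cong)
      (simp add: ennreal_mult nn_integral_multc shift)
  also have "\<dots> = 1"
    using has_integral_cauchy_dens
    by (subst nn_integral_eq_integral) (auto simp: has_bochner_integral_iff)
  finally show "(\<integral>\<^sup>+ x. ennreal (gmarg x) \<partial>lborel) = ennreal 1" by simp
qed auto

text \<open>Numerator and \<open>gmarg x\<close> both decay like \<open>1 / (1 + x^2)\<close>, so
  their quotient is bounded uniformly in \<open>x\<close>: under the heavy Cauchy tail the slab
  posterior stays close to the observation.\<close>

lemma G_post_variance_bound:
  "(\<integral>\<^sup>+ u. ennreal ((u - x)\<^sup>2) \<partial>G_post x) \<le> ennreal 32"
proof -
  have p: "1 + x\<^sup>2 > 0" by (simp add: add_pos_nonneg)
  have i: "integrable lborel (\<lambda>u. (x - u)\<^sup>2 * (phi (x - u) * cauchy_dens u))"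
    and b: "(LINT u|lborel. (x - u)\<^sup>2 * (phi (x - u) * cauchy_dens u)) \<le> 2 * 4 / (pi * (1 + x\<^sup>2))"
    using weighted_convolution[of "\<lambda>v. v\<^sup>2" 4 x] has_integral_phi_sq_1_plus_sq by simp_all
  have "(\<integral>\<^sup>+ u. ennreal ((u - x)\<^sup>2) \<partial>G_post x)
      = (\<integral>\<^sup>+ u. ennreal ((x - u)\<^sup>2 * (phi (x - u) * cauchy_dens u) / gmarg x) \<partial>lborel)"
    unfolding G_post_def
    by (subst nn_integral_density) (auto simp: ennreal_mult'[symmetric] power2_commute mult_ac intro!: nn_integral_cong)
  also have "\<dots> = ennreal ((LINT u|lborel. (x - u)\<^sup>2 * (phi (x - u) * cauchy_dens u)) / gmarg x)"
    using i by (subst nn_integral_eq_integral) auto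
  also have "(LINT u|lborel. (x - u)\<^sup>2 * (phi (x - u) * cauchy_dens u)) / gmarg x
      \<le> (2 * 4 / (pi * (1 + x\<^sup>2))) / (1 / (4 * pi * (1 + x\<^sup>2)))"
    using gmarg_ge[of x] p b
    by (intro frac_le) (auto intro!: integral_nonneg)
  also have "\<dots> = 32" using p by (simp add: divide_simps)
  finally show ?thesis by (simp add: ennreal_leI)
qed

subsection \<open>Odds of the posterior median\<close>

definition gdiff :: "real \<Rightarrow> real" where
  "gdiff x = (LINT u|lborel. sgn u * (phi (x - u) * cauchy_dens u))"

text \<open>The \<open>H\<close> of the overview: the prior odds
  \<open>(1 - \<alpha>) / \<alpha>\<close> for which \<open>x \<ge> 0\<close> is exactly the median
  threshold.\<close>

definition med_odds :: "real \<Rightarrow> real" where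
  "med_odds x = gdiff x / phi x"

lemma integrable_gdiff_integrand: "integrable lborel (\<lambda>u. sgn u * (phi (x - u) * cauchy_dens u))"
  by (rule Bochner_Integration.integrable_bound[OF integrable_gmarg_integrand[of x]])
    (auto simp: abs_mult abs_sgn_eq)

lemma gdiff_le_gmarg: "gdiff x \<le> gmarg x"
  unfolding gdiff_def gmarg_def
proof (intro integral_mono integrable_gdiff_integrand integrable_gmarg_integrand)
  fix u :: real
  have "0 \<le> phi (x - u) * cauchy_dens u" by simp
  then show "sgn u * (phi (x - u) * cauchy_dens u) \<le> phi (x - u) * cauchy_dens u"
    by (cases "u > 0"; cases "u = 0") (auto simp: sgn_if)
qed

lemma med_odds_le: "med_odds x \<le> gmarg x / phi x"
  unfolding med_odds_def using gdiff_le_gmarg by (intro divide_right_mono) auto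

lemma phi_shift_div: "phi (x - u) / phi x = sqrt (2 * pi) * (exp (x * u) * phi u)"
  by (simp add: phi_alt exp_add[symmetric] exp_diff[symmetric] power2_eq_square algebra_simps add_divide_distrib diff_divide_distrib)

lemma med_odds_alt:
  "med_odds x = (LINT u|lborel. sqrt (2 * pi) * (sgn u * exp (x * u)) * (phi u * cauchy_dens u))"
proof -
  have "med_odds x = (LINT u|lborel. sgn u * (phi (x - u) * cauchy_dens u) / phi x)"
    by (simp add: med_odds_def gdiff_def)
  also have "\<dots> = (LINT u|lborel. sgn u * (phi (x - u) / phi x) * cauchy_dens u)"
    by (simp add: mult_ac)
  also have "\<dots> = (LINT u|lborel. sqrt (2 * pi) * (sgn u * exp (x * u)) * (phi u * cauchy_dens u))"
    by (simp add: phi_shift_div mult_ac)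
  finally show ?thesis .
qed

lemma integrable_med_odds_integrand:
  "integrable lborel (\<lambda>u. sqrt (2 * pi) * (sgn u * exp (x * u)) * (phi u * cauchy_dens u))"
proof -
  have "integrable lborel (\<lambda>u. sgn u * (phi (x - u) * cauchy_dens u) / phi x)"
    using integrable_gdiff_integrand by simp
  also have "(\<lambda>u. sgn u * (phi (x - u) * cauchy_dens u) / phi x)
      = (\<lambda>u. sgn u * (phi (x - u) / phi x) * cauchy_dens u)" by (simp add: mult_ac)
  finally show ?thesis by (simp add: phi_shift_div mult_ac)
qed

text \<open>Averaging the integrand with its reflection turns \<open>exp\<close> into
  \<open>sinh\<close>. The new integrand is nonnegative for \<open>x \<ge> 0\<close> and increasing
  in \<open>x\<close>, which the signed one is not.\<close>

lemma med_odds_symmetrized: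
  "med_odds x = (LINT u|lborel. sqrt (2 * pi) * (sgn u * sinh (x * u)) * (phi u * cauchy_dens u))"
  and integrable_med_odds_symmetrized:
  "integrable lborel (\<lambda>u. sqrt (2 * pi) * (sgn u * sinh (x * u)) * (phi u * cauchy_dens u))"
proof -
  let ?f = "\<lambda>u. sqrt (2 * pi) * (sgn u * exp (x * u)) * (phi u * cauchy_dens u)"
  have i: "integrable lborel ?f" by (rule integrable_med_odds_integrand)
  have i': "integrable lborel (\<lambda>u. ?f (0 - u))" by (rule integrable_reflect_shift[OF i])
  have eq: "(\<lambda>u. (?f u + ?f (0 - u)) / 2)
      = (\<lambda>u. sqrt (2 * pi) * (sgn u * sinh (x * u)) * (phi u * cauchy_dens u))"
    by (auto simp: sinh_field_def phi_alt sgn_minus algebra_simps add_divide_distrib diff_divide_distrib)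
  have "(LINT u|lborel. (?f u + ?f (0 - u)) / 2) = (integral\<^sup>L lborel ?f + integral\<^sup>L lborel ?f) / 2"
    using i i' integral_reflect_shift[of ?f 0] by (subst integral_divide_zero, subst Bochner_Integration.integral_add) auto
  then show "med_odds x = (LINT u|lborel. sqrt (2 * pi) * (sgn u * sinh (x * u)) * (phi u * cauchy_dens u))"
    unfolding eq med_odds_alt by simp
  have "integrable lborel (\<lambda>u. (?f u + ?f (0 - u)) / 2)"
    using i i' by auto
  then show "integrable lborel (\<lambda>u. sqrt (2 * pi) * (sgn u * sinh (x * u)) * (phi u * cauchy_dens u))"
    unfolding eq .
qed

lemma med_odds_0 [simp]: "med_odds 0 = 0"
  by (simp add: med_odds_symmetrized)

text \<open>Since \<open>cosh\<close> is at least 1, \<open>sinh\<close> increases at least as fast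
  as the identity. The resulting linear growth yields strict monotonicity and unboundedness of
  \<open>med_odds\<close> at once.\<close>

lemma med_odds_diff_ge:
  assumes "x \<le> y"
  shows "(y - x) * (LINT u|lborel. sqrt (2 * pi) * \<bar>u\<bar> * (phi u * cauchy_dens u)) \<le> med_odds y - med_odds x" (is "?l \<le> _")
    and "(LINT u|lborel. sqrt (2 * pi) * \<bar>u\<bar> * (phi u * cauchy_dens u)) > 0" (is "?I > 0")
proof -
  let ?w = "\<lambda>u. sqrt (2 * pi) * \<bar>u\<bar> * (phi u * cauchy_dens u)"
  let ?f = "\<lambda>x u. sqrt (2 * pi) * (sgn u * sinh (x * u)) * (phi u * cauchy_dens u)"
  have key: "sinh b - sinh a \<ge> b - a" if "a \<le> b" for a b :: real
  proof -
    have "sinh a - a \<le> sinh b - b"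
      by (rule DERIV_nonneg_imp_nondecreasing[OF that, where f="\<lambda>z. sinh z - z"])
        (auto intro!: derivative_eq_intros exI simp: cosh_real_ge_1)
    then show ?thesis by simp
  qed
  have sg: "sgn u * (sinh (y * u) - sinh (x * u)) \<ge> (y - x) * \<bar>u\<bar>" if "x \<le> y" for u x y :: real
  proof (cases "u > 0")
    case True
    with key[of "x * u" "y * u"] that show ?thesis by (simp add: algebra_simps mult_right_mono)
  next
    case False
    with key[of "y * u" "x * u"] that show ?thesis
      by (cases "u = 0") (auto simp: algebra_simps mult_right_mono_neg)
  qed
  have le: "(y - x) * ?w u \<le> ?f y u - ?f x u" if "x \<le> y" for u x y
  proof -
    have "(sqrt (2 * pi) * (phi u * cauchy_dens u)) * ((y - x) * \<bar>u\<bar>)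
        \<le> (sqrt (2 * pi) * (phi u * cauchy_dens u)) * (sgn u * (sinh (y * u) - sinh (x * u)))"
      by (intro mult_left_mono sg that) simp
    then show ?thesis by (simp add: algebra_simps)
  qed
  \<comment> \<open>The bound \<open>le\<close> with 0 and 1 for \<open>x\<close> and
    \<open>y\<close> dominates the weight by the symmetrized integrand at 1.\<close>
  have w: "integrable lborel ?w"
  proof (rule Bochner_Integration.integrable_bound[OF integrable_med_odds_symmetrized[of 1]])
    show "AE u in lborel. norm (?w u) \<le> norm (?f 1 u)"
    proof (rule AE_I2)
      fix u
      have "?w u \<le> ?f 1 u" using le[of 0 1 u] by simp
      moreover have "0 \<le> ?w u" by simp
      ultimately show "norm (?w u) \<le> norm (?f 1 u)" unfolding real_norm_def by linarith
    qed
  qed measurable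
  have "?l = (LINT u|lborel. (y - x) * ?w u)" by simp
  also have "\<dots> \<le> (LINT u|lborel. ?f y u - ?f x u)"
    using w by (intro integral_mono le assms Bochner_Integration.integrable_diff integrable_med_odds_symmetrized) auto
  also have "\<dots> = med_odds y - med_odds x"
    by (simp add: integrable_med_odds_symmetrized med_odds_symmetrized)
  finally show "?l \<le> med_odds y - med_odds x" .
  have "?I \<noteq> 0"
  proof
    assume "?I = 0"
    then have "AE u in lborel. ?w u = 0"
      by (subst (asm) integral_nonneg_eq_0_iff_AE[OF w]) auto
    then have "AE u in lborel. (u::real) = 0"
      by eventually_elim (use cauchy_dens_pos phi_pos in \<open>simp add: less_imp_neq[THEN not_sym]\<close>)
    moreover have "AE u in lborel. (u::real) \<noteq> 0" by (rule AE_lborel_singleton)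
    ultimately have "AE u in (lborel :: real measure). False"
      by eventually_elim auto
    then show False by (simp add: AE_iff_null null_sets_def)
  qed
  moreover have "?I \<ge> 0" by (rule Bochner_Integration.integral_nonneg) auto
  ultimately show "?I > 0" by linarith
qed

lemma med_odds_strict_mono: "x < y \<Longrightarrow> med_odds x < med_odds y"
proof -
  assume "x < y"
  then have "0 < (y - x) * (LINT u|lborel. sqrt (2 * pi) * \<bar>u\<bar> * (phi u * cauchy_dens u))"
    using med_odds_diff_ge(2)[of x y] by (intro mult_pos_pos) auto
  also have "\<dots> \<le> med_odds y - med_odds x" using \<open>x < y\<close> by (intro med_odds_diff_ge) simp
  finally show ?thesis by simp
qed

lemma med_odds_mono: "x \<le> y \<Longrightarrow> med_odds x \<le> med_odds y"
  using med_odds_strict_mono[of x y] by (cases "x = y") auto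

lemma med_odds_nonneg: "x \<ge> 0 \<Longrightarrow> med_odds x \<ge> 0"
  using med_odds_mono[of 0 x] by simp

text \<open>Dominated convergence applied to \<open>gdiff\<close>; as \<open>phi\<close> is at most
  1, the Cauchy density itself is a dominating function.\<close>

lemma isCont_med_odds: "isCont med_odds x"
proof -
  have "isCont gdiff x"
    unfolding continuous_at_sequentially comp_def
  proof (intro allI impI)
    fix X assume X: "X \<longlonglongrightarrow> x"
    show "(\<lambda>n. gdiff (X n)) \<longlonglongrightarrow> gdiff x"
      unfolding gdiff_def
    proof (rule integral_dominated_convergence[where w=cauchy_dens])
      show "integrable lborel cauchy_dens" using has_integral_cauchy_dens by (simp add: has_bochner_integral_iff)
      show "AE u in lborel. (\<lambda>n. sgn u * (phi (X n - u) * cauchy_dens u)) \<longlonglongrightarrow> sgn u * (phi (x - u) * cauchy_dens u)"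
        unfolding phi_alt using X by (intro AE_I2 tendsto_intros) auto
      fix n
      show "AE u in lborel. norm (sgn u * (phi (X n - u) * cauchy_dens u)) \<le> cauchy_dens u"
        using phi_le_1 by (intro AE_I2) (auto simp: abs_mult abs_sgn_eq mult_left_le_one_le)
    qed auto
  qed
  moreover have "isCont phi x" unfolding phi_alt[abs_def] by (intro continuous_intros) auto
  ultimately show ?thesis
    unfolding med_odds_def[abs_def] by (intro continuous_intros) (auto simp: less_imp_neq[THEN not_sym])
qed

text \<open>Intermediate value theorem on \<open>{0..y / ?I}\<close>; the linear growth bound shows
  that \<open>y\<close> is reached by the right end.\<close>

lemma med_odds_surj:
  assumes "y \<ge> 0"
  obtains t where "t \<ge> 0" "med_odds t = y"
proof -
  let ?I = "LINT u|lborel. sqrt (2 * pi) * \<bar>u\<bar> * (phi u * cauchy_dens u)"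
  have I: "?I > 0" by (rule med_odds_diff_ge(2)[of 0 0]) simp
  have "med_odds (y / ?I) \<ge> y"
    using med_odds_diff_ge(1)[of 0 "y / ?I"] I assms by simp
  then have "\<exists>t. 0 \<le> t \<and> t \<le> y / ?I \<and> med_odds t = y"
    using assms I by (intro IVT) (auto simp: isCont_med_odds)
  then show ?thesis using that by blast
qed

text \<open>Laplace's method: the symmetrized integral is restricted to \<open>{t..t+1}\<close>,
  where \<open>t * u - u^2 / 2\<close> stays within \<open>1 / 2\<close> of its maximum
  \<open>t^2 / 2\<close> and the Cauchy density is of order \<open>1 / (1 + t^2)\<close>.\<close>

lemma med_odds_ge:
  assumes "t \<ge> 1"
  shows "exp (t\<^sup>2 / 2) / (100 * (1 + t\<^sup>2)) \<le> med_odds t"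
proof -
  let ?f = "\<lambda>u. sqrt (2 * pi) * (sgn u * sinh (t * u)) * (phi u * cauchy_dens u)"
  define k where "k = exp (t\<^sup>2 / 2) / (100 * (1 + t\<^sup>2))"
  have pos: "1 + t\<^sup>2 > 0" by (simp add: add_pos_nonneg)
  have bound: "k * indicator {t..t+1} u \<le> ?f u" for u
  proof (cases "u \<in> {t..t+1}")
    case False
    have "0 \<le> sgn u * sinh (t * u)"
      using assms by (auto simp: sgn_if sinh_real_nonneg_iff sinh_real_nonpos_iff zero_le_mult_iff mult_le_0_iff)
    then have "0 \<le> ?f u" by - (rule mult_nonneg_nonneg, rule mult_nonneg_nonneg, simp, assumption, simp)
    with False show ?thesis by simp
  next
    case True
    then have u: "t \<le> u" "u \<le> t + 1" "u > 0" using assms by auto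
    have quarter: "a / 4 \<le> (a - b) / 2" if "b \<le> 1" "2 \<le> a" for a b :: real
      using that by simp
    have tu: "1 \<le> t * u" using assms u mult_mono[of 1 t 1 u] by simp
    have "exp (- (t * u)) \<le> 1" using tu by simp
    moreover have "exp (t * u) \<ge> 2" using exp_ge_add_one_self[of "t * u"] tu by linarith
    ultimately have sinh: "sinh (t * u) \<ge> exp (t * u) / 4"
      unfolding sinh_field_def by (rule quarter)
    have "(u - t)\<^sup>2 \<le> 1" using u by (simp add: abs_square_le_1)
    then have "t * u - u\<^sup>2 / 2 \<ge> t\<^sup>2 / 2 - 1 / 2" by (simp add: power2_eq_square algebra_simps)
    then have e: "exp (t * u) * exp (- u\<^sup>2 / 2) \<ge> exp (t\<^sup>2 / 2) * exp (- 1 / 2)"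
      by (simp add: exp_add[symmetric])
    have "exp (- 1 / 2 :: real) \<ge> 1 / 2" using exp_ge_add_one_self[of "- 1 / 2 :: real"] by simp
    then have "exp (t\<^sup>2 / 2) * (1 / 2) \<le> exp (t\<^sup>2 / 2) * exp (- 1 / 2)" by (intro mult_left_mono) auto
    with e have e2: "exp (t * u) * exp (- u\<^sup>2 / 2) \<ge> exp (t\<^sup>2 / 2) / 2" by linarith
    have "u\<^sup>2 \<le> (t + 1)\<^sup>2" using u by (intro power_mono) auto
    moreover have "(t + 1)\<^sup>2 + (t - 1)\<^sup>2 = 2 * t\<^sup>2 + 2" by (simp add: power2_eq_square algebra_simps)
    moreover have "0 \<le> (t - 1)\<^sup>2" "0 \<le> t\<^sup>2" by simp_all
    ultimately have "1 + u\<^sup>2 \<le> 3 * (1 + t\<^sup>2)" unfolding distrib_left by linarith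
    then have "pi * (1 + u\<^sup>2) \<le> 4 * (3 * (1 + t\<^sup>2))"
      using pi_less_4 by (intro mult_mono) (auto simp: add_nonneg_nonneg)
    then have c: "cauchy_dens u \<ge> 1 / (12 * (1 + t\<^sup>2))"
      unfolding cauchy_dens_def using pos by (intro divide_left_mono mult_pos_pos) (auto simp: add_pos_nonneg)
    have "k = exp (t\<^sup>2 / 2) / 2 / 4 * (8 / (100 * (1 + t\<^sup>2)))" by (simp add: k_def)
    also have "\<dots> \<le> exp (t\<^sup>2 / 2) / 2 / 4 * (1 / (12 * (1 + t\<^sup>2)))"
      using pos by (intro mult_left_mono) (auto simp: divide_simps)
    also have "\<dots> \<le> (exp (t * u) * exp (- u\<^sup>2 / 2)) / 4 * cauchy_dens u"
      using e2 c pos by (intro mult_mono divide_right_mono) auto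
    also have "\<dots> = exp (t * u) / 4 * (exp (- u\<^sup>2 / 2) * cauchy_dens u)" by simp
    also have "\<dots> \<le> sinh (t * u) * (exp (- u\<^sup>2 / 2) * cauchy_dens u)"
      using sinh by (intro mult_right_mono) auto
    also have "\<dots> = ?f u" using u by (simp add: phi_alt)
    finally show ?thesis using True by simp
  qed
  have "k = (LINT u|lborel. k * indicator {t..t+1} u)" by simp
  also have "\<dots> \<le> integral\<^sup>L lborel ?f"
    by (intro integral_mono bound integrable_med_odds_symmetrized) simp
  also have "\<dots> = med_odds t" by (simp add: med_odds_symmetrized)
  finally show ?thesis by (simp add: k_def)
qed

lemma gmarg_div_phi_le: "gmarg x / phi x \<le> 6 * exp (x\<^sup>2 / 2) / (1 + x\<^sup>2)"
proof -
  have "gmarg x / phi x \<le> (2 / (1 + x\<^sup>2)) / (exp (- x\<^sup>2 / 2) / 3)"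
    using gmarg_le_2[of x] phi_ge_exp[of x] by (intro frac_le) (auto simp: add_nonneg_nonneg)
  also have "\<dots> = 6 * exp (x\<^sup>2 / 2) / (1 + x\<^sup>2)" by (simp add: exp_minus field_simps)
  finally show ?thesis .
qed

lemma gmarg_div_phi_ge: "exp (x\<^sup>2 / 2) / (8 * (1 + x\<^sup>2)) \<le> gmarg x / phi x"
proof -
  have "exp (x\<^sup>2 / 2) / (8 * (1 + x\<^sup>2)) = (1 / (16 * (1 + x\<^sup>2))) / (exp (- x\<^sup>2 / 2) / 2)"
    by (simp add: exp_minus divide_simps)
  also have "\<dots> \<le> gmarg x / phi x"
    using gmarg_ge_16[of x] phi_le_exp[of x] by (intro frac_le) (auto simp: add_nonneg_nonneg)
  finally show ?thesis .
qed

lemma one_plus_le_exp_quarter: "1 + z \<le> 4 * exp (z / 4)" if "z \<ge> 0" for z :: real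
  using exp_ge_add_one_self[of "z / 4"] that by linarith

text \<open>Half of the exponent is given up to absorb the polynomial denominator, which makes later
  bounds purely exponential.\<close>

lemma exp_half_div_ge: "exp (z / 4) / 4 \<le> exp (z / 2) / (1 + z)" if "z \<ge> 0" for z :: real
proof -
  have "exp (z / 4) * (1 + z) \<le> exp (z / 4) * (4 * exp (z / 4))"
    by (intro mult_left_mono one_plus_le_exp_quarter that) simp
  also have "\<dots> = 4 * exp (z / 2)" by (simp add: exp_add[symmetric])
  finally show ?thesis using that by (simp add: divide_simps mult_ac)
qed

lemma gmarg_div_phi_ge_exp: "exp (x\<^sup>2 / 4) / 32 \<le> gmarg x / phi x"
proof -
  have "exp (x\<^sup>2 / 4) / 32 = exp (x\<^sup>2 / 4) / 4 / 8" by simp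
  also have "\<dots> \<le> exp (x\<^sup>2 / 2) / (1 + x\<^sup>2) / 8"
    by (intro divide_right_mono exp_half_div_ge) auto
  also have "\<dots> = exp (x\<^sup>2 / 2) / (8 * (1 + x\<^sup>2))"
    by (simp only: divide_divide_eq_left mult.commute)
  finally show ?thesis using gmarg_div_phi_ge[of x] by (rule order.trans)
qed

text \<open>For \<open>t \<ge> 1\<close> the Laplace bound applies; for \<open>t < 1\<close> the
  summand 1 suffices, because \<open>exp (t^2 / 4)\<close> is then at most 3.\<close>

lemma one_plus_med_odds_ge:
  assumes "t \<ge> 0"
  shows "exp (t\<^sup>2 / 4) / 400 \<le> 1 + med_odds t"
proof (cases "t \<ge> 1")
  case True
  have "exp (t\<^sup>2 / 4) / 400 = exp (t\<^sup>2 / 4) / 4 / 100" by simp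
  also have "\<dots> \<le> exp (t\<^sup>2 / 2) / (1 + t\<^sup>2) / 100"
    by (intro divide_right_mono exp_half_div_ge) auto
  also have "\<dots> = exp (t\<^sup>2 / 2) / (100 * (1 + t\<^sup>2))"
    by (simp only: divide_divide_eq_left mult.commute)
  finally have "exp (t\<^sup>2 / 4) / 400 \<le> med_odds t" using med_odds_ge[OF True] by (rule order.trans)
  then show ?thesis by simp
next
  case False
  then have "t\<^sup>2 \<le> 1" using assms by (simp add: abs_square_le_1)
  then have "exp (t\<^sup>2 / 4) \<le> exp 1" by simp
  also have "\<dots> \<le> 3" using exp_le by simp
  finally show ?thesis using med_odds_nonneg[OF assms] by simp
qed

subsection \<open>Posterior coordinates and the median threshold\<close>

lemma mix_dens_pos: "0 < \<alpha> \<Longrightarrow> \<alpha> \<le> 1 \<Longrightarrow> 0 < (1 - \<alpha>) * phi x + \<alpha> * gmarg x"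
  by (intro add_nonneg_pos mult_pos_pos) auto

lemma post_weight_bounds:
  assumes "0 < \<alpha>" "\<alpha> \<le> 1"
  shows "0 \<le> post_weight \<alpha> x" "post_weight \<alpha> x \<le> 1"
  using assms mix_dens_pos[OF assms, of x] by (auto simp: post_weight_def)

lemma post_weight_measurable [measurable]: "post_weight \<alpha> \<in> borel_measurable borel"
  unfolding post_weight_def by measurable

lemma sets_G_post [simp, measurable_cong]: "sets (G_post x) = sets borel"
  by (simp add: G_post_def)

lemma space_G_post [simp]: "space (G_post x) = UNIV"
  by (simp add: G_post_def)

lemma emeasure_G_post:
  assumes [measurable]: "A \<in> sets borel"
  shows "emeasure (G_post x) A = ennreal ((LINT u|lborel. phi (x - u) * cauchy_dens u * indicator A u) / gmarg x)"
proof -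
  have "integrable lborel (\<lambda>u. phi (x - u) * cauchy_dens u * indicator A u)"
    by (intro integrable_real_mult_indicator integrable_gmarg_integrand) simp
  then have "integrable lborel (\<lambda>u. phi (x - u) * cauchy_dens u * indicator A u / gmarg x)" by simp
  then have "(\<integral>\<^sup>+ u. ennreal (phi (x - u) * cauchy_dens u * indicator A u / gmarg x) \<partial>lborel)
      = ennreal (LINT u|lborel. phi (x - u) * cauchy_dens u * indicator A u / gmarg x)"
    by (rule nn_integral_eq_integral) auto
  then show ?thesis
    unfolding G_post_def
    by (subst emeasure_density) (auto simp: ennreal_indicator[symmetric] ennreal_mult'[symmetric])
qed

lemma prob_space_G_post: "prob_space (G_post x)"
  by standard (simp add: emeasure_G_post gmarg_def[symmetric] less_imp_neq[THEN not_sym])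

lemma sets_post_coord [simp, measurable_cong]: "sets (post_coord \<alpha> x) = sets borel"
  unfolding post_coord_def using sets.sigma_sets_eq[of borel] by (subst sets_measure_of) auto

lemma space_post_coord [simp]: "space (post_coord \<alpha> x) = UNIV"
  unfolding post_coord_def by (subst space_measure_of) auto

text \<open>\<open>measure_of\<close> returns the prescribed values only once the set function is
  known to be countably additive. The indicator at 0 is treated as the point mass
  \<open>return borel 0\<close>.\<close>

lemma emeasure_post_coord:
  assumes A: "A \<in> sets borel"
  shows "emeasure (post_coord \<alpha> x) A = ennreal (1 - post_weight \<alpha> x) * indicator A 0
      + ennreal (post_weight \<alpha> x) * emeasure (G_post x) A" (is "_ = ?\<mu> A")
  unfolding post_coord_def
proof (rule emeasure_measure_of_sigma[OF _ _ _ A])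
  show "sigma_algebra UNIV (sets (borel :: real measure))"
    using sets.sigma_algebra_axioms[of borel] by simp
  show "positive (sets borel) ?\<mu>" by (simp add: positive_def)
  show "countably_additive (sets borel) ?\<mu>"
  proof (rule countably_additiveI)
    fix F :: "nat \<Rightarrow> real set"
    assume F: "range F \<subseteq> sets borel" "disjoint_family F" "\<Union> (range F) \<in> sets borel"
    have "(\<Sum>i. emeasure (return borel 0) (F i)) = emeasure (return borel 0) (\<Union> (range F))"
      using F by (intro suminf_emeasure) auto
    then have 1: "(\<Sum>i. indicator (F i) 0) = (indicator (\<Union> (range F)) 0 :: ennreal)"
      using F by (subst (asm) (1 2) emeasure_return) auto
    have 2: "(\<Sum>i. emeasure (G_post x) (F i)) = emeasure (G_post x) (\<Union> (range F))"
      using F by (intro suminf_emeasure) auto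
    have "(\<Sum>i. ?\<mu> (F i)) = (\<Sum>i. ennreal (1 - post_weight \<alpha> x) * indicator (F i) 0)
        + (\<Sum>i. ennreal (post_weight \<alpha> x) * emeasure (G_post x) (F i))"
      by (intro suminf_add[symmetric]) auto
    then show "(\<Sum>i. ?\<mu> (F i)) = ?\<mu> (\<Union> (range F))"
      by (simp add: 1 2)
  qed
qed

lemma prob_space_post_coord:
  assumes "0 < \<alpha>" "\<alpha> \<le> 1"
  shows "prob_space (post_coord \<alpha> x)"
proof
  show "emeasure (post_coord \<alpha> x) (space (post_coord \<alpha> x)) = 1"
    using post_weight_bounds[OF assms, of x] prob_space.emeasure_space_1[OF prob_space_G_post, of x]
    by (simp add: emeasure_post_coord ennreal_plus[symmetric] del: ennreal_plus)
qed

lemma nn_integral_post_coord: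
  assumes [measurable]: "f \<in> borel_measurable borel"
  shows "(\<integral>\<^sup>+ u. f u \<partial>post_coord \<alpha> x)
    = ennreal (1 - post_weight \<alpha> x) * f 0 + ennreal (post_weight \<alpha> x) * (\<integral>\<^sup>+ u. f u \<partial>G_post x)"
  using assms
proof (induction rule: borel_measurable_induct)
  case (cong f g)
  then have "f = g" by (auto simp: fun_eq_iff)
  with cong show ?case by simp
next
  case (set A)
  then show ?case by (simp add: emeasure_post_coord)
next
  case (mult f c)
  then show ?case by (simp add: nn_integral_cmult distrib_left mult_ac)
next
  case (add f g)
  then show ?case by (simp add: nn_integral_add distrib_left add_ac)
next
  case (seq F)
  note [measurable] = seq(1)
  have inc: "incseq (\<lambda>i. ennreal c * (\<integral>\<^sup>+ u. F i u \<partial>G_post x))" for c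
    using seq(3) by (auto simp: incseq_def le_fun_def intro!: mult_left_mono nn_integral_mono)
  have inc0: "incseq (\<lambda>i. ennreal c * F i 0)" for c
    using seq(3) by (auto simp: incseq_def le_fun_def intro!: mult_left_mono)
  have "(\<integral>\<^sup>+ u. (SUP i. F i u) \<partial>post_coord \<alpha> x) = (SUP i. \<integral>\<^sup>+ u. F i u \<partial>post_coord \<alpha> x)"
    using seq by (intro nn_integral_monotone_convergence_SUP) (auto simp: measurable_def[symmetric])
  also have "\<dots> = (SUP i. ennreal (1 - post_weight \<alpha> x) * F i 0
      + ennreal (post_weight \<alpha> x) * (\<integral>\<^sup>+ u. F i u \<partial>G_post x))"
    using seq by simp
  also have "\<dots> = (SUP i. ennreal (1 - post_weight \<alpha> x) * F i 0)
      + (SUP i. ennreal (post_weight \<alpha> x) * (\<integral>\<^sup>+ u. F i u \<partial>G_post x))"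
    by (rule ennreal_SUP_add[OF inc0 inc])
  also have "(SUP i. ennreal (post_weight \<alpha> x) * (\<integral>\<^sup>+ u. F i u \<partial>G_post x))
      = ennreal (post_weight \<alpha> x) * (\<integral>\<^sup>+ u. (SUP i. F i u) \<partial>G_post x)"
    using seq by (subst nn_integral_monotone_convergence_SUP) (auto simp: SUP_mult_left_ennreal)
  finally show ?case by (simp add: SUP_mult_left_ennreal image_comp)
qed

text \<open>Off the null set \<open>{0}\<close> the indicators of the two half-lines are
  \<open>(1 - sgn u) / 2\<close> and \<open>(1 + sgn u) / 2\<close>.\<close>

lemma measure_G_post_halfline:
  "measure (G_post x) {..0} = (gmarg x - gdiff x) / (2 * gmarg x)"
  "measure (G_post x) {0..} = (gmarg x + gdiff x) / (2 * gmarg x)"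
proof -
  have *: "(LINT u|lborel. phi (x - u) * cauchy_dens u * indicator A u)
      = (gmarg x + e * gdiff x) / 2"
    if A: "\<And>u. u \<noteq> 0 \<Longrightarrow> indicator A u = (1 + e * sgn u) / 2" and [measurable]: "A \<in> sets borel" for A e
  proof -
    have "(LINT u|lborel. phi (x - u) * cauchy_dens u * indicator A u)
      = (LINT u|lborel. (phi (x - u) * cauchy_dens u + e * (sgn u * (phi (x - u) * cauchy_dens u))) / 2)"
    proof (rule integral_cong_AE)
      show "AE u in lborel. phi (x - u) * cauchy_dens u * indicator A u
        = (phi (x - u) * cauchy_dens u + e * (sgn u * (phi (x - u) * cauchy_dens u))) / 2"
        using AE_lborel_singleton[of 0]
        by eventually_elim (simp add: A algebra_simps add_divide_distrib)
    qed measurable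
    also have "\<dots> = (gmarg x + e * gdiff x) / 2"
      unfolding gmarg_def gdiff_def
      by (subst integral_divide_zero, subst Bochner_Integration.integral_add)
        (auto intro: integrable_gmarg_integrand integrable_gdiff_integrand)
    finally show ?thesis .
  qed
  have 1: "(LINT u|lborel. phi (x - u) * cauchy_dens u * indicator {..0} u) = (gmarg x + (-1) * gdiff x) / 2"
    by (rule *) (auto simp: sgn_if split: split_indicator)
  have 2: "(LINT u|lborel. phi (x - u) * cauchy_dens u * indicator {0..} u) = (gmarg x + 1 * gdiff x) / 2"
    by (rule *) (auto simp: sgn_if split: split_indicator)
  have m: "measure (G_post x) A = (LINT u|lborel. phi (x - u) * cauchy_dens u * indicator A u) / gmarg x"
    if "A \<in> sets borel" for A
    using emeasure_G_post[OF that, of x]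
    by (simp add: measure_def Bochner_Integration.integral_nonneg)
  show "measure (G_post x) {..0} = (gmarg x - gdiff x) / (2 * gmarg x)"
    by (subst m, simp, subst 1) simp
  show "measure (G_post x) {0..} = (gmarg x + gdiff x) / (2 * gmarg x)"
    by (subst m, simp, subst 2) simp
qed

text \<open>For \<open>x \<ge> 0\<close> the quantity \<open>gdiff x\<close> is nonnegative, so the
  condition on \<open>{0..}\<close> holds automatically. The condition on \<open>{..0}\<close>
  reduces to \<open>\<alpha> * gdiff x \<le> (1 - \<alpha>) * phi x\<close>.\<close>

lemma is_median_post_coord_0_iff:
  assumes \<alpha>: "0 < \<alpha>" "\<alpha> \<le> 1" and "x \<ge> 0"
  shows "is_median (post_coord \<alpha> x) 0 \<longleftrightarrow> med_odds x \<le> (1 - \<alpha>) / \<alpha>"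
proof -
  interpret G: prob_space "G_post x" by (rule prob_space_G_post)
  define D where "D = (1 - \<alpha>) * phi x + \<alpha> * gmarg x"
  have D: "D > 0" unfolding D_def by (rule mix_dens_pos[OF \<alpha>])
  have g: "gmarg x \<noteq> 0" by (simp add: less_imp_neq[THEN not_sym])
  have a: "post_weight \<alpha> x = \<alpha> * gmarg x / D" by (simp add: post_weight_def D_def)
  have a1: "1 - post_weight \<alpha> x = (1 - \<alpha>) * phi x / D"
    using D by (simp add: a divide_simps) (simp add: D_def)
  have m: "measure (post_coord \<alpha> x) A = (1 - post_weight \<alpha> x) + post_weight \<alpha> x * measure (G_post x) A"
    if "A \<in> sets borel" "0 \<in> A" for A
    using that post_weight_bounds[OF \<alpha>, of x]
    unfolding measure_def[of "post_coord \<alpha> x"]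
    by (simp add: emeasure_post_coord G.emeasure_eq_measure ennreal_mult'[symmetric] ennreal_plus[symmetric] del: ennreal_plus)
  have 1: "measure (post_coord \<alpha> x) {..0} = ((1 - \<alpha>) * phi x + \<alpha> * (gmarg x - gdiff x) / 2) / D"
    using m[of "{..0}"] g D unfolding a1 unfolding a measure_G_post_halfline by (simp add: divide_simps)
  have 2: "measure (post_coord \<alpha> x) {0..} = ((1 - \<alpha>) * phi x + \<alpha> * (gmarg x + gdiff x) / 2) / D"
    using m[of "{0..}"] g D unfolding a1 unfolding a measure_G_post_halfline by (simp add: divide_simps)
  have "gdiff x \<ge> 0"
    using med_odds_nonneg[OF \<open>x \<ge> 0\<close>] phi_pos[of x] by (auto simp: med_odds_def zero_le_divide_iff)
  then have pos: "\<alpha> * gdiff x \<ge> 0" "(1 - \<alpha>) * phi x \<ge> 0" using \<alpha> by simp_all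
  have "is_median (post_coord \<alpha> x) 0 \<longleftrightarrow> \<alpha> * gdiff x \<le> (1 - \<alpha>) * phi x"
    unfolding is_median_def 1 2 using D pos
    by (simp add: pos_le_divide_eq) (auto simp: D_def algebra_simps)
  also have "\<dots> \<longleftrightarrow> med_odds x \<le> (1 - \<alpha>) / \<alpha>"
    using \<alpha> phi_pos[of x] by (auto simp: med_odds_def divide_simps mult_ac)
  finally show ?thesis .
qed

text \<open>By strict monotonicity of \<open>med_odds\<close>, the set whose supremum defines
  \<open>thr\<close> is exactly \<open>{0..t}\<close>.\<close>

lemma thr_eq:
  assumes "t \<ge> 0"
  shows "thr (1 / (1 + med_odds t)) = t"
proof -
  define \<alpha> where "\<alpha> = 1 / (1 + med_odds t)"
  have H: "med_odds t \<ge> 0" using assms by (rule med_odds_nonneg)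
  then have \<alpha>: "0 < \<alpha>" "\<alpha> \<le> 1" "(1 - \<alpha>) / \<alpha> = med_odds t" by (simp_all add: \<alpha>_def field_simps)
  have "{x. 0 \<le> x \<and> is_median (post_coord \<alpha> x) 0} = {0..t}"
    using med_odds_mono[of _ t] med_odds_strict_mono[of t]
    by (auto simp: is_median_post_coord_0_iff[OF \<alpha>(1,2)] \<alpha>(3)) (meson not_le)
  then show ?thesis using assms by (simp add: thr_def \<alpha>_def)
qed

text \<open>Surjectivity of \<open>med_odds\<close> provides a \<open>t\<close> with odds
  \<open>(1 - \<alpha>) / \<alpha>\<close>, and \<open>thr_eq\<close> identifies it. Together the
  two lemmas make \<open>thr\<close> a bijection with inverse
  \<open>1 / (1 + med_odds t)\<close>.\<close>

lemma thr_props: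
  assumes "0 < \<alpha>" "\<alpha> \<le> 1"
  shows "thr \<alpha> \<ge> 0" "\<alpha> = 1 / (1 + med_odds (thr \<alpha>))"
proof -
  have "(1 - \<alpha>) / \<alpha> \<ge> 0" using assms by simp
  then obtain t where t: "t \<ge> 0" "med_odds t = (1 - \<alpha>) / \<alpha>" by (rule med_odds_surj)
  then have "1 + med_odds t = 1 / \<alpha>" using assms by (simp add: field_simps)
  then have eq: "1 / (1 + med_odds t) = \<alpha>" by simp
  have "thr \<alpha> = t" using thr_eq[OF t(1)] by (simp only: eq)
  then show "thr \<alpha> \<ge> 0" "\<alpha> = 1 / (1 + med_odds (thr \<alpha>))" using t(1) eq by simp_all
qed

text \<open>Bijectivity of \<open>thr\<close> justifies the definite description. All later
  estimates of threshold weights start from this closed form.\<close>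

lemma thr_inv_eq:
  assumes "y \<ge> 0"
  shows "thr_inv y = 1 / (1 + med_odds y)"
  unfolding thr_inv_def
proof (rule the_equality)
  show "0 < 1 / (1 + med_odds y) \<and> 1 / (1 + med_odds y) \<le> 1 \<and> thr (1 / (1 + med_odds y)) = y"
    using assms med_odds_nonneg[OF assms] thr_eq by auto
next
  fix \<alpha> assume *: "0 < \<alpha> \<and> \<alpha> \<le> 1 \<and> thr \<alpha> = y"
  then have "\<alpha> = 1 / (1 + med_odds (thr \<alpha>))" by (intro thr_props(2)) auto
  also have "thr \<alpha> = y" using * by simp
  finally show "\<alpha> = 1 / (1 + med_odds y)" .
qed

lemma thr_inv_bounds:
  assumes "y \<ge> 0"
  shows "0 < thr_inv y" "thr_inv y \<le> 1"
  using med_odds_nonneg[OF assms] by (auto simp: thr_inv_eq[OF assms])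

lemma thr_inv_mono:
  assumes "0 \<le> x" "x \<le> y"
  shows "thr_inv y \<le> thr_inv x"
proof -
  have "0 \<le> med_odds x" "med_odds x \<le> med_odds y" using assms by (auto intro: med_odds_nonneg med_odds_mono)
  then show ?thesis using assms by (simp add: thr_inv_eq frac_le)
qed

lemma posterior_risk_eq_sum:
  assumes "0 < \<alpha>" "\<alpha> \<le> 1"
  shows "(\<integral>\<^sup>+ \<theta>. ennreal (\<Sum>i<n. (\<theta> i - \<theta>0 i)\<^sup>2) \<partial>posterior n \<alpha> X)
    = (\<Sum>i<n. \<integral>\<^sup>+ u. ennreal ((u - \<theta>0 i)\<^sup>2) \<partial>post_coord \<alpha> (X i))"
proof -
  have "(\<integral>\<^sup>+ \<theta>. ennreal (\<Sum>i<n. (\<theta> i - \<theta>0 i)\<^sup>2) \<partial>posterior n \<alpha> X)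
    = (\<integral>\<^sup>+ \<theta>. (\<Sum>i<n. ennreal ((\<theta> i - \<theta>0 i)\<^sup>2)) \<partial>posterior n \<alpha> X)"
    by (simp add: sum_ennreal)
  also have "\<dots> = (\<Sum>i<n. \<integral>\<^sup>+ \<theta>. ennreal ((\<theta> i - \<theta>0 i)\<^sup>2) \<partial>posterior n \<alpha> X)"
    unfolding posterior_def by (rule nn_integral_sum) measurable
  also have "\<dots> = (\<Sum>i<n. \<integral>\<^sup>+ u. ennreal ((u - \<theta>0 i)\<^sup>2) \<partial>post_coord \<alpha> (X i))"
  proof (rule sum.cong[OF refl])
    fix i assume i: "i \<in> {..<n}"
    have "distr (posterior n \<alpha> X) (post_coord \<alpha> (X i)) (\<lambda>\<omega>. \<omega> i) = post_coord \<alpha> (X i)"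
      unfolding posterior_def using i by (intro distr_PiM_component prob_space_post_coord assms) auto
    then have "(\<integral>\<^sup>+ u. ennreal ((u - \<theta>0 i)\<^sup>2) \<partial>post_coord \<alpha> (X i))
      = (\<integral>\<^sup>+ u. ennreal ((u - \<theta>0 i)\<^sup>2) \<partial>distr (posterior n \<alpha> X) (post_coord \<alpha> (X i)) (\<lambda>\<omega>. \<omega> i))"
      by simp
    also have "\<dots> = (\<integral>\<^sup>+ \<theta>. ennreal ((\<theta> i - \<theta>0 i)\<^sup>2) \<partial>posterior n \<alpha> X)"
      using i by (subst nn_integral_distr) (auto simp: posterior_def)
    finally show "(\<integral>\<^sup>+ \<theta>. ennreal ((\<theta> i - \<theta>0 i)\<^sup>2) \<partial>posterior n \<alpha> X)
      = (\<integral>\<^sup>+ u. ennreal ((u - \<theta>0 i)\<^sup>2) \<partial>post_coord \<alpha> (X i))" by simp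
  qed
  finally show ?thesis .
qed

lemma sq_diff_le: "(a - c)\<^sup>2 \<le> 2 * (a - b)\<^sup>2 + 2 * (b - c)\<^sup>2" for a b c :: real
proof -
  have "0 \<le> ((a - b) - (b - c))\<^sup>2" by simp
  then show ?thesis by (simp add: power2_eq_square algebra_simps)
qed

text \<open>The spike contributes \<open>m^2\<close>. For the slab, \<open>(u - m)^2\<close> is
  split at the observation \<open>x\<close>, which doubles both squares; 64 is twice the bound 32 on
  the second moment about \<open>x\<close>.\<close>

lemma post_coord_risk_le:
  assumes "0 < \<alpha>" "\<alpha> \<le> 1"
  shows "(\<integral>\<^sup>+ u. ennreal ((u - m)\<^sup>2) \<partial>post_coord \<alpha> x)
    \<le> ennreal ((1 - post_weight \<alpha> x) * m\<^sup>2 + post_weight \<alpha> x * (64 + 2 * (x - m)\<^sup>2))"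
proof -
  interpret G: prob_space "G_post x" by (rule prob_space_G_post)
  note a = post_weight_bounds[OF assms, of x]
  have "(\<integral>\<^sup>+ u. ennreal ((u - m)\<^sup>2) \<partial>G_post x)
    \<le> (\<integral>\<^sup>+ u. 2 * ennreal ((u - x)\<^sup>2) + ennreal (2 * (x - m)\<^sup>2) \<partial>G_post x)"
  proof (rule nn_integral_mono)
    fix u
    have "ennreal ((u - m)\<^sup>2) \<le> ennreal (2 * (u - x)\<^sup>2 + 2 * (x - m)\<^sup>2)"
      by (intro ennreal_leI sq_diff_le)
    then show "ennreal ((u - m)\<^sup>2) \<le> 2 * ennreal ((u - x)\<^sup>2) + ennreal (2 * (x - m)\<^sup>2)"
      by (simp add: ennreal_plus ennreal_mult)
  qed
  also have "\<dots> = 2 * (\<integral>\<^sup>+ u. ennreal ((u - x)\<^sup>2) \<partial>G_post x) + ennreal (2 * (x - m)\<^sup>2)"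
    using G.emeasure_space_1 by (simp add: nn_integral_add nn_integral_cmult)
  also have "\<dots> \<le> 2 * ennreal 32 + ennreal (2 * (x - m)\<^sup>2)"
    by (intro add_right_mono mult_left_mono G_post_variance_bound) simp
  also have "\<dots> = ennreal (64 + 2 * (x - m)\<^sup>2)"
    by (simp add: ennreal_plus ennreal_mult)
  finally have G: "(\<integral>\<^sup>+ u. ennreal ((u - m)\<^sup>2) \<partial>G_post x) \<le> ennreal (64 + 2 * (x - m)\<^sup>2)" .
  have "(\<integral>\<^sup>+ u. ennreal ((u - m)\<^sup>2) \<partial>post_coord \<alpha> x)
    = ennreal (1 - post_weight \<alpha> x) * ennreal (m\<^sup>2)
      + ennreal (post_weight \<alpha> x) * (\<integral>\<^sup>+ u. ennreal ((u - m)\<^sup>2) \<partial>G_post x)"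
    by (subst nn_integral_post_coord) auto
  also have "\<dots> \<le> ennreal (1 - post_weight \<alpha> x) * ennreal (m\<^sup>2)
      + ennreal (post_weight \<alpha> x) * ennreal (64 + 2 * (x - m)\<^sup>2)"
    by (intro add_left_mono mult_left_mono G) simp
  also have "\<dots> = ennreal ((1 - post_weight \<alpha> x) * m\<^sup>2 + post_weight \<alpha> x * (64 + 2 * (x - m)\<^sup>2))"
    using a by (simp add: ennreal_mult[symmetric] ennreal_plus[symmetric] del: ennreal_plus)
  finally show ?thesis .
qed

subsection \<open>Coordinate risks and the score of the marginal likelihood\<close>

text \<open>The derivative in \<open>\<alpha>\<close> of one summand of
  \<open>loglik\<close>.\<close>

definition score :: "real \<Rightarrow> real \<Rightarrow> real" where
  "score \<alpha> x = (gmarg x - phi x) / ((1 - \<alpha>) * phi x + \<alpha> * gmarg x)"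

lemma score_measurable [measurable]: "score \<alpha> \<in> borel_measurable borel"
  unfolding score_def by measurable

lemma post_weight_eq_score:
  assumes "0 < \<alpha>" "\<alpha> \<le> 1"
  shows "post_weight \<alpha> x = \<alpha> + \<alpha> * (1 - \<alpha>) * score \<alpha> x"
  using mix_dens_pos[OF assms, of x]
  by (simp add: post_weight_def score_def divide_simps) (simp add: algebra_simps)

lemma post_weight_mono:
  assumes "0 < \<alpha>" "\<alpha> \<le> \<beta>" "\<beta> \<le> 1"
  shows "post_weight \<alpha> x \<le> post_weight \<beta> x"
proof -
  have "\<alpha> * (1 - \<beta>) \<le> \<beta> * (1 - \<alpha>)" using assms by (simp add: algebra_simps)
  then have "(\<alpha> * (1 - \<beta>)) * (gmarg x * phi x) \<le> (\<beta> * (1 - \<alpha>)) * (gmarg x * phi x)"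
    by (rule mult_right_mono) simp
  then show ?thesis
    unfolding post_weight_def using assms
    by (intro frac_le_eq[THEN iffD2] divide_nonpos_pos mult_pos_pos mix_dens_pos less_imp_neq[THEN not_sym])
      (auto simp: algebra_simps)
qed

text \<open>With \<open>r = gmarg x / phi x\<close> the weight is
  \<open>\<alpha> * r / (1 - \<alpha> + \<alpha> * r)\<close>. If
  \<open>\<alpha> * r \<le> 1\<close>, it is at least \<open>\<alpha> * r / 2\<close>, and
  \<open>r\<close> is of order \<open>exp (x^2 / 4)\<close> or more. Otherwise it is at least
  \<open>1 / 2\<close>, and \<open>\<alpha> * exp (t^2 / 4)\<close> is at most 400 at the threshold
  \<open>t\<close>.\<close>

lemma post_weight_ge:
  assumes \<alpha>: "0 < \<alpha>" "\<alpha> \<le> 1"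
  shows "\<alpha> * exp (min (x\<^sup>2) ((thr \<alpha>)\<^sup>2) / 4) / 800 \<le> post_weight \<alpha> x"
proof -
  define r where "r = gmarg x / phi x"
  have r: "r > 0" by (simp add: r_def)
  have a: "post_weight \<alpha> x = \<alpha> * r / ((1 - \<alpha>) + \<alpha> * r)"
    using mix_dens_pos[OF \<alpha>, of x] less_imp_neq[OF phi_pos[of x], THEN not_sym]
    by (simp add: post_weight_def r_def add_divide_distrib[symmetric] divide_simps)
  have pos: "0 < (1 - \<alpha>) + \<alpha> * r" using \<alpha> r by (intro add_nonneg_pos) auto
  show ?thesis
  proof (cases "\<alpha> * r \<le> 1")
    case True
    have "exp (min (x\<^sup>2) ((thr \<alpha>)\<^sup>2) / 4) \<le> exp (x\<^sup>2 / 4)" by simp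
    also have "\<dots> \<le> 32 * r" using gmarg_div_phi_ge_exp[of x, folded r_def] by linarith
    finally have "exp (min (x\<^sup>2) ((thr \<alpha>)\<^sup>2) / 4) / 800 \<le> r / 2" using r by linarith
    then have "\<alpha> * (exp (min (x\<^sup>2) ((thr \<alpha>)\<^sup>2) / 4) / 800) \<le> \<alpha> * (r / 2)"
      using \<alpha> by (intro mult_left_mono) auto
    also have "\<dots> = \<alpha> * r / 2" by simp
    also have "\<dots> \<le> post_weight \<alpha> x"
      unfolding a using True \<alpha> r pos by (intro divide_left_mono) auto
    finally show ?thesis by simp
  next
    case False
    have "1 + med_odds (thr \<alpha>) = 1 / \<alpha>" using thr_props(2)[OF \<alpha>] by (metis divide_divide_eq_right div_by_1 mult_1)
    then have "exp ((thr \<alpha>)\<^sup>2 / 4) / 400 \<le> 1 / \<alpha>"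
      using one_plus_med_odds_ge[OF thr_props(1)[OF \<alpha>]] by simp
    then have "\<alpha> * exp ((thr \<alpha>)\<^sup>2 / 4) \<le> 400" using \<alpha> by (simp add: field_simps)
    moreover have "\<alpha> * exp (min (x\<^sup>2) ((thr \<alpha>)\<^sup>2) / 4) \<le> \<alpha> * exp ((thr \<alpha>)\<^sup>2 / 4)"
      using \<alpha> by (intro mult_left_mono) auto
    ultimately have "\<alpha> * exp (min (x\<^sup>2) ((thr \<alpha>)\<^sup>2) / 4) / 800 \<le> 1 / 2" by simp
    also have "1 / 2 \<le> post_weight \<alpha> x"
      unfolding a using False \<alpha> pos by (simp add: divide_simps)
    finally show ?thesis .
  qed
qed

text \<open>Beyond the threshold \<open>T\<close> the spike probability is at most the ratio of
  \<open>med_odds T = (1 - \<alpha>) / \<alpha>\<close> to \<open>gmarg x / phi x\<close>. Up to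
  polynomial factors this is \<open>exp (- d / 2)\<close> with \<open>d = x^2 - T^2\<close>, which
  absorbs \<open>(1 + d)^2\<close> and leaves a multiple of \<open>1 + T^2\<close>.\<close>

lemma post_weight_compl_le:
  assumes \<alpha>: "0 < \<alpha>" "\<alpha> \<le> 1"
  shows "(1 - post_weight \<alpha> x) * x\<^sup>2 \<le> 768 * (1 + min (x\<^sup>2) ((thr \<alpha>)\<^sup>2))"
proof (cases "x\<^sup>2 \<le> (thr \<alpha>)\<^sup>2")
  case True
  have "(1 - post_weight \<alpha> x) * x\<^sup>2 \<le> x\<^sup>2"
    using post_weight_bounds[OF \<alpha>, of x] by (intro mult_left_le_one_le) auto
  also have "\<dots> \<le> 768 * (1 + x\<^sup>2)" by simp
  finally show ?thesis using True by (simp add: min_def)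
next
  case False
  define T where "T = thr \<alpha>"
  define d where "d = x\<^sup>2 - T\<^sup>2"
  have d: "d \<ge> 0" "x\<^sup>2 = T\<^sup>2 + d" using False by (auto simp: d_def T_def)
  have pT: "1 + T\<^sup>2 > 0" by (simp add: add_pos_nonneg)
  define D where "D = (1 - \<alpha>) * phi x + \<alpha> * gmarg x"
  have D: "D > 0" unfolding D_def by (rule mix_dens_pos[OF \<alpha>])
  have "1 - post_weight \<alpha> x = (1 - \<alpha>) * phi x / D"
    using D by (simp add: post_weight_def D_def divide_simps)
  also have "\<dots> \<le> (1 - \<alpha>) * phi x / (\<alpha> * gmarg x)"
    using \<alpha> D by (intro divide_left_mono) (auto simp: D_def)
  also have "\<dots> = ((1 - \<alpha>) / \<alpha>) / (gmarg x / phi x)"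
    by simp
  also have "(1 - \<alpha>) / \<alpha> = med_odds T"
  proof -
    have "1 + med_odds T = 1 / \<alpha>" using thr_props(2)[OF \<alpha>] unfolding T_def by (metis divide_divide_eq_right div_by_1 mult_1)
    then show ?thesis using \<alpha> by (simp add: diff_divide_distrib)
  qed
  also have "med_odds T / (gmarg x / phi x) \<le> (6 * exp (T\<^sup>2 / 2) / (1 + T\<^sup>2)) / (exp (x\<^sup>2 / 2) / (8 * (1 + x\<^sup>2)))"
    by (rule frac_le[OF _ order.trans[OF med_odds_le gmarg_div_phi_le] _ gmarg_div_phi_ge])
      (auto simp: add_pos_nonneg add_nonneg_nonneg)
  also have "\<dots> = 48 * exp (T\<^sup>2 / 2 - x\<^sup>2 / 2) * (1 + x\<^sup>2) / (1 + T\<^sup>2)"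
  proof -
    have "6 * a / q / (b / (8 * r)) = 48 * (a / b) * r / q" for a b q r :: real by (simp add: mult_ac)
    then show ?thesis by (simp only: exp_diff)
  qed
  also have "T\<^sup>2 / 2 - x\<^sup>2 / 2 = - d / 2" by (simp add: d_def field_simps)
  finally have a: "1 - post_weight \<alpha> x \<le> 48 * exp (- d / 2) * (1 + x\<^sup>2) / (1 + T\<^sup>2)" .
  have x: "1 + x\<^sup>2 \<le> (1 + T\<^sup>2) * (1 + d)" using d by (simp add: algebra_simps)
  have e: "(1 + d)\<^sup>2 * exp (- d / 2) \<le> 16"
  proof -
    have "(1 + d)\<^sup>2 \<le> (4 * exp (d / 4))\<^sup>2" using d one_plus_le_exp_quarter[of d] by (intro power_mono) auto
    also have "\<dots> = 16 * exp (d / 2)" by (simp add: power_mult_distrib power2_eq_square exp_add[symmetric])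
    finally have "(1 + d)\<^sup>2 * exp (- d / 2) \<le> 16 * exp (d / 2) * exp (- d / 2)" by (intro mult_right_mono) auto
    also have "\<dots> = 16" by (simp add: exp_add[symmetric])
    finally show ?thesis .
  qed
  have "(1 - post_weight \<alpha> x) * x\<^sup>2 \<le> 48 * exp (- d / 2) * (1 + x\<^sup>2) / (1 + T\<^sup>2) * (1 + x\<^sup>2)"
    using a pT by (intro mult_mono) (auto simp: add_nonneg_nonneg)
  also have "\<dots> = 48 * exp (- d / 2) * (1 + x\<^sup>2)\<^sup>2 / (1 + T\<^sup>2)"
    by (simp add: power2_eq_square)
  also have "\<dots> \<le> 48 * exp (- d / 2) * ((1 + T\<^sup>2) * (1 + d))\<^sup>2 / (1 + T\<^sup>2)"
    using x pT by (intro divide_right_mono mult_left_mono power_mono) (auto simp: add_nonneg_nonneg)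
  also have "\<dots> = 48 * (1 + T\<^sup>2) * ((1 + d)\<^sup>2 * exp (- d / 2))"
    using pT by (simp add: power_mult_distrib power2_eq_square)
  also have "\<dots> \<le> 48 * (1 + T\<^sup>2) * 16"
    using e pT by (intro mult_left_mono) auto
  finally show ?thesis using False by (simp add: min_def T_def)
qed

text \<open>Replacing \<open>m^2\<close> by \<open>2 * x^2 + 2 * (x - m)^2\<close> reduces the spike
  term to \<open>post_weight_compl_le\<close>; the constants are \<open>1536 = 2 * 768\<close> and
  \<open>1600 = 1536 + 64\<close>.\<close>

lemma signal_risk_le:
  assumes \<alpha>: "0 < \<alpha>" "\<alpha> \<le> 1"
  shows "(\<integral>\<^sup>+ u. ennreal ((u - m)\<^sup>2) \<partial>post_coord \<alpha> x)
    \<le> ennreal (1600 + 2 * (x - m)\<^sup>2 + 1536 * min (x\<^sup>2) ((thr \<alpha>)\<^sup>2))"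
proof -
  define a where "a = post_weight \<alpha> x"
  have a: "0 \<le> a" "a \<le> 1" using post_weight_bounds[OF \<alpha>] by (auto simp: a_def)
  have "m\<^sup>2 \<le> 2 * x\<^sup>2 + 2 * (x - m)\<^sup>2" using sq_diff_le[of m 0 x] by (simp add: power2_commute)
  then have "(1 - a) * m\<^sup>2 \<le> (1 - a) * (2 * x\<^sup>2 + 2 * (x - m)\<^sup>2)" using a by (intro mult_left_mono) auto
  then have "(1 - a) * m\<^sup>2 + a * (64 + 2 * (x - m)\<^sup>2) \<le> 2 * ((1 - a) * x\<^sup>2) + 2 * (x - m)\<^sup>2 + 64 * a"
    by (simp add: algebra_simps)
  also have "\<dots> \<le> 2 * (768 * (1 + min (x\<^sup>2) ((thr \<alpha>)\<^sup>2))) + 2 * (x - m)\<^sup>2 + 64"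
    using post_weight_compl_le[OF \<alpha>, of x] a by (intro add_mono mult_left_mono) (auto simp: a_def)
  finally have "(1 - a) * m\<^sup>2 + a * (64 + 2 * (x - m)\<^sup>2) \<le> 1600 + 2 * (x - m)\<^sup>2 + 1536 * min (x\<^sup>2) ((thr \<alpha>)\<^sup>2)"
    by simp
  then show ?thesis
    unfolding a_def by (rule order.trans[OF post_coord_risk_le[OF \<alpha>] ennreal_leI])
qed

lemma noise_risk_le:
  assumes \<alpha>: "0 < \<alpha>" "\<alpha> \<le> 1"
  shows "(\<integral>\<^sup>+ u. ennreal ((u - 0)\<^sup>2) \<partial>post_coord \<alpha> x) \<le> ennreal (64 * (post_weight \<alpha> x * (1 + x\<^sup>2)))"
proof -
  have "post_weight \<alpha> x * (64 + 2 * x\<^sup>2) \<le> post_weight \<alpha> x * (64 * (1 + x\<^sup>2))"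
    using post_weight_bounds[OF \<alpha>] by (intro mult_left_mono) auto
  then show ?thesis
    by (intro order.trans[OF post_coord_risk_le[OF \<alpha>]] ennreal_leI) (simp add: mult_ac)
qed

lemma mix_dens_diff:
  assumes "0 < \<beta>" "\<beta> \<le> 1"
  shows "((1 - \<alpha>) * phi x + \<alpha> * gmarg x) / ((1 - \<beta>) * phi x + \<beta> * gmarg x) = 1 + (\<alpha> - \<beta>) * score \<beta> x"
  using mix_dens_pos[OF assms, of x]
  by (simp add: score_def divide_simps) (simp add: algebra_simps)

text \<open>Concavity of the log-likelihood: it lies below its tangent at \<open>\<beta>\<close>, by
  \<open>ln r \<le> r - 1\<close> for each ratio of densities.\<close>

lemma loglik_diff_le:
  assumes \<alpha>: "0 < \<alpha>" "\<alpha> \<le> 1" and \<beta>: "0 < \<beta>" "\<beta> \<le> 1"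
  shows "loglik n X \<alpha> - loglik n X \<beta> \<le> (\<alpha> - \<beta>) * (\<Sum>i<n. score \<beta> (X i))"
proof -
  have "ln ((1 - \<alpha>) * phi x + \<alpha> * gmarg x) - ln ((1 - \<beta>) * phi x + \<beta> * gmarg x) \<le> (\<alpha> - \<beta>) * score \<beta> x" for x
  proof -
    let ?A = "(1 - \<alpha>) * phi x + \<alpha> * gmarg x" and ?B = "(1 - \<beta>) * phi x + \<beta> * gmarg x"
    have pos: "?A > 0" "?B > 0" using mix_dens_pos[OF \<alpha>] mix_dens_pos[OF \<beta>] by auto
    then have "ln ?A - ln ?B = ln (?A / ?B)" by (simp add: ln_div)
    also have "\<dots> \<le> ?A / ?B - 1" using pos by (intro ln_le_minus_one divide_pos_pos)
    also have "\<dots> = (\<alpha> - \<beta>) * score \<beta> x" by (simp add: mix_dens_diff[OF \<beta>])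
    finally show ?thesis .
  qed
  then show ?thesis
    by (simp add: loglik_def sum_subtractf[symmetric] sum_distrib_left sum_mono)
qed

text \<open>Comparison with \<open>\<beta> = min 1 (2 * \<alpha>)\<close>: by concavity the score
  sum at \<open>\<beta>\<close> cannot be positive, and the weights at \<open>\<beta>\<close> are
  \<open>\<beta>\<close> plus a nonnegative multiple of the scores. Moving to the right of
  \<open>\<alpha>\<close> also covers a maximiser at the lower end of the range.\<close>

lemma mmle_weight_sum_le:
  assumes \<alpha>: "0 < \<alpha>" "\<alpha> \<le> 1"
    and max: "\<And>\<beta>. \<alpha> \<le> \<beta> \<Longrightarrow> \<beta> \<le> 1 \<Longrightarrow> loglik n X \<beta> \<le> loglik n X \<alpha>"
  shows "(\<Sum>i<n. post_weight \<alpha> (X i)) \<le> 2 * real n * \<alpha>"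
proof (cases "\<alpha> < 1")
  case False
  then have "\<alpha> = 1" using \<alpha> by simp
  have "(\<Sum>i<n. post_weight \<alpha> (X i)) \<le> (\<Sum>i<n. 1)"
    by (intro sum_mono post_weight_bounds \<alpha>)
  with \<open>\<alpha> = 1\<close> show ?thesis by simp
next
  case True
  define \<beta> where "\<beta> = min 1 (2 * \<alpha>)"
  have \<beta>: "0 < \<beta>" "\<beta> \<le> 1" "\<alpha> < \<beta>" "\<beta> \<le> 2 * \<alpha>" using \<alpha> True by (auto simp: \<beta>_def)
  have "0 \<le> loglik n X \<alpha> - loglik n X \<beta>" using max[of \<beta>] \<beta> by simp
  also have "\<dots> \<le> (\<alpha> - \<beta>) * (\<Sum>i<n. score \<beta> (X i))" by (rule loglik_diff_le) (use \<alpha> \<beta> in auto)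
  finally have S: "(\<Sum>i<n. score \<beta> (X i)) \<le> 0" using \<beta> by (simp add: zero_le_mult_iff)
  have "(\<Sum>i<n. post_weight \<alpha> (X i)) \<le> (\<Sum>i<n. post_weight \<beta> (X i))"
    using \<alpha> \<beta> by (intro sum_mono post_weight_mono) auto
  also have "\<dots> = real n * \<beta> + \<beta> * (1 - \<beta>) * (\<Sum>i<n. score \<beta> (X i))"
    by (simp add: post_weight_eq_score \<beta> sum.distrib sum_distrib_left)
  also have "\<dots> \<le> real n * \<beta>" using S \<beta> by (simp add: mult_nonneg_nonpos)
  also have "\<dots> \<le> real n * (2 * \<alpha>)" using \<beta> by (intro mult_left_mono) auto
  finally show ?thesis by simp
qed

text \<open>The score equation bounds the exponential sum over all observations; the tangent line of
  \<open>exp\<close> at \<open>ln (n / s)\<close> then bounds the sum over at most \<open>s\<close> of them, whatever the data are.\<close>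

lemma mmle_truncated_squares_le:
  assumes \<alpha>: "0 < \<alpha>" "\<alpha> \<le> 1"
    and max: "\<And>\<beta>. \<alpha> \<le> \<beta> \<Longrightarrow> \<beta> \<le> 1 \<Longrightarrow> loglik n X \<beta> \<le> loglik n X \<alpha>"
    and S: "S \<subseteq> {..<n}" "card S \<le> s" "1 \<le> s" "s \<le> n"
  shows "(\<Sum>i\<in>S. min ((X i)\<^sup>2) ((thr \<alpha>)\<^sup>2)) \<le> 4 * real s * (ln (real n / real s) + 1600)"
proof -
  define w where "w i = min ((X i)\<^sup>2) ((thr \<alpha>)\<^sup>2) / 4" for i
  define y where "y = real n / real s"
  have y: "y > 0" "ln y \<ge> 0" using S by (auto simp: y_def)
  have "\<alpha> / 800 * (\<Sum>i<n. exp (w i)) \<le> (\<Sum>i<n. post_weight \<alpha> (X i))"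
    unfolding sum_distrib_left w_def
    by (intro sum_mono) (use post_weight_ge[OF \<alpha>] in simp)
  also have "\<dots> \<le> 2 * real n * \<alpha>" by (rule mmle_weight_sum_le[OF \<alpha> max])
  finally have e: "(\<Sum>i<n. exp (w i)) \<le> 1600 * real n" using \<alpha> by (simp add: field_simps)
  have tangent: "w i \<le> ln y + exp (w i) / y" for i
  proof -
    have "1 + (w i - ln y) \<le> exp (w i - ln y)" by (rule exp_ge_add_one_self)
    also have "\<dots> = exp (w i) / y" using y by (simp add: exp_diff)
    finally show ?thesis by simp
  qed
  have "(\<Sum>i\<in>S. w i) \<le> (\<Sum>i\<in>S. ln y + exp (w i) / y)" by (intro sum_mono tangent)
  also have "\<dots> = real (card S) * ln y + (\<Sum>i\<in>S. exp (w i)) / y"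
    by (simp add: sum.distrib sum_divide_distrib)
  also have "\<dots> \<le> real s * ln y + (1600 * real n) / y"
  proof (intro add_mono mult_right_mono divide_right_mono)
    show "(\<Sum>i\<in>S. exp (w i)) \<le> 1600 * real n"
      by (rule order.trans[OF sum_mono2 e]) (use S in auto)
  qed (use S y in auto)
  also have "(1600 * real n) / y = 1600 * real s" using S by (simp add: y_def)
  finally have "(\<Sum>i\<in>S. w i) \<le> real s * (ln y + 1600)" by (simp add: algebra_simps)
  then show ?thesis by (simp add: w_def y_def sum_divide_distrib[symmetric])
qed

subsection \<open>Score and weight under pure noise\<close>

text \<open>Up to a constant factor, the distance at which \<open>phi x\<close> drops to the order
  of \<open>\<alpha>\<close>: \<open>phi\<close> at \<open>sqrt 2 * log_scale \<alpha>\<close>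
  equals \<open>\<alpha> / sqrt (2 * pi)\<close> for \<open>0 < \<alpha> \<le> 1\<close>.\<close>

definition log_scale :: "real \<Rightarrow> real" where
  "log_scale \<alpha> = sqrt (ln (1 / \<alpha>))"

lemma small_weight:
  assumes "0 < \<alpha>" "\<alpha> \<le> exp (-1)"
  shows "\<alpha> \<le> 1 / 2" "1 \<le> log_scale \<alpha>" "exp (- (log_scale \<alpha>)\<^sup>2) = \<alpha>"
proof -
  have "exp (1::real) \<ge> 2" using exp_ge_add_one_self[of "1::real"] by simp
  then have "exp (-1::real) \<le> 1 / 2" by (simp add: exp_minus field_simps)
  then show "\<alpha> \<le> 1 / 2" using assms by simp
  have "ln \<alpha> \<le> -1" using assms by (metis ln_exp ln_le_cancel_iff exp_gt_zero)
  then have l: "1 \<le> ln (1 / \<alpha>)" using assms by (simp add: ln_div)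
  then show "1 \<le> log_scale \<alpha>" by (simp add: log_scale_def)
  show "exp (- (log_scale \<alpha>)\<^sup>2) = \<alpha>" proof -
    have "exp (- (log_scale \<alpha>)\<^sup>2) = exp (- ln (1 / \<alpha>))" using l unfolding log_scale_def by simp
    also have "\<dots> = \<alpha>" using assms by (simp add: ln_div)
    finally show ?thesis .
  qed
qed

lemma mix_dens_ge:
  assumes "0 < \<alpha>" "\<alpha> \<le> 1 / 2"
  shows "\<alpha> * gmarg x \<le> (1 - \<alpha>) * phi x + \<alpha> * gmarg x"
    "phi x / 2 \<le> (1 - \<alpha>) * phi x + \<alpha> * gmarg x"
proof -
  show "\<alpha> * gmarg x \<le> (1 - \<alpha>) * phi x + \<alpha> * gmarg x" using assms by simp
  have "1 / 2 * phi x \<le> (1 - \<alpha>) * phi x" using assms by (intro mult_right_mono) auto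
  moreover have "0 \<le> \<alpha> * gmarg x" using assms by simp
  ultimately show "phi x / 2 \<le> (1 - \<alpha>) * phi x + \<alpha> * gmarg x" by linarith
qed

lemma one_plus_sq_le_exp: "(1 + z)\<^sup>2 * exp (- z / 2) \<le> 64 * exp (- z / 4)" if "z \<ge> 0" for z :: real
proof -
  have "1 + z \<le> 8 * exp (z / 8)" using exp_ge_add_one_self[of "z / 8"] that by linarith
  then have "(1 + z)\<^sup>2 \<le> (8 * exp (z / 8))\<^sup>2" using that by (intro power_mono) auto
  also have "\<dots> = 64 * exp (z / 4)" by (simp add: power_mult_distrib power2_eq_square exp_add[symmetric])
  finally have "(1 + z)\<^sup>2 * exp (- z / 2) \<le> 64 * exp (z / 4) * exp (- z / 2)" by (intro mult_right_mono) auto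
  also have "\<dots> = 64 * exp (- z / 4)" by (simp add: exp_add[symmetric])
  finally show ?thesis .
qed

text \<open>Up to distance \<open>2 * L\<close> the weight is at most
  \<open>2 * \<alpha> * gmarg x / phi x\<close>, so the integrand is at most
  \<open>4 * \<alpha>\<close> on an interval of length \<open>4 * L\<close>. Beyond it the weight is
  bounded by 1, and half of the Gaussian exponent already gives a factor
  \<open>\<alpha>\<close>.\<close>

lemma expectation_noise_weight:
  assumes "0 < \<alpha>" "\<alpha> \<le> exp (-1)"
  shows "(\<integral>\<^sup>+ x. ennreal (phi x * (post_weight \<alpha> x * (1 + x\<^sup>2))) \<partial>lborel) \<le> ennreal (256 * \<alpha> * log_scale \<alpha>)"
proof -
  define L where "L = log_scale \<alpha>"
  note sw = small_weight[OF assms, folded L_def]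
  have \<alpha>: "0 < \<alpha>" "\<alpha> \<le> 1" using assms sw by auto
  let ?b = "\<lambda>x. 32 * \<alpha> * (indicator {- 2 * L..2 * L} x + 1 / (1 + x\<^sup>2))"
  have bound: "phi x * (post_weight \<alpha> x * (1 + x\<^sup>2)) \<le> ?b x" for x
  proof (cases "x \<in> {- 2 * L..2 * L}")
    case True
    have p: "1 + x\<^sup>2 > 0" by (simp add: add_pos_nonneg)
    have "post_weight \<alpha> x \<le> \<alpha> * gmarg x / (phi x / 2)"
      unfolding post_weight_def using mix_dens_ge(2)[OF \<alpha>(1) sw(1), of x] \<alpha> mix_dens_pos[OF \<alpha>, of x]
      by (intro divide_left_mono) auto
    then have "phi x * (post_weight \<alpha> x * (1 + x\<^sup>2)) \<le> phi x * (\<alpha> * gmarg x / (phi x / 2) * (1 + x\<^sup>2))"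
      using p by (intro mult_left_mono mult_right_mono) auto
    also have "\<dots> = 2 * \<alpha> * (gmarg x * (1 + x\<^sup>2))" using phi_pos[of x] by simp
    also have "gmarg x * (1 + x\<^sup>2) \<le> 2" using gmarg_le_2[of x] p by (simp add: field_simps)
    finally have "phi x * (post_weight \<alpha> x * (1 + x\<^sup>2)) \<le> 4 * \<alpha>" using \<alpha> by simp
    also have "\<dots> \<le> 32 * \<alpha> * (1 + 1 / (1 + x\<^sup>2))"
      using \<alpha> p by (simp add: algebra_simps)
    finally show ?thesis using True by simp
  next
    case False
    have p: "1 + x\<^sup>2 > 0" by (simp add: add_pos_nonneg)
    have "\<bar>2 * L\<bar> \<le> \<bar>x\<bar>" using False sw by auto
    then have "(2 * L)\<^sup>2 \<le> x\<^sup>2" by (simp only: abs_le_square_iff)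
    then have "exp (- x\<^sup>2 / 4) \<le> exp (- L\<^sup>2)" by simp
    then have e: "exp (- x\<^sup>2 / 4) \<le> \<alpha>" using sw by simp
    have "phi x * (post_weight \<alpha> x * (1 + x\<^sup>2)) \<le> exp (- x\<^sup>2 / 2) / 2 * (1 * (1 + x\<^sup>2))"
      using post_weight_bounds[OF \<alpha>, of x] phi_le_exp[of x] p by (intro mult_mono) auto
    also have "\<dots> = (1 + x\<^sup>2)\<^sup>2 * exp (- x\<^sup>2 / 2) / 2 / (1 + x\<^sup>2)"
    proof -
      have "e / 2 * (1 * q) = q\<^sup>2 * e / 2 / q" if "q > 0" for e q :: real
        using that by (simp add: power2_eq_square)
      then show ?thesis using p .
    qed
    also have "\<dots> \<le> 64 * exp (- x\<^sup>2 / 4) / 2 / (1 + x\<^sup>2)"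
      using one_plus_sq_le_exp[of "x\<^sup>2"] p by (intro divide_right_mono) auto
    also have "\<dots> \<le> 64 * \<alpha> / 2 / (1 + x\<^sup>2)" using e p by (intro divide_right_mono) auto
    finally show ?thesis using False by simp
  qed
  have "has_bochner_integral lborel (\<lambda>x. indicator {- 2 * L..2 * L} x + 1 / (1 + x\<^sup>2)) (4 * L + pi)"
    using sw by (intro has_bochner_integral_add has_integral_inverse_1_plus_square) (simp add: has_bochner_integral_iff)
  then have b: "has_bochner_integral lborel ?b (32 * \<alpha> * (4 * L + pi))"
    by (rule has_bochner_integral_mult_right)
  have "(\<integral>\<^sup>+ x. ennreal (phi x * (post_weight \<alpha> x * (1 + x\<^sup>2))) \<partial>lborel) \<le> (\<integral>\<^sup>+ x. ennreal (?b x) \<partial>lborel)"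
    by (intro nn_integral_mono ennreal_leI bound)
  also have "\<dots> = ennreal (32 * \<alpha> * (4 * L + pi))"
    using b \<alpha> by (subst nn_integral_eq_integral) (auto simp: has_bochner_integral_iff add_nonneg_nonneg)
  also have "\<dots> \<le> ennreal (256 * \<alpha> * L)"
  proof (rule ennreal_leI)
    have "32 * \<alpha> * (4 * L + pi) \<le> 32 * \<alpha> * (8 * L)"
      using \<alpha> sw pi_less_4 by (intro mult_left_mono) auto
    then show "32 * \<alpha> * (4 * L + pi) \<le> 256 * \<alpha> * L" by simp
  qed
  finally show ?thesis by (simp add: L_def)
qed

lemma integrable_phi_score:
  assumes "0 < \<alpha>" "\<alpha> \<le> 1 / 2"
  shows "integrable lborel (\<lambda>x. phi x * score \<alpha> x)"
proof (rule Bochner_Integration.integrable_bound[where f="\<lambda>x. 2 * (gmarg x + phi x)"])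
  show "integrable lborel (\<lambda>x. 2 * (gmarg x + phi x))"
    using has_integral_gmarg integrable_phi by (auto simp: has_bochner_integral_iff)
  show "AE x in lborel. norm (phi x * score \<alpha> x) \<le> norm (2 * (gmarg x + phi x))"
  proof (rule AE_I2)
    fix x
    define D where "D = (1 - \<alpha>) * phi x + \<alpha> * gmarg x"
    have D: "phi x / 2 \<le> D" "D > 0" using mix_dens_ge(2)[OF assms] mix_dens_pos[of \<alpha> x] assms by (auto simp: D_def)
    have "norm (phi x * score \<alpha> x) = phi x * \<bar>gmarg x - phi x\<bar> / D"
      using D by (simp add: score_def D_def[symmetric] abs_mult)
    also have "\<dots> \<le> phi x * (gmarg x + phi x) / (phi x / 2)"
    proof (intro frac_le mult_left_mono)
      have "0 < gmarg x" "0 < phi x" by simp_all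
      then show "\<bar>gmarg x - phi x\<bar> \<le> gmarg x + phi x" by linarith
    qed (use D in \<open>auto intro: add_nonneg_nonneg\<close>)
    also have "\<dots> = norm (2 * (gmarg x + phi x))"
      using less_imp_neq[OF phi_pos[of x], THEN not_sym] by (simp add: add_nonneg_nonneg)
    finally show "norm (phi x * score \<alpha> x) \<le> norm (2 * (gmarg x + phi x))" .
  qed
qed measurable

text \<open>In the identity \<open>id\<close> the terms \<open>gmarg\<close> and \<open>phi\<close>
  have equal integrals, so only the negative quadratic term survives. It is kept on
  \<open>{5 * L..10 * L}\<close>, where \<open>phi x \<le> \<alpha> * gmarg x\<close> and it amounts
  to at least \<open>gmarg x / 8\<close>.\<close>

lemma expectation_score_le:
  assumes "0 < \<alpha>" "\<alpha> \<le> exp (-1)"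
  shows "(LINT x|lborel. phi x * score \<alpha> x) \<le> - 1 / (2600 * log_scale \<alpha>)"
proof -
  define L where "L = log_scale \<alpha>"
  note sw = small_weight[OF assms, folded L_def]
  \<comment> \<open>A lower bound for \<open>gmarg x / 8\<close> on the window:
    \<open>12928 = 8 * 16 * 101\<close>, as \<open>1 + x^2 \<le> 101 * L^2\<close> there.\<close>
  define k where "k = 1 / (12928 * L\<^sup>2)"
  have L: "L > 0" "L\<^sup>2 \<ge> 1" using sw by (auto simp: power2_eq_square intro: mult_mono[of 1 L 1 L, simplified])
  let ?b = "\<lambda>x. gmarg x - phi x - k * indicator {5 * L..10 * L} x"
  have id: "phi x * score \<alpha> x = gmarg x - phi x - \<alpha> * (gmarg x - phi x)\<^sup>2 / ((1 - \<alpha>) * phi x + \<alpha> * gmarg x)" for x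
    using mix_dens_pos[of \<alpha> x] assms sw
    by (simp add: score_def divide_simps) (simp add: power2_eq_square algebra_simps)
  have bound: "phi x * score \<alpha> x \<le> ?b x" for x
  proof (cases "x \<in> {5 * L..10 * L}")
    case False
    have "0 \<le> \<alpha> * (gmarg x - phi x)\<^sup>2 / ((1 - \<alpha>) * phi x + \<alpha> * gmarg x)"
      using mix_dens_pos[of \<alpha> x] assms sw by (intro divide_nonneg_pos) auto
    then show ?thesis using False by (simp add: id)
  next
    case True
    have p: "1 + x\<^sup>2 > 0" by (simp add: add_pos_nonneg)
    have x1: "(5 * L)\<^sup>2 \<le> x\<^sup>2" and x2: "x\<^sup>2 \<le> (10 * L)\<^sup>2"
      using True L by (intro power_mono; simp)+
    \<comment> \<open>The exponent \<open>25 / 4 * L^2\<close> splits into \<open>5 * L^2\<close>,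
      which pays for the constant 32, and \<open>5 / 4 * L^2\<close>, which still brings the
      exponential down to \<open>\<alpha> = exp (- L^2)\<close>.\<close>
    have phi: "phi x \<le> \<alpha> * gmarg x"
    proof -
      have "exp (5::real) = exp 1 ^ 5" by (simp add: exp_of_nat_mult[symmetric])
      also have "\<dots> \<ge> 2 ^ 5" using exp_ge_add_one_self[of "1::real"] by (intro power_mono) auto
      finally have "32 \<le> exp (5::real)" by simp
      also have "\<dots> \<le> exp (5 * L\<^sup>2)" using L by simp
      finally have "32 * exp (- x\<^sup>2 / 4) \<le> exp (5 * L\<^sup>2) * exp (- (5 * L)\<^sup>2 / 4)"
        using x1 by (intro mult_mono) auto
      also have "\<dots> = exp (- 5 / 4 * L\<^sup>2)" by (simp add: exp_add[symmetric] power_mult_distrib)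
      also have "\<dots> \<le> exp (- L\<^sup>2)" by simp
      finally have "32 * exp (- x\<^sup>2 / 4) \<le> \<alpha>" using sw by simp
      then have a: "32 * exp (- x\<^sup>2 / 4) * (1 / (16 * (1 + x\<^sup>2))) \<le> \<alpha> * gmarg x"
        using gmarg_ge_16[of x] assms p by (intro mult_mono) auto
      have "phi x \<le> exp (- x\<^sup>2 / 2) / 2" by (rule phi_le_exp)
      also have "\<dots> = exp (- x\<^sup>2 / 4) * exp (- x\<^sup>2 / 4) / 2" by (simp add: exp_add[symmetric])
      also have "\<dots> \<le> exp (- x\<^sup>2 / 4) * (4 / (1 + x\<^sup>2)) / 2"
      proof (intro divide_right_mono mult_left_mono)
        show "exp (- x\<^sup>2 / 4) \<le> 4 / (1 + x\<^sup>2)"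
          using one_plus_le_exp_quarter[of "x\<^sup>2"] p by (simp add: exp_minus field_simps)
      qed auto
      also have "\<dots> = 32 * exp (- x\<^sup>2 / 4) * (1 / (16 * (1 + x\<^sup>2)))" using p by (simp add: divide_simps)
      also have "\<dots> \<le> \<alpha> * gmarg x" by (rule a)
      finally show ?thesis .
    qed
    have "\<alpha> * gmarg x \<le> 1 / 2 * gmarg x" using sw by (intro mult_right_mono) auto
    with phi have half: "gmarg x / 2 \<le> gmarg x - phi x" by linarith
    have "(1 - \<alpha>) * phi x \<le> 1 * phi x" using assms by (intro mult_right_mono) auto
    then have D: "(1 - \<alpha>) * phi x + \<alpha> * gmarg x \<le> 2 * \<alpha> * gmarg x" using phi by linarith
    have "x\<^sup>2 \<le> 100 * L\<^sup>2" using x2 by (simp add: power_mult_distrib)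
    then have "1 + x\<^sup>2 \<le> 101 * L\<^sup>2" using L by linarith
    then have "8 * (16 * (1 + x\<^sup>2)) \<le> 12928 * L\<^sup>2" by simp
    then have "k \<le> 1 / (8 * (16 * (1 + x\<^sup>2)))"
      unfolding k_def using p L by (intro divide_left_mono) auto
    also have "\<dots> = (1 / (16 * (1 + x\<^sup>2))) / 8" by simp
    also have "\<dots> \<le> gmarg x / 8" using gmarg_ge_16[of x] by (intro divide_right_mono) auto
    also have "\<dots> = \<alpha> * (gmarg x / 2)\<^sup>2 / (2 * \<alpha> * gmarg x)"
      using assms less_imp_neq[OF gmarg_pos[of x], THEN not_sym] by (simp add: power2_eq_square divide_simps)
    also have "\<dots> \<le> \<alpha> * (gmarg x - phi x)\<^sup>2 / ((1 - \<alpha>) * phi x + \<alpha> * gmarg x)"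
      using D half assms sw by (intro frac_le mult_left_mono power_mono mix_dens_pos) auto
    finally show ?thesis using True by (simp add: id)
  qed
  have hb: "has_bochner_integral lborel ?b (1 - 1 - k * (10 * L - 5 * L))"
    using L by (intro has_bochner_integral_diff has_integral_gmarg has_bochner_integral_mult_right)
      (auto simp: has_bochner_integral_iff integrable_phi integral_phi)
  have "(LINT x|lborel. phi x * score \<alpha> x) \<le> (LINT x|lborel. ?b x)"
    using hb assms sw by (intro integral_mono integrable_phi_score bound) (auto simp: has_bochner_integral_iff)
  also have "\<dots> = - (k * (5 * L))" using hb by (simp add: has_bochner_integral_iff)
  also have "k * (5 * L) = 5 / (12928 * L)" using L by (simp add: k_def power2_eq_square)
  also have "- (5 / (12928 * L)) \<le> - 1 / (2600 * L)" using L by (simp add: divide_simps)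
  finally show ?thesis by (simp add: L_def)
qed

text \<open>Split at distance \<open>L\<close>, writing \<open>D\<close> for the mixture density.
  Inside, \<open>D \<ge> phi x / 2\<close> gives \<open>24 * exp (L^2 / 2) * gmarg x\<close>;
  outside, \<open>D^2 \<ge> \<alpha> * gmarg x * phi x / 2\<close> gives at most
  \<open>2 * gmarg x / \<alpha>\<close>, whose tail integral is of order
  \<open>1 / (\<alpha> * L)\<close>.\<close>

lemma expectation_score_sq_le:
  assumes "0 < \<alpha>" "\<alpha> \<le> exp (-1)"
  shows "integrable lborel (\<lambda>x. phi x * (score \<alpha> x)\<^sup>2)"
    and "(LINT x|lborel. phi x * (score \<alpha> x)\<^sup>2) \<le> 60 / (\<alpha> * log_scale \<alpha>)"
proof -
  define L where "L = log_scale \<alpha>"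
  note sw = small_weight[OF assms, folded L_def]
  have L: "L > 0" using sw by simp
  \<comment> \<open>The argument is written \<open>0 + 1 / L * x\<close> to match the affine change
    of variables for \<open>lborel\<close>.\<close>
  let ?b = "\<lambda>x. 4 * phi x + 24 * exp (L\<^sup>2 / 2) * gmarg x + 8 / (\<alpha> * L\<^sup>2) * (1 / (1 + (0 + 1 / L * x)\<^sup>2))"
  have bound: "phi x * (score \<alpha> x)\<^sup>2 \<le> ?b x" for x
  proof -
    define D where "D = (1 - \<alpha>) * phi x + \<alpha> * gmarg x"
    have D: "phi x / 2 \<le> D" "\<alpha> * gmarg x \<le> D" "D > 0"
      using mix_dens_ge[OF assms(1) sw(1), of x] mix_dens_pos[of \<alpha> x] assms sw by (auto simp: D_def)
    have pos: "phi x > 0" "gmarg x > 0" by simp_all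
    have "0 < phi x * gmarg x" by simp
    then have "(gmarg x - phi x)\<^sup>2 \<le> (phi x)\<^sup>2 + (gmarg x)\<^sup>2"
      by (simp add: power2_eq_square algebra_simps)
    then have "phi x * (gmarg x - phi x)\<^sup>2 / D\<^sup>2 \<le> phi x * ((phi x)\<^sup>2 + (gmarg x)\<^sup>2) / D\<^sup>2"
      by (intro divide_right_mono mult_left_mono) auto
    then have 1: "phi x * (score \<alpha> x)\<^sup>2 \<le> phi x * (phi x)\<^sup>2 / D\<^sup>2 + phi x * (gmarg x)\<^sup>2 / D\<^sup>2"
      by (simp add: score_def D_def[symmetric] power_divide distrib_left add_divide_distrib)
    have Dsq: "(phi x / 2)\<^sup>2 \<le> D\<^sup>2" using D pos by (intro power_mono) auto
    have D0: "0 < D\<^sup>2 * (phi x / 2)\<^sup>2" using D(3) pos by (intro mult_pos_pos zero_less_power) simp_all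
    have "phi x * (phi x)\<^sup>2 / D\<^sup>2 \<le> phi x * (phi x)\<^sup>2 / (phi x / 2)\<^sup>2"
      by (intro divide_left_mono Dsq D0) simp
    also have "\<dots> = 4 * phi x" using pos by (simp add: power2_eq_square)
    finally have 2: "phi x * (phi x)\<^sup>2 / D\<^sup>2 \<le> 4 * phi x" .
    show ?thesis
    proof (cases "\<bar>x\<bar> \<le> L")
      case True
      then have "x\<^sup>2 \<le> L\<^sup>2" using abs_le_square_iff[of x L] L by simp
      then have e: "exp (x\<^sup>2 / 2) \<le> exp (L\<^sup>2 / 2)" by simp
      have "gmarg x / phi x \<le> 6 * exp (x\<^sup>2 / 2) / (1 + x\<^sup>2)" by (rule gmarg_div_phi_le)
      also have "\<dots> \<le> 6 * exp (x\<^sup>2 / 2) / 1" by (intro divide_left_mono) (auto simp: add_pos_nonneg)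
      also have "\<dots> \<le> 6 * exp (L\<^sup>2 / 2)" using e by simp
      finally have r: "gmarg x / phi x \<le> 6 * exp (L\<^sup>2 / 2)" .
      have "phi x * (gmarg x)\<^sup>2 / D\<^sup>2 \<le> phi x * (gmarg x)\<^sup>2 / (phi x / 2)\<^sup>2"
        by (intro divide_left_mono Dsq D0) simp
      also have "\<dots> = 4 * gmarg x * (gmarg x / phi x)" using pos by (simp add: power2_eq_square)
      also have "\<dots> \<le> 4 * gmarg x * (6 * exp (L\<^sup>2 / 2))" using r pos by (intro mult_left_mono) auto
      finally have "phi x * (gmarg x)\<^sup>2 / D\<^sup>2 \<le> 24 * exp (L\<^sup>2 / 2) * gmarg x" by (simp add: mult_ac)
      moreover have "0 \<le> 8 / (\<alpha> * L\<^sup>2) * (1 / (1 + (0 + 1 / L * x)\<^sup>2))" using assms by (simp add: add_nonneg_nonneg)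
      ultimately show ?thesis using 1 2 by linarith
    next
      case False
      then have xL: "L\<^sup>2 \<le> x\<^sup>2" using abs_le_square_iff[of L x] L by simp
      have pL: "L\<^sup>2 > 0" "x\<^sup>2 > 0" using L xL False by auto
      have "\<alpha> * gmarg x * (phi x / 2) \<le> D * D" by (intro mult_mono D(1,2) less_imp_le[OF D(3)]) simp
      then have "phi x * (gmarg x)\<^sup>2 / D\<^sup>2 \<le> phi x * (gmarg x)\<^sup>2 / (\<alpha> * gmarg x * (phi x / 2))"
        unfolding power2_eq_square
        by (intro divide_left_mono mult_pos_pos D(3)) (use assms in simp_all)
      also have "\<dots> = 2 * gmarg x / \<alpha>" using pos by (simp add: power2_eq_square)
      also have "\<dots> \<le> 2 * (2 / (1 + x\<^sup>2)) / \<alpha>" using gmarg_le_2[of x] assms by (intro divide_right_mono mult_left_mono) auto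
      also have "\<dots> \<le> 2 * (2 / ((L\<^sup>2 + x\<^sup>2) / 2)) / \<alpha>"
        using xL pL assms by (intro divide_right_mono mult_left_mono divide_left_mono) (auto simp: add_pos_nonneg)
      also have "\<dots> = 8 / (\<alpha> * L\<^sup>2) * (1 / (1 + (0 + 1 / L * x)\<^sup>2))"
      proof -
        have "1 + (0 + 1 / L * x)\<^sup>2 = (L\<^sup>2 + x\<^sup>2) / L\<^sup>2" using L by (simp add: power_divide add_divide_distrib)
        then show ?thesis using pL by simp
      qed
      finally have "phi x * (gmarg x)\<^sup>2 / D\<^sup>2 \<le> 8 / (\<alpha> * L\<^sup>2) * (1 / (1 + (0 + 1 / L * x)\<^sup>2))" .
      moreover have "0 \<le> 24 * exp (L\<^sup>2 / 2) * gmarg x" by simp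
      ultimately show ?thesis using 1 2 by linarith
    qed
  qed
  have "has_bochner_integral lborel (\<lambda>x. 1 / (1 + (0 + 1 / L * x)\<^sup>2)) (L * pi)"
    using has_integral_inverse_1_plus_square L
      lborel_integrable_real_affine[of "\<lambda>x::real. 1 / (1 + x\<^sup>2)" "1 / L" 0]
      lborel_integral_real_affine[of "1 / L" "\<lambda>x::real. 1 / (1 + x\<^sup>2)" 0]
    by (simp add: has_bochner_integral_iff field_simps)
  then have hb: "has_bochner_integral lborel ?b (4 * 1 + 24 * exp (L\<^sup>2 / 2) * 1 + 8 / (\<alpha> * L\<^sup>2) * (L * pi))"
    by (intro has_bochner_integral_add has_bochner_integral_mult_right has_integral_gmarg)
      (auto simp: has_bochner_integral_iff integrable_phi integral_phi)
  show int: "integrable lborel (\<lambda>x. phi x * (score \<alpha> x)\<^sup>2)"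
  proof (rule Bochner_Integration.integrable_bound)
    show "integrable lborel ?b" using hb by (simp add: has_bochner_integral_iff)
    show "AE x in lborel. norm (phi x * (score \<alpha> x)\<^sup>2) \<le> norm (?b x)"
    proof (rule AE_I2)
      fix x
      have "0 \<le> phi x * (score \<alpha> x)\<^sup>2" by simp
      then show "norm (phi x * (score \<alpha> x)\<^sup>2) \<le> norm (?b x)"
        using bound[of x] by (simp only: real_norm_def)
    qed
  qed measurable
  have "(LINT x|lborel. phi x * (score \<alpha> x)\<^sup>2) \<le> (LINT x|lborel. ?b x)"
    using hb by (intro integral_mono int bound) (auto simp: has_bochner_integral_iff)
  also have "\<dots> = 4 + 24 * exp (L\<^sup>2 / 2) + 8 * pi / (\<alpha> * L)"
    using hb L by (simp add: has_bochner_integral_iff power2_eq_square)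
  also have "\<dots> \<le> 4 / (\<alpha> * L) + 24 / (\<alpha> * L) + 32 / (\<alpha> * L)"
  proof (intro add_mono)
    \<comment> \<open>Since \<open>exp (L^2 / 2)\<close> is the inverse square root of
      \<open>\<alpha>\<close> and dominates \<open>L\<close>, each of the three pieces is at most a
      constant times \<open>1 / (\<alpha> * L)\<close>.\<close>
    have "L \<le> 1 + L\<^sup>2 / 2" using zero_le_power2[of "L - 1"] by (simp add: power2_eq_square algebra_simps)
    also have "\<dots> \<le> exp (L\<^sup>2 / 2)" by (rule exp_ge_add_one_self)
    finally have e: "L \<le> exp (L\<^sup>2 / 2)" .
    then have "exp (L\<^sup>2 / 2) * L \<le> exp (L\<^sup>2 / 2) * exp (L\<^sup>2 / 2)" by (intro mult_left_mono) auto
    then have "exp (L\<^sup>2 / 2) * L * exp (- L\<^sup>2) \<le> exp (L\<^sup>2 / 2) * exp (L\<^sup>2 / 2) * exp (- L\<^sup>2)"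
      by (intro mult_right_mono) auto
    also have "\<dots> = 1" by (simp add: exp_add[symmetric])
    finally have 3: "exp (L\<^sup>2 / 2) * (\<alpha> * L) \<le> 1" using sw by (simp add: mult_ac)
    have "1 \<le> exp (L\<^sup>2 / 2)" by simp
    then have "1 * (\<alpha> * L) \<le> exp (L\<^sup>2 / 2) * (\<alpha> * L)" using assms L by (intro mult_right_mono) auto
    with 3 have 4: "\<alpha> * L \<le> 1" by simp
    show "4 \<le> 4 / (\<alpha> * L)" using 4 assms L by (simp add: field_simps)
    show "24 * exp (L\<^sup>2 / 2) \<le> 24 / (\<alpha> * L)" using 3 assms L by (simp add: field_simps)
    show "8 * pi / (\<alpha> * L) \<le> 32 / (\<alpha> * L)" using assms L pi_less_4 by (intro divide_right_mono) auto
  qed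
  also have "\<dots> = 60 / (\<alpha> * L)" by (simp add: add_divide_distrib[symmetric])
  finally show "(LINT x|lborel. phi x * (score \<alpha> x)\<^sup>2) \<le> 60 / (\<alpha> * log_scale \<alpha>)" by (simp add: L_def)
qed

text \<open>The denominator dominates both \<open>\<alpha> * gmarg x\<close> and
  \<open>phi x / 2\<close>, hence \<open>\<alpha> * phi x\<close>. Exponents
  \<open>c * \<alpha> * score \<alpha> x\<close> with \<open>c\<close> in \<open>{0..1}\<close>
  therefore stay in the range of the quadratic bound for \<open>exp\<close>.\<close>

lemma score_scaled_bounds:
  assumes "0 < \<alpha>" "\<alpha> \<le> 1 / 2"
  shows "\<alpha> * score \<alpha> x \<le> 1" "- 1 \<le> \<alpha> * score \<alpha> x"
proof -
  define D where "D = (1 - \<alpha>) * phi x + \<alpha> * gmarg x"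
  have D: "phi x / 2 \<le> D" "\<alpha> * gmarg x \<le> D" "D > 0"
    using mix_dens_ge[OF assms, of x] mix_dens_pos[of \<alpha> x] assms by (auto simp: D_def)
  have eq: "\<alpha> * score \<alpha> x = (\<alpha> * gmarg x - \<alpha> * phi x) / D"
    by (simp add: score_def D_def algebra_simps)
  have p: "0 \<le> \<alpha> * phi x" "0 \<le> \<alpha> * gmarg x" "\<alpha> * phi x \<le> 1 / 2 * phi x" using assms by (auto intro!: mult_right_mono)
  show "\<alpha> * score \<alpha> x \<le> 1" unfolding eq using D p by (simp add: field_simps)
  have "- 1 * D \<le> \<alpha> * gmarg x - \<alpha> * phi x" using D p by linarith
  then show "- 1 \<le> \<alpha> * score \<alpha> x" unfolding eq using D by (simp only: pos_le_divide_eq)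
qed

lemma exp_le_quadratic: "exp x \<le> 1 + x + x\<^sup>2" if "\<bar>x\<bar> \<le> 1" for x :: real
proof (cases "x \<ge> 0")
  case True
  then show ?thesis using that exp_bound[of x] by simp
next
  case False
  define y where "y = - x"
  have y: "y > 0" using False by (simp add: y_def)
  have "exp x = 1 / exp y" by (simp add: y_def exp_minus field_simps)
  also have "\<dots> \<le> 1 / (1 + y)" using y exp_ge_add_one_self[of y] by (intro divide_left_mono) auto
  also have "\<dots> \<le> 1 - y + y\<^sup>2"
  proof -
    have "(1 - y + y\<^sup>2) * (1 + y) = 1 + y ^ 3" by (simp add: power2_eq_square power3_eq_cube algebra_simps)
    moreover have "0 \<le> y ^ 3" using y by simp
    ultimately have "1 \<le> (1 - y + y\<^sup>2) * (1 + y)" by simp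
    then show ?thesis using y by (simp add: pos_divide_le_eq)
  qed
  finally show ?thesis by (simp add: y_def)
qed

text \<open>Second-order expansion of \<open>exp\<close>. The linear term gives
  \<open>- c / 2600\<close> and the quadratic one \<open>60 * c^2\<close>, both in units of
  \<open>\<alpha> / log_scale \<alpha>\<close>, so a small fixed \<open>c\<close> makes the exponent
  negative.\<close>

lemma expectation_exp_score_le:
  fixes c :: real
  assumes "0 < \<alpha>" "\<alpha> \<le> exp (-1)" and c: "0 \<le> c" "c \<le> 1"
  shows "(\<integral>\<^sup>+ x. ennreal (phi x * exp (c * \<alpha> * score \<alpha> x)) \<partial>lborel)
    \<le> ennreal (exp ((60 * c\<^sup>2 - c / 2600) * (\<alpha> / log_scale \<alpha>)))"
proof -
  note sw = small_weight[OF assms(1,2)]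
  let ?b = "\<lambda>x. phi x + c * \<alpha> * (phi x * score \<alpha> x) + (c * \<alpha>)\<^sup>2 * (phi x * (score \<alpha> x)\<^sup>2)"
  have bound: "phi x * exp (c * \<alpha> * score \<alpha> x) \<le> ?b x" for x
  proof -
    have "\<bar>c * \<alpha> * score \<alpha> x\<bar> = c * \<bar>\<alpha> * score \<alpha> x\<bar>" using c by (simp add: abs_mult)
    also have "\<dots> \<le> 1 * 1" using c score_scaled_bounds[OF assms(1) sw(1), of x] by (intro mult_mono) auto
    finally have "exp (c * \<alpha> * score \<alpha> x) \<le> 1 + c * \<alpha> * score \<alpha> x + (c * \<alpha> * score \<alpha> x)\<^sup>2"
      by (intro exp_le_quadratic) simp
    then have "phi x * exp (c * \<alpha> * score \<alpha> x) \<le> phi x * (1 + c * \<alpha> * score \<alpha> x + (c * \<alpha> * score \<alpha> x)\<^sup>2)"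
      by (intro mult_left_mono) auto
    then show ?thesis by (simp add: algebra_simps power_mult_distrib)
  qed
  have int: "integrable lborel (\<lambda>x. phi x * score \<alpha> x)" "integrable lborel (\<lambda>x. phi x * (score \<alpha> x)\<^sup>2)"
    using integrable_phi_score[OF assms(1) sw(1)] expectation_score_sq_le(1)[OF assms(1,2)] by auto
  have b0: "0 \<le> ?b x" for x
  proof -
    have "0 \<le> phi x * exp (c * \<alpha> * score \<alpha> x)" by simp
    then show ?thesis using bound[of x] by linarith
  qed
  have "(\<integral>\<^sup>+ x. ennreal (phi x * exp (c * \<alpha> * score \<alpha> x)) \<partial>lborel) \<le> (\<integral>\<^sup>+ x. ennreal (?b x) \<partial>lborel)"
    by (intro nn_integral_mono ennreal_leI bound)
  also have "\<dots> = ennreal (LINT x|lborel. ?b x)"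
    using int integrable_phi b0 by (intro nn_integral_eq_integral) auto
  also have "(LINT x|lborel. ?b x) = 1 + c * \<alpha> * (LINT x|lborel. phi x * score \<alpha> x)
      + (c * \<alpha>)\<^sup>2 * (LINT x|lborel. phi x * (score \<alpha> x)\<^sup>2)"
    using int integrable_phi by (simp add: integral_phi)
  also have "\<dots> \<le> 1 + c * \<alpha> * (- 1 / (2600 * log_scale \<alpha>)) + (c * \<alpha>)\<^sup>2 * (60 / (\<alpha> * log_scale \<alpha>))"
    using assms expectation_score_le[OF assms(1,2)] expectation_score_sq_le(2)[OF assms(1,2)]
    by (intro add_mono mult_left_mono) auto
  also have "\<dots> = 1 + (60 * c\<^sup>2 - c / 2600) * (\<alpha> / log_scale \<alpha>)"
    using assms sw by (simp add: power2_eq_square field_simps)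
  also have "\<dots> \<le> exp ((60 * c\<^sup>2 - c / 2600) * (\<alpha> / log_scale \<alpha>))" by (rule exp_ge_add_one_self)
  finally show ?thesis by (simp add: ennreal_leI)
qed

subsection \<open>Bounds at the marginal maximum likelihood estimator\<close>

lemma nn_integral_data_law_component:
  assumes i: "i < n" and [measurable]: "f \<in> borel_measurable borel"
  shows "(\<integral>\<^sup>+ X. f (X i) \<partial>data_law n \<theta>) = (\<integral>\<^sup>+ x. ennreal (normal_density (\<theta> i) 1 x) * f x \<partial>lborel)"
proof -
  let ?N = "\<lambda>i. density lborel (\<lambda>x. ennreal (normal_density (\<theta> i) 1 x))"
  have "distr (data_law n \<theta>) (?N i) (\<lambda>X. X i) = ?N i"
    unfolding data_law_def using i by (intro distr_PiM_component prob_space_normal_density) auto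
  then have "(\<integral>\<^sup>+ x. f x \<partial>?N i) = (\<integral>\<^sup>+ x. f x \<partial>distr (data_law n \<theta>) (?N i) (\<lambda>X. X i))" by simp
  also have "\<dots> = (\<integral>\<^sup>+ X. f (X i) \<partial>data_law n \<theta>)"
    using i by (intro nn_integral_distr) (auto simp: data_law_def)
  finally show ?thesis by (simp add: nn_integral_density)
qed

lemma nn_integral_data_law_prod:
  assumes [measurable]: "\<And>i. f i \<in> borel_measurable borel"
  shows "(\<integral>\<^sup>+ X. (\<Prod>i<n. f i (X i)) \<partial>data_law n \<theta>)
    = (\<Prod>i<n. \<integral>\<^sup>+ x. ennreal (normal_density (\<theta> i) 1 x) * f i x \<partial>lborel)"
proof -
  interpret product_sigma_finite "\<lambda>i. density lborel (\<lambda>x. ennreal (normal_density (\<theta> i) 1 x))"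
    by (intro product_sigma_finite.intro prob_space_imp_sigma_finite prob_space_normal_density) simp
  show ?thesis
    unfolding data_law_def by (subst product_nn_integral_prod) (auto simp: nn_integral_density)
qed

lemma nn_integral_normal_density: "(\<integral>\<^sup>+ x. ennreal (normal_density m 1 x) \<partial>lborel) = 1"
  using prob_space.emeasure_space_1[OF prob_space_normal_density[of 1 m]]
  by (simp add: emeasure_density)

lemma nn_integral_normal_density_sq:
  "(\<integral>\<^sup>+ x. ennreal (normal_density m 1 x) * ennreal ((x - m)\<^sup>2) \<partial>lborel) = 1"
proof -
  have h: "has_bochner_integral lborel (\<lambda>x. normal_density m 1 x * (x - m)\<^sup>2) 1"
    using normal_moment_even[of 1 m 1] by simp
  have "(\<integral>\<^sup>+ x. ennreal (normal_density m 1 x) * ennreal ((x - m)\<^sup>2) \<partial>lborel)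
      = (\<integral>\<^sup>+ x. ennreal (normal_density m 1 x * (x - m)\<^sup>2) \<partial>lborel)"
    by (simp add: ennreal_mult)
  also have "\<dots> = 1"
    using h by (subst nn_integral_eq_integral) (auto simp: has_bochner_integral_iff)
  finally show ?thesis .
qed

text \<open>Independence factorises the Chernoff moment: a signal contributes at most
  \<open>exp c\<close>, a noise coordinate \<open>exp (- \<rho>)\<close>, and the marked coordinate
  \<open>i\<close> at most \<open>2 * exp 1\<close>. The factor \<open>1 + (X i)^2\<close> is the
  risk of coordinate \<open>i\<close> when its weight is only known to be at most 1.\<close>

lemma data_law_exp_score_le:
  fixes c :: real
  assumes \<alpha>: "0 < \<alpha>" "\<alpha> \<le> exp (-1)" and c: "0 \<le> c" "c \<le> 1"
    and \<rho>: "\<rho> = (c / 2600 - 60 * c\<^sup>2) * (\<alpha> / log_scale \<alpha>)" "\<rho> \<ge> 0"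
    and i: "i < n" "\<theta> i = 0"
    and card: "card {j \<in> {..<n}. \<theta> j \<noteq> 0} \<le> s"
  shows "(\<integral>\<^sup>+ X. ennreal (1 + (X i)\<^sup>2) * (\<Prod>j<n. ennreal (exp (c * \<alpha> * score \<alpha> (X j)))) \<partial>data_law n \<theta>)
    \<le> ennreal (exp (2 + \<rho> + real s * (c + \<rho>) - real n * \<rho>))"
proof -
  note sw = small_weight[OF \<alpha>]
  define S where "S = {j \<in> {..<n}. \<theta> j \<noteq> 0}"
  define f where "f j x = (if j = i then ennreal (1 + x\<^sup>2) else 1) * ennreal (exp (c * \<alpha> * score \<alpha> x))" for j x
  \<comment> \<open>The exponents of the factors: 2 at \<open>i\<close>, \<open>c\<close> on the
    signals and \<open>- \<rho>\<close> elsewhere, written as corrections to a constant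
    \<open>- \<rho>\<close> so that the sum is immediate.\<close>
  define d where "d j = (if j = i then 2 + \<rho> else 0) + (if j \<in> S then c + \<rho> else 0) - \<rho>" for j
  have [measurable]: "f j \<in> borel_measurable borel" for j unfolding f_def by measurable
  have le_c: "exp (c * \<alpha> * score \<alpha> x) \<le> exp c" for x
  proof -
    have "c * (\<alpha> * score \<alpha> x) \<le> c * 1"
      using c score_scaled_bounds(1)[OF \<alpha>(1) sw(1)] by (intro mult_left_mono) auto
    then show ?thesis by (simp add: mult.assoc)
  qed
  have eq: "ennreal (1 + (X i)\<^sup>2) * (\<Prod>j<n. ennreal (exp (c * \<alpha> * score \<alpha> (X j)))) = (\<Prod>j<n. f j (X j))" for X
    unfolding f_def prod.distrib using i by (simp add: prod.If_cases Int_absorb1 Int_commute)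
  have comp: "(\<integral>\<^sup>+ x. ennreal (normal_density (\<theta> j) 1 x) * f j x \<partial>lborel) \<le> ennreal (exp (d j))" if "j < n" for j
  proof (cases "j = i")
    case True
    have "(\<integral>\<^sup>+ x. ennreal (normal_density (\<theta> j) 1 x) * f j x \<partial>lborel)
        \<le> (\<integral>\<^sup>+ x. ennreal (exp 1 * (phi x * (1 + x\<^sup>2))) \<partial>lborel)"
    proof (rule nn_integral_mono)
      fix x
      have "exp (c * \<alpha> * score \<alpha> x) \<le> exp 1" using le_c[of x] c by (simp add: order.trans[OF le_c])
      then have "phi x * ((1 + x\<^sup>2) * exp (c * \<alpha> * score \<alpha> x)) \<le> phi x * ((1 + x\<^sup>2) * exp 1)"
        by (intro mult_left_mono) (auto simp: add_nonneg_nonneg)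
      then show "ennreal (normal_density (\<theta> j) 1 x) * f j x \<le> ennreal (exp 1 * (phi x * (1 + x\<^sup>2)))"
        using True i
        by (simp add: f_def phi_def ennreal_mult'[symmetric] ennreal_leI mult_ac add_nonneg_nonneg
            del: ennreal_plus)
    qed
    also have "\<dots> = ennreal (exp 1 * 2)"
      using has_integral_phi_1_plus_sq
      by (subst nn_integral_eq_integral) (auto simp: has_bochner_integral_iff add_nonneg_nonneg)
    also have "\<dots> \<le> ennreal (exp (d j))"
    proof (rule ennreal_leI)
      have "exp 1 * 2 \<le> exp 1 * exp (1::real)" using exp_ge_add_one_self[of "1::real"] by (intro mult_left_mono) auto
      also have "\<dots> = exp 2" by (simp add: exp_add[symmetric])
      also have "\<dots> \<le> exp (d j)" using True i \<rho> c by (simp add: d_def S_def)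
      finally show "exp 1 * 2 \<le> exp (d j)" .
    qed
    finally show ?thesis .
  next
    case False
    show ?thesis
    proof (cases "j \<in> S")
      case True
      have "(\<integral>\<^sup>+ x. ennreal (normal_density (\<theta> j) 1 x) * f j x \<partial>lborel)
          \<le> (\<integral>\<^sup>+ x. ennreal (normal_density (\<theta> j) 1 x) * ennreal (exp c) \<partial>lborel)"
        using False le_c by (intro nn_integral_mono mult_left_mono) (auto simp: f_def ennreal_leI)
      also have "\<dots> = ennreal (exp c)"
        by (simp add: nn_integral_multc nn_integral_normal_density)
      finally show ?thesis using True False by (simp add: d_def)
    next
      case jS: False
      then have "\<theta> j = 0" using that by (simp add: S_def)
      then have "(\<integral>\<^sup>+ x. ennreal (normal_density (\<theta> j) 1 x) * f j x \<partial>lborel)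
          = (\<integral>\<^sup>+ x. ennreal (phi x * exp (c * \<alpha> * score \<alpha> x)) \<partial>lborel)"
        using False by (simp add: f_def phi_def ennreal_mult'[symmetric])
      also have "\<dots> \<le> ennreal (exp ((60 * c\<^sup>2 - c / 2600) * (\<alpha> / log_scale \<alpha>)))"
        by (rule expectation_exp_score_le[OF \<alpha> c])
      also have "(60 * c\<^sup>2 - c / 2600) * (\<alpha> / log_scale \<alpha>) = - \<rho>"
        unfolding \<rho> by (simp add: algebra_simps)
      finally show ?thesis using jS False by (simp add: d_def)
    qed
  qed
  have "(\<integral>\<^sup>+ X. ennreal (1 + (X i)\<^sup>2) * (\<Prod>j<n. ennreal (exp (c * \<alpha> * score \<alpha> (X j)))) \<partial>data_law n \<theta>)
      = (\<Prod>j<n. \<integral>\<^sup>+ x. ennreal (normal_density (\<theta> j) 1 x) * f j x \<partial>lborel)"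
    unfolding eq by (rule nn_integral_data_law_prod) simp
  also have "\<dots> \<le> (\<Prod>j<n. ennreal (exp (d j)))"
    by (intro prod_mono_ennreal) (auto intro: comp)
  also have "\<dots> = ennreal (exp (\<Sum>j<n. d j))"
    by (simp add: prod_ennreal exp_sum)
  also have "(\<Sum>j<n. d j) = 2 + \<rho> + real (card S) * (c + \<rho>) - real n * \<rho>"
  proof -
    have "{..<n} \<inter> S = S" by (auto simp: S_def)
    then have "(\<Sum>j<n. if j \<in> S then c + \<rho> else 0) = real (card S) * (c + \<rho>)"
      by (simp add: sum.If_cases)
    then show ?thesis using i by (simp add: d_def sum.distrib sum_subtractf)
  qed
  also have "ennreal (exp \<dots>) \<le> ennreal (exp (2 + \<rho> + real s * (c + \<rho>) - real n * \<rho>))"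
    using card[folded S_def] c(1) \<rho>(2)
    by (intro ennreal_leI) (auto intro!: mult_right_mono)
  finally show ?thesis .
qed

section \<open>Deterministic bounds for a fixed data set\<close>

context
  fixes n :: nat and ahat :: "(nat \<Rightarrow> real) \<Rightarrow> real" and X :: "nat \<Rightarrow> real"
  assumes mmle: "is_mmle n ahat" and X: "X \<in> space (PiM {..<n} (\<lambda>_. lborel))"
    and n: "n \<ge> 1"
begin

lemma ahat_bounds: "0 < ahat X" "ahat X \<le> 1"
  and ahat_max: "alpha_low n \<le> \<beta> \<Longrightarrow> \<beta> \<le> 1 \<Longrightarrow> loglik n X \<beta> \<le> loglik n X (ahat X)"
  and ahat_ge: "alpha_low n \<le> ahat X"
proof -
  have "0 < alpha_low n" unfolding alpha_low_def using n by (intro thr_inv_bounds) simp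
  then show "0 < ahat X" "ahat X \<le> 1" "alpha_low n \<le> ahat X"
    "alpha_low n \<le> \<beta> \<Longrightarrow> \<beta> \<le> 1 \<Longrightarrow> loglik n X \<beta> \<le> loglik n X (ahat X)"
    using mmle X unfolding is_mmle_def by fastforce+
qed

lemma alpha_mod_bounds:
  assumes "A \<ge> 0"
  shows "0 < alpha_mod A n (ahat X)" "alpha_mod A n (ahat X) \<le> 1"
proof -
  have "t_A A n \<ge> 0" using assms n by (simp add: t_A_def)
  then show "0 < alpha_mod A n (ahat X)" "alpha_mod A n (ahat X) \<le> 1"
    using ahat_bounds thr_inv_bounds by (auto simp: alpha_mod_def alpha_A_def)
qed

text \<open>When the default weight is in force, \<open>(thr (ahat X))^2\<close> is at least
  \<open>(t_n n)^2\<close> and so at least \<open>ln (real n)\<close>, while the new squared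
  threshold is \<open>2 * (1 + A) * ln (real n)\<close>.\<close>

lemma thr_alpha_mod_sq_le:
  assumes A: "A \<ge> 0" and tn: "ln (real n) \<le> (t_n n)\<^sup>2" "0 \<le> t_n n"
  shows "(thr (alpha_mod A n (ahat X)))\<^sup>2 \<le> 2 * (1 + A) * (thr (ahat X))\<^sup>2"
proof (cases "thr (ahat X) \<le> t_n n")
  case True
  have "1 * (thr (ahat X))\<^sup>2 \<le> 2 * (1 + A) * (thr (ahat X))\<^sup>2"
    using A by (intro mult_right_mono) auto
  with True show ?thesis by (simp add: alpha_mod_def)
next
  case False
  have t: "t_A A n \<ge> 0" using A n by (simp add: t_A_def)
  have "(thr (alpha_mod A n (ahat X)))\<^sup>2 = (t_A A n)\<^sup>2"
    using False t by (simp add: alpha_mod_def alpha_A_def thr_inv_eq thr_eq)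
  also have "\<dots> = 2 * (1 + A) * ln (real n)" using A n by (simp add: t_A_def)
  also have "\<dots> \<le> 2 * (1 + A) * (thr (ahat X))\<^sup>2"
  proof (rule mult_left_mono)
    have "(t_n n)\<^sup>2 \<le> (thr (ahat X))\<^sup>2" using False tn by (intro power_mono) auto
    then show "ln (real n) \<le> (thr (ahat X))\<^sup>2" using tn by simp
  qed (use A in simp)
  finally show ?thesis .
qed

lemma signal_truncated_squares_le:
  assumes A: "A \<ge> 0" and tn: "ln (real n) \<le> (t_n n)\<^sup>2" "0 \<le> t_n n"
    and S: "S \<subseteq> {..<n}" "card S \<le> s" "1 \<le> s" "s \<le> n"
  shows "(\<Sum>i\<in>S. min ((X i)\<^sup>2) ((thr (alpha_mod A n (ahat X)))\<^sup>2))
    \<le> 8 * (1 + A) * real s * (ln (real n / real s) + 1600)"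
proof -
  let ?R = "2 * (1 + A)"
  have "min (x\<^sup>2) ((thr (alpha_mod A n (ahat X)))\<^sup>2) \<le> ?R * min (x\<^sup>2) ((thr (ahat X))\<^sup>2)" for x :: real
  proof -
    have "1 * x\<^sup>2 \<le> ?R * x\<^sup>2" using A by (intro mult_right_mono) auto
    then have "min (x\<^sup>2) ((thr (alpha_mod A n (ahat X)))\<^sup>2) \<le> min (?R * x\<^sup>2) (?R * (thr (ahat X))\<^sup>2)"
      using thr_alpha_mod_sq_le[OF A tn] by (intro min.mono) auto
    also have "\<dots> = ?R * min (x\<^sup>2) ((thr (ahat X))\<^sup>2)" using A by (simp add: min_mult_distrib_left)
    finally show ?thesis .
  qed
  then have "(\<Sum>i\<in>S. min ((X i)\<^sup>2) ((thr (alpha_mod A n (ahat X)))\<^sup>2))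
      \<le> ?R * (\<Sum>i\<in>S. min ((X i)\<^sup>2) ((thr (ahat X))\<^sup>2))"
    unfolding sum_distrib_left by (intro sum_mono)
  also have "\<dots> \<le> ?R * (4 * real s * (ln (real n / real s) + 1600))"
    using A ahat_bounds ahat_ge ahat_max S
    by (intro mult_left_mono mmle_truncated_squares_le) auto
  finally show ?thesis by (simp add: algebra_simps)
qed

text \<open>Three cases: the default weight is used; the estimate is at most
  \<open>\<alpha>1\<close>; or it exceeds \<open>\<beta>\<close>. In the last case concavity makes
  the score sum at \<open>\<beta>\<close> nonnegative, so the exponential is at least 1 and
  dominates any weight, as in Chernoff's bound. The assumption \<open>low\<close> makes
  \<open>\<beta>\<close> an admissible competitor.\<close>

lemma noise_weight_le:
  assumes A: "A \<ge> 0" and tn: "0 \<le> t_n n"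
    and low: "alpha_low n \<le> thr_inv (t_n n) / 2"
    and \<alpha>1: "0 < \<alpha>1" "\<alpha>1 \<le> 1" and \<beta>: "\<beta> = max \<alpha>1 (thr_inv (t_n n) / 2)" "c \<ge> 0"
  shows "post_weight (alpha_mod A n (ahat X)) x
    \<le> post_weight (alpha_A A n) x + post_weight \<alpha>1 x + exp (c * \<beta> * (\<Sum>j<n. score \<beta> (X j)))"
proof -
  have t: "t_A A n \<ge> 0" using A n by (simp add: t_A_def)
  have nonneg: "0 \<le> post_weight (alpha_A A n) x" "0 \<le> post_weight \<alpha>1 x"
    "0 \<le> exp (c * \<beta> * (\<Sum>j<n. score \<beta> (X j)))"
    using thr_inv_bounds[OF t] \<alpha>1 by (auto simp: alpha_A_def intro: post_weight_bounds)
  show ?thesis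
  proof (cases "thr (ahat X) \<le> t_n n")
    case False
    then show ?thesis using nonneg by (simp add: alpha_mod_def)
  next
    case True
    have "thr_inv (t_n n) \<le> thr_inv (thr (ahat X))"
      using True thr_props(1)[OF ahat_bounds] by (intro thr_inv_mono)
    also have "\<dots> = ahat X"
      using thr_props[OF ahat_bounds] by (simp add: thr_inv_eq)
    finally have ge: "thr_inv (t_n n) \<le> ahat X" .
    note tb = thr_inv_bounds[OF tn]
    show ?thesis
    proof (cases "ahat X \<le> \<beta>")
      case True
      \<comment> \<open>The estimate is at least \<open>thr_inv (t_n n)\<close>, hence above the
        second entry of the maximum \<open>\<beta>\<close>; only the entry \<open>\<alpha>1\<close>
        can bound it.\<close>
      then have "ahat X \<le> \<alpha>1" using ge tb unfolding \<beta> by (auto simp: max_def split: if_splits)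
      then have "post_weight (ahat X) x \<le> post_weight \<alpha>1 x"
        using ahat_bounds \<alpha>1 by (intro post_weight_mono)
      moreover have "alpha_mod A n (ahat X) = ahat X"
        using \<open>thr (ahat X) \<le> t_n n\<close> by (simp add: alpha_mod_def)
      ultimately have "post_weight (alpha_mod A n (ahat X)) x \<le> post_weight \<alpha>1 x" by simp
      then show ?thesis using nonneg by linarith
    next
      case False
      have b: "0 < \<beta>" "\<beta> \<le> 1" "alpha_low n \<le> \<beta>" using \<alpha>1 tb low unfolding \<beta> by auto
      have "0 \<le> loglik n X (ahat X) - loglik n X \<beta>" using ahat_max[of \<beta>] b by simp
      also have "\<dots> \<le> (ahat X - \<beta>) * (\<Sum>j<n. score \<beta> (X j))"
        by (rule loglik_diff_le[OF ahat_bounds b(1,2)])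
      finally have "0 \<le> (\<Sum>j<n. score \<beta> (X j))" using False by (simp add: zero_le_mult_iff)
      then have "1 \<le> exp (c * \<beta> * (\<Sum>j<n. score \<beta> (X j)))" using b \<beta> by simp
      moreover have "post_weight (alpha_mod A n (ahat X)) x \<le> 1"
        by (intro post_weight_bounds alpha_mod_bounds A)
      ultimately show ?thesis using nonneg by linarith
    qed
  qed
qed

end

subsection \<open>Asymptotics of the threshold weights\<close>

lemma thr_inv_ge:
  assumes "y \<ge> 0"
  shows "exp (- y\<^sup>2 / 2) / 7 \<le> thr_inv y"
proof -
  have "gmarg y / phi y \<le> 6 * exp (y\<^sup>2 / 2) / (1 + y\<^sup>2)" by (rule gmarg_div_phi_le)
  also have "\<dots> \<le> 6 * exp (y\<^sup>2 / 2) / 1" by (intro divide_left_mono) (auto simp: add_pos_nonneg)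
  finally have "med_odds y \<le> 6 * exp (y\<^sup>2 / 2)" using med_odds_le[of y] by simp
  moreover have "1 \<le> exp (y\<^sup>2 / 2)" by simp
  ultimately have "1 + med_odds y \<le> 7 * exp (y\<^sup>2 / 2)" by linarith
  then have "1 / (7 * exp (y\<^sup>2 / 2)) \<le> 1 / (1 + med_odds y)"
    using med_odds_nonneg[OF assms] by (intro divide_left_mono) auto
  then show ?thesis using assms by (simp add: thr_inv_eq exp_minus field_simps)
qed

lemma thr_inv_le:
  assumes "y \<ge> 1"
  shows "thr_inv y \<le> 100 * (1 + y\<^sup>2) * exp (- y\<^sup>2 / 2)"
proof -
  have pos: "0 < exp (y\<^sup>2 / 2) / (100 * (1 + y\<^sup>2))" by (simp add: add_pos_nonneg)
  have "exp (y\<^sup>2 / 2) / (100 * (1 + y\<^sup>2)) \<le> 1 + med_odds y" using med_odds_ge[OF assms] by linarith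
  then have "1 / (1 + med_odds y) \<le> 1 / (exp (y\<^sup>2 / 2) / (100 * (1 + y\<^sup>2)))"
    using pos by (intro divide_left_mono mult_pos_pos) auto
  also have "\<dots> = 100 * (1 + y\<^sup>2) * exp (- y\<^sup>2 / 2)" by (simp add: exp_minus field_simps)
  finally show ?thesis using assms by (simp add: thr_inv_eq)
qed

text \<open>Because \<open>exp 12 / 400\<close> exceeds \<open>exp 1\<close>, a squared threshold of
  48 brings the weight into the range of the score estimates.\<close>

lemma thr_inv_le_exp:
  assumes "y \<ge> 0" "y\<^sup>2 \<ge> 48"
  shows "thr_inv y \<le> exp (-1)"
proof -
  have "exp (12::real) = exp 1 ^ 12" by (simp add: exp_of_nat_mult[symmetric])
  also have "\<dots> \<ge> 2 ^ 12" using exp_ge_add_one_self[of "1::real"] by (intro power_mono) auto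
  finally have e12: "4096 \<le> exp (12::real)" by simp
  have e3: "exp (1::real) \<le> 3" using exp_le by simp
  have "exp (12::real) \<le> exp (y\<^sup>2 / 4)" using assms by simp
  with e12 have "4096 \<le> exp (y\<^sup>2 / 4)" by linarith
  then have "4096 / 400 \<le> exp (y\<^sup>2 / 4) / 400" by (intro divide_right_mono) auto
  also have "\<dots> \<le> 1 + med_odds y" by (rule one_plus_med_odds_ge[OF assms(1)])
  finally have "exp 1 \<le> 1 + med_odds y" using e3 by simp
  then have "1 / (1 + med_odds y) \<le> 1 / exp 1" by (intro frac_le) auto
  then show ?thesis using assms by (simp add: thr_inv_eq exp_minus inverse_eq_divide)
qed

lemma log_scale_le:
  assumes "0 < \<alpha>" "1 / y \<le> \<alpha>" "0 < y"
  shows "log_scale \<alpha> \<le> sqrt (ln y)"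
proof -
  have "1 / \<alpha> \<le> y" using assms by (simp add: field_simps)
  then show ?thesis using assms by (simp add: log_scale_def)
qed

text \<open>Bounds the Chernoff rate \<open>\<beta> / log_scale \<beta>\<close> from below. It is
  applied once with the level \<open>\<alpha>1\<close> and \<open>y = n / s\<close>, and once with
  the level belonging to \<open>t_n\<close> and \<open>y = n\<close>.\<close>

lemma div_log_scale_ge:
  assumes "0 < \<gamma>" "\<gamma> \<le> \<beta>" "\<beta> \<le> exp (-1)" "1 / y \<le> \<gamma>" "0 < y"
  shows "\<gamma> / sqrt (ln y) \<le> \<beta> / log_scale \<beta>"
proof -
  have "log_scale \<beta> \<le> sqrt (ln y)" using assms by (intro log_scale_le) auto
  moreover have "1 \<le> log_scale \<beta>" using assms by (intro small_weight) auto
  ultimately show ?thesis using assms by (intro frac_le) auto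
qed

text \<open>Collects what a large \<open>n\<close> has to satisfy. In the last condition a
  polynomial in \<open>ln (real n)\<close> is beaten by the power \<open>- A\<close> of
  \<open>n\<close>, which makes the default weight negligible; the free bound \<open>M\<close>
  serves the Chernoff exponent.\<close>

lemma eventually_large_n:
  fixes A M :: real
  assumes "A > 0"
  shows "eventually (\<lambda>n. 400 \<le> ln (real n) \<and> M \<le> ln (real n) \<and> 5 * ln (ln (real n)) \<le> ln (real n)
    \<and> 100 * (1 + 2 * (1 + A) * ln (real n)) * (3 * (1 + A) * ln (real n)) * exp (- A * ln (real n)) \<le> 1) sequentially"
proof -
  have lim: "filterlim (\<lambda>n. ln (real n)) at_top sequentially" by real_asymp
  have "((\<lambda>z::real. 100 * (1 + 2 * (1 + A) * z) * (3 * (1 + A) * z) * exp (- A * z)) \<longlongrightarrow> 0) at_top"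
    using assms by real_asymp
  then have 1: "eventually (\<lambda>z::real. 100 * (1 + 2 * (1 + A) * z) * (3 * (1 + A) * z) * exp (- A * z) < 1) at_top"
    by (rule order_tendstoD) simp
  have 2: "eventually (\<lambda>z::real. 5 * ln z \<le> z) at_top" by real_asymp
  have "eventually (\<lambda>z::real. 400 \<le> z \<and> M \<le> z \<and> 5 * ln z \<le> z
      \<and> 100 * (1 + 2 * (1 + A) * z) * (3 * (1 + A) * z) * exp (- A * z) \<le> 1) at_top"
    using 1 2 eventually_ge_at_top[of 400] eventually_ge_at_top[of M] by eventually_elim auto
  then show ?thesis using lim unfolding filterlim_iff by blast
qed

section \<open>Weights at the thresholds of the modified estimator\<close>

context
  fixes A :: real and n :: nat and z :: real
  assumes A: "A > 0" and z: "z = ln (real n)" "400 \<le> z" "5 * ln z \<le> z"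
    and zA: "100 * (1 + 2 * (1 + A) * z) * (3 * (1 + A) * z) * exp (- A * z) \<le> 1"
begin

lemma n_eq: "real n = exp z" "n \<ge> 1"
proof -
  have "real n > 0" using z by (cases "n = 0") auto
  then show "real n = exp z" "n \<ge> 1" by (auto simp: z)
qed

lemma t_n_sq: "(t_n n)\<^sup>2 = 2 * z - 5 * ln z" "0 \<le> t_n n" "z \<le> (t_n n)\<^sup>2"
  using z by (auto simp: t_n_def)

text \<open>The correction \<open>5 * ln z\<close> in \<open>t_n\<close> multiplies
  \<open>exp (- z)\<close> by the power \<open>5 / 2\<close> of \<open>z\<close>.\<close>

lemma alpha_n_ge: "z\<^sup>2 * sqrt z / (7 * exp z) \<le> thr_inv (t_n n)"
proof -
  have "exp (5 / 2 * ln z) = exp (ln z) * exp (ln z) * exp (ln z / 2)"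
    by (simp add: exp_add[symmetric])
  also have "exp (ln z / 2) = sqrt z" using z(2) by (simp add: ln_sqrt[symmetric])
  finally have e: "exp (5 / 2 * ln z) = z\<^sup>2 * sqrt z" using z by (simp add: power2_eq_square)
  have "exp (- (t_n n)\<^sup>2 / 2) = exp (5 / 2 * ln z - z)" by (simp add: t_n_sq field_simps)
  also have "\<dots> = z\<^sup>2 * sqrt z / exp z" by (simp only: exp_diff e)
  finally show ?thesis using thr_inv_ge[OF t_n_sq(2)] by simp
qed

text \<open>The lower end of the weight range is at most of order \<open>z / n\<close>, whereas the
  weight at \<open>t_n\<close> is at least of order \<open>z^2 * sqrt z / n\<close>;
  \<open>z \<ge> 400\<close> settles the constants.\<close>

lemma alpha_low_le: "alpha_low n \<le> thr_inv (t_n n) / 2"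
proof -
  have "alpha_low n \<le> 100 * (1 + (sqrt (2 * ln (real n)))\<^sup>2) * exp (- (sqrt (2 * ln (real n)))\<^sup>2 / 2)"
    unfolding alpha_low_def using z by (intro thr_inv_le) simp
  also have "\<dots> = 100 * (1 + 2 * z) / exp z" using z by (simp add: exp_minus field_simps)
  also have "\<dots> \<le> z\<^sup>2 * sqrt z / (7 * exp z) / 2"
  proof -
    have "20 \<le> sqrt z" using z by (intro real_le_rsqrt) simp
    then have "(400 * z) * 20 \<le> z\<^sup>2 * sqrt z"
      using z unfolding power2_eq_square by (intro mult_mono mult_right_mono) auto
    then have "1400 * (1 + 2 * z) \<le> z\<^sup>2 * sqrt z" using z(2) by simp
    then have "1400 * (1 + 2 * z) / (14 * exp z) \<le> z\<^sup>2 * sqrt z / (14 * exp z)"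
      by (intro divide_right_mono) auto
    moreover have "1400 * (1 + 2 * z) / (14 * exp z) = 100 * (1 + 2 * z) / exp z" by (simp add: field_simps)
    ultimately show ?thesis by simp
  qed
  also have "\<dots> \<le> thr_inv (t_n n) / 2" by (intro divide_right_mono alpha_n_ge) simp
  finally show ?thesis .
qed

text \<open>The weight at \<open>t_A\<close> is at most a polynomial in \<open>z\<close> times
  \<open>exp (- (1 + A) * z)\<close>. One factor \<open>exp (- z)\<close> cancels \<open>n\<close>,
  and \<open>exp (- A * z)\<close> remains to beat the polynomials, which is where
  \<open>A > 0\<close> enters.\<close>

lemma alpha_A_le: "alpha_A A n \<le> exp (-1)" "0 < alpha_A A n"
  and alpha_A_log_scale_le: "real n * (alpha_A A n * log_scale (alpha_A A n)) \<le> 1"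
proof -
  define t where "t = t_A A n"
  have t: "t \<ge> 0" "t\<^sup>2 = 2 * (1 + A) * z" using A z by (simp_all add: t_def t_A_def)
  have "2 * 24 \<le> 2 * (1 + A) * z" using A z by (intro mult_mono) auto
  then have t48: "48 \<le> t\<^sup>2" by (simp add: t)
  then have t1: "1 \<le> t" using t power_le_one[of t 2] by (cases "t \<ge> 1") auto
  show "alpha_A A n \<le> exp (-1)" unfolding alpha_A_def t_def[symmetric] by (rule thr_inv_le_exp[OF t(1) t48])
  show "0 < alpha_A A n" unfolding alpha_A_def t_def[symmetric] by (rule thr_inv_bounds[OF t(1)])
  have "exp (- t\<^sup>2 / 2) = exp (- A * z) * exp (- z)" by (simp add: t exp_add[symmetric] field_simps)
  moreover have "alpha_A A n \<le> 100 * (1 + t\<^sup>2) * exp (- t\<^sup>2 / 2)"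
    unfolding alpha_A_def t_def[symmetric] by (rule thr_inv_le[OF t1])
  ultimately have "alpha_A A n \<le> 100 * (1 + 2 * (1 + A) * z) * (exp (- A * z) * exp (- z))"
    using t by simp
  then have 1: "real n * alpha_A A n \<le> real n * (100 * (1 + 2 * (1 + A) * z) * (exp (- A * z) * exp (- z)))"
    by (rule mult_left_mono) simp
  also have "\<dots> = 100 * (1 + 2 * (1 + A) * z) * exp (- A * z)"
    by (simp add: n_eq exp_minus)
  finally have 1: "real n * alpha_A A n \<le> 100 * (1 + 2 * (1 + A) * z) * exp (- A * z)" .
  \<comment> \<open>The factor \<open>1 / 7\<close> of \<open>thr_inv_ge\<close> is absorbed into
    \<open>exp (- 6)\<close>; afterwards the crude bound of a square root by its argument is good
    enough.\<close>
  have e7: "7 \<le> exp (6::real)" using exp_ge_add_one_self[of "6::real"] by simp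
  have "1 / exp (6 + t\<^sup>2 / 2) = exp (- t\<^sup>2 / 2) / exp 6"
    unfolding exp_add by (simp add: exp_minus inverse_eq_divide)
  also have "\<dots> \<le> exp (- t\<^sup>2 / 2) / 7"
    using e7 by (intro divide_left_mono) auto
  also have "\<dots> \<le> alpha_A A n" unfolding alpha_A_def t_def[symmetric] by (rule thr_inv_ge[OF t(1)])
  finally have "log_scale (alpha_A A n) \<le> sqrt (ln (exp (6 + t\<^sup>2 / 2)))"
    using \<open>0 < alpha_A A n\<close> by (intro log_scale_le) auto
  also have "\<dots> \<le> sqrt ((6 + t\<^sup>2 / 2)\<^sup>2)"
    unfolding ln_exp by (intro real_sqrt_le_mono) (simp add: power2_eq_square add_pos_nonneg)
  also have "\<dots> = 6 + t\<^sup>2 / 2" by simp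
  also have "\<dots> \<le> 3 / 2 * t\<^sup>2" using t48 by simp
  also have "\<dots> = 3 * (1 + A) * z" by (simp add: t)
  finally have 2: "log_scale (alpha_A A n) \<le> 3 * (1 + A) * z" .
  have "1 \<le> log_scale (alpha_A A n)" by (rule small_weight) fact+
  then have "real n * alpha_A A n * log_scale (alpha_A A n)
      \<le> 100 * (1 + 2 * (1 + A) * z) * exp (- A * z) * (3 * (1 + A) * z)"
    using A z by (intro mult_mono 1 2) auto
  also have "\<dots> \<le> 1" using zA by (simp add: mult_ac)
  finally show "real n * (alpha_A A n * log_scale (alpha_A A n)) \<le> 1" by (simp add: mult_ac)
qed

end

subsection \<open>Risk bound\<close>

theorem theorem5:
  fixes A :: real
  assumes "A > 0"
  shows "\<exists>C c0 :: real. \<exists>N0 :: nat. C > 0 \<and> c0 > 0 \<and> N0 > 0 \<and>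
    (\<forall>n s ahat. n \<ge> N0 \<and> 1 \<le> s \<and> real s \<le> c0 * real n \<and> is_mmle n ahat \<longrightarrow>
       (SUP \<theta>0 \<in> ell0 n s.
          \<integral>\<^sup>+ X. (\<integral>\<^sup>+ \<theta>. ennreal (\<Sum>i<n. (\<theta> i - \<theta>0 i)\<^sup>2)
                     \<partial>posterior n (alpha_mod A n (ahat X)) X) \<partial>data_law n \<theta>0)
       \<le> ennreal (C * rate n s))"
proof -
  \<comment> \<open>\<open>c\<close> minimises the exponent \<open>60 c\<^sup>2 - c / 2600\<close> of the moment generating function; \<open>K\<close> is large
    enough for the noise to outweigh the factor \<open>exp c\<close> of each signal.\<close>
  define c :: real where "c = 1 / 312000"
  define \<kappa> :: real where "\<kappa> = c / 5200"
  define K :: real where "K = 20800"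
  have c: "0 \<le> c" "c \<le> 1" "c / 2600 - 60 * c\<^sup>2 = \<kappa>" "0 < \<kappa>" "\<kappa> \<le> 1" "\<kappa> * K = 4 * c"
    by (simp_all add: c_def \<kappa>_def K_def power2_eq_square)
  have K: "1 \<le> K" by (simp add: K_def)
  \<comment> \<open>The summands account for the noise (\<open>283 = 256 + 27\<close>), for the
    variance terms of the signals (\<open>1602 = 1600 + 2\<close>) and for the truncated squares
    (\<open>12288 = 1536 * 8\<close>).\<close>
  define C :: real where "C = 64 * (283 + 256 * K) + 1602 + 12288 * (1 + A) * 1601"
  have C: "C > 0" using assms K by (simp add: C_def add_pos_pos)
  \<comment> \<open>With \<open>28 / \<kappa> \<le> z\<close> the exponent
    \<open>\<kappa> * z^2 / 14\<close> is at least \<open>2 * z\<close>.\<close>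
  obtain N where N: "\<And>n. n \<ge> N \<Longrightarrow> 400 \<le> ln (real n) \<and> 28 / \<kappa> \<le> ln (real n) \<and> 5 * ln (ln (real n)) \<le> ln (real n)
    \<and> 100 * (1 + 2 * (1 + A) * ln (real n)) * (3 * (1 + A) * ln (real n)) * exp (- A * ln (real n)) \<le> 1"
    using eventually_large_n[OF assms, of "28 / \<kappa>"] unfolding eventually_sequentially by blast
  have collect: "64 * (ennreal a + ennreal b + ennreal d) = ennreal (64 * (a + b + d))"
    if "0 \<le> a" "0 \<le> b" "0 \<le> d" for a b d :: real
    using that by (simp add: ennreal_mult)
  \<comment> \<open>The sparsity bound \<open>1 / (9 * K^2)\<close> makes
    \<open>sqrt (n / s)\<close> at least \<open>3 * K\<close>, which puts the level
    \<open>\<alpha>1\<close> below \<open>1 / 3\<close> and thus below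
    \<open>exp (-1)\<close>.\<close>
  have main: "(\<integral>\<^sup>+ X. (\<integral>\<^sup>+ \<theta>. ennreal (\<Sum>i<n. (\<theta> i - \<theta>0 i)\<^sup>2)
        \<partial>posterior n (alpha_mod A n (ahat X)) X) \<partial>data_law n \<theta>0) \<le> ennreal (C * rate n s)"
    if n: "n \<ge> max N 1" and s: "1 \<le> s" "real s \<le> 1 / (9 * K\<^sup>2) * real n"
      and mmle: "is_mmle n ahat" and \<theta>0: "\<theta>0 \<in> ell0 n s" for n s ahat \<theta>0
  proof -

    \<comment> \<open>Sample size and sparsity\<close>
    define z where "z = ln (real n)"
    have z: "400 \<le> z" "28 / \<kappa> \<le> z" "5 * ln z \<le> z"
      and zA: "100 * (1 + 2 * (1 + A) * z) * (3 * (1 + A) * z) * exp (- A * z) \<le> 1"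
      using N[of n] n by (auto simp: z_def)
    note large = assms z_def z(1,3) zA
    note tn = t_n_sq[OF large]
    note aA = alpha_A_le[OF large]
    have n1: "n \<ge> 1" and nz: "real n = exp z" using n_eq[OF large] by auto
    define y where "y = real n / real s"
    have y: "y \<ge> 9 * K\<^sup>2" "y > 0"
      using s K n1 by (auto simp: y_def field_simps power2_eq_square)
    have "9 * 1\<^sup>2 \<le> 9 * K\<^sup>2" using K by (intro mult_left_mono power_mono) auto
    then have y9: "y \<ge> 9" using y by simp
    have s4: "4 * real s \<le> real n" "s \<le> n"
    proof -
      have "9 * real s \<le> real n" using y9 s by (simp add: y_def field_simps)
      then show "4 * real s \<le> real n" "s \<le> n" by linarith+
    qed
    have "exp (1::real) \<le> 3" using exp_le by simp
    then have "exp 1 \<le> y" using y9 by simp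
    then have lny: "1 \<le> ln y" using y by (simp add: ln_ge_iff)

    \<comment> \<open>Levels for the estimated weight\<close>
    define \<alpha>1 where "\<alpha>1 = K * sqrt (ln y) / y"
    have \<alpha>1_ge: "1 / y \<le> \<alpha>1"
    proof -
      have "1 * 1 \<le> K * sqrt (ln y)" using K lny by (intro mult_mono) auto
      then show ?thesis unfolding \<alpha>1_def using y by (intro divide_right_mono) auto
    qed
    then have \<alpha>1_pos: "0 < \<alpha>1" using y by (meson divide_pos_pos less_le_trans zero_less_one)
    have \<alpha>1_le: "\<alpha>1 \<le> exp (-1)"
    proof -
      have sy: "3 * K \<le> sqrt y" using y K by (intro real_le_rsqrt) (simp add: power_mult_distrib)
      have "sqrt (ln y) \<le> sqrt y" using y ln_le_minus_one[of y] by simp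
      then have "\<alpha>1 \<le> K * sqrt y / y" unfolding \<alpha>1_def using K y by (intro divide_right_mono mult_left_mono) auto
      also have "\<dots> = K / sqrt y" using y by (simp add: real_div_sqrt divide_simps)
      also have "\<dots> \<le> K / (3 * K)" using sy K y by (intro divide_left_mono) auto
      also have "\<dots> = 1 / 3" using K by simp
      also have "\<dots> \<le> exp (-1)" using \<open>exp (1::real) \<le> 3\<close> by (simp add: exp_minus field_simps)
      finally show ?thesis .
    qed
    \<comment> \<open>Because of the factor \<open>1 / 2\<close>, a weight in \<open>{thr_inv (t_n n)..\<beta>}\<close> is at most \<open>\<alpha>1\<close>.\<close>
    define \<beta> where "\<beta> = max \<alpha>1 (thr_inv (t_n n) / 2)"
    have \<beta>_pos: "0 < \<beta>" using \<alpha>1_pos by (simp add: \<beta>_def)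
    have \<beta>_le: "\<beta> \<le> exp (-1)"
    proof -
      have "thr_inv (t_n n) \<le> exp (-1)" using tn z by (intro thr_inv_le_exp) auto
      moreover have "0 < thr_inv (t_n n)" by (rule thr_inv_bounds[OF tn(2)])
      ultimately show ?thesis using \<alpha>1_le by (simp add: \<beta>_def)
    qed

    \<comment> \<open>Chernoff exponent\<close>
    define \<rho> where "\<rho> = (c / 2600 - 60 * c\<^sup>2) * (\<beta> / log_scale \<beta>)"
    have \<rho>_eq: "\<rho> = \<kappa> * (\<beta> / log_scale \<beta>)" by (simp add: \<rho>_def c)
    have Lb: "1 \<le> log_scale \<beta>" by (rule small_weight[OF \<beta>_pos \<beta>_le])
    have \<rho>0: "0 \<le> \<rho>" using c \<beta>_pos Lb by (simp add: \<rho>_eq)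
    have \<rho>1: "\<rho> \<le> 1"
    proof -
      have "\<beta> \<le> 1" using small_weight(1)[OF \<beta>_pos \<beta>_le] by simp
      then have "\<beta> / log_scale \<beta> \<le> 1" using Lb by (simp add: divide_le_eq)
      then have "\<kappa> * (\<beta> / log_scale \<beta>) \<le> 1 * 1" using c \<beta>_pos Lb by (intro mult_mono) auto
      then show ?thesis by (simp add: \<rho>_eq)
    qed
    \<comment> \<open>The level \<open>\<alpha>1\<close> divided by \<open>sqrt (ln y)\<close> is
      \<open>K * s / n\<close>; since \<open>\<kappa> * K = 4 * c\<close>, the noise outweighs four
      times the exponent \<open>c\<close> of each signal.\<close>
    have \<rho>s: "4 * c * real s \<le> real n * \<rho>"
    proof -
      have "\<alpha>1 / sqrt (ln y) \<le> \<beta> / log_scale \<beta>"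
        using \<alpha>1_pos \<beta>_le \<alpha>1_ge y by (intro div_log_scale_ge) (auto simp: \<beta>_def)
      moreover have "\<alpha>1 / sqrt (ln y) = K / y" using lny by (simp add: \<alpha>1_def)
      ultimately have "real n * (\<kappa> * (K / y)) \<le> real n * \<rho>"
        unfolding \<rho>_eq using c by (intro mult_left_mono) auto
      moreover have "real n * (\<kappa> * (K / y)) = \<kappa> * K * real s" using n1 s by (simp add: y_def)
      ultimately show ?thesis using c by simp
    qed
    have \<rho>z: "2 * z \<le> real n * \<rho>"
    proof -
      \<comment> \<open>Half of the lower bound \<open>alpha_n_ge\<close>. Dividing by
        \<open>sqrt z\<close> leaves \<open>z^2 / (14 * n)\<close>, so \<open>n * \<rho>\<close>
        grows like the square of \<open>ln n\<close>.\<close>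
      define \<gamma> where "\<gamma> = z\<^sup>2 * sqrt z / (7 * exp z) / 2"
      have "1 \<le> sqrt z" using z by simp
      moreover have "14 * 1 \<le> z * z" using z by (intro mult_mono) auto
      ultimately have "(14 * 1) * 1 \<le> (z * z) * sqrt z" using z by - (rule mult_mono; simp)
      then have "14 / (14 * exp z) \<le> (z\<^sup>2 * sqrt z) / (14 * exp z)" by (intro divide_right_mono) (auto simp: power2_eq_square)
      then have g: "1 / exp z \<le> \<gamma>" by (simp add: \<gamma>_def)
      then have g0: "0 < \<gamma>" by (meson divide_pos_pos exp_gt_zero less_le_trans zero_less_one)
      have "\<gamma> \<le> thr_inv (t_n n) / 2"
        unfolding \<gamma>_def by (intro divide_right_mono alpha_n_ge[OF large]) simp
      then have g\<beta>: "\<gamma> \<le> \<beta>" unfolding \<beta>_def by (rule max.coboundedI2)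
      have "\<gamma> / sqrt (ln (exp z)) \<le> \<beta> / log_scale \<beta>"
        using g g0 \<beta>_le by (intro div_log_scale_ge g\<beta>) auto
      moreover have "\<gamma> / sqrt (ln (exp z)) = z\<^sup>2 / (14 * exp z)" using z by (simp add: \<gamma>_def)
      ultimately have "real n * (\<kappa> * (z\<^sup>2 / (14 * exp z))) \<le> real n * \<rho>"
        unfolding \<rho>_eq using c by (intro mult_left_mono) auto
      moreover have "real n * (\<kappa> * (z\<^sup>2 / (14 * exp z))) = (\<kappa> * z / 14) * z" by (simp add: nz power2_eq_square)
      moreover have "2 * z \<le> (\<kappa> * z / 14) * z" using z c by (intro mult_right_mono) (auto simp: field_simps)
      ultimately show ?thesis by linarith
    qed
    \<comment> \<open>One half of \<open>n * \<rho>\<close> pays for the signals, because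
      \<open>s * c\<close> and \<open>s * \<rho>\<close> are each at most a quarter of it; the other
      half is at least \<open>z\<close>. Summed over \<open>n = exp z\<close> coordinates the
      remainder stays bounded.\<close>
    have exponent: "2 + \<rho> + real s * (c + \<rho>) - real n * \<rho> \<le> 3 - z"
    proof -
      have "4 * real s * \<rho> \<le> real n * \<rho>" using s4 \<rho>0 by (intro mult_right_mono) auto
      then have "4 * (real s * (c + \<rho>)) \<le> 2 * (real n * \<rho>)" using \<rho>s by (simp add: algebra_simps)
      then show ?thesis using \<rho>1 \<rho>z by linarith
    qed

    \<comment> \<open>Signal and noise coordinates\<close>
    define S where "S = {i \<in> {..<n}. \<theta>0 i \<noteq> 0}"
    have S: "S \<subseteq> {..<n}" "finite S" "card S \<le> s" using \<theta>0 by (auto simp: S_def ell0_def)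
    define Sc where "Sc = {..<n} - S"
    have Sc: "i < n" "\<theta>0 i = 0" if "i \<in> Sc" for i using that by (auto simp: Sc_def S_def)
    have cardSc: "card Sc \<le> n" using card_mono[of "{..<n}" Sc] by (auto simp: Sc_def)
    define M where "M = 1536 * (8 * (1 + A) * real s * (ln y + 1600))"
    define q where "q X = (\<Prod>j<n. ennreal (exp (c * \<beta> * score \<beta> (X j))))" for X :: "nat \<Rightarrow> real"
    define fA where "fA x = ennreal (post_weight (alpha_A A n) x * (1 + x\<^sup>2))" for x
    define f1 where "f1 x = ennreal (post_weight \<alpha>1 x * (1 + x\<^sup>2))" for x
    have meas [measurable]: "fA \<in> borel_measurable borel" "f1 \<in> borel_measurable borel"
      unfolding fA_def f1_def by measurable
    have sets: "sets (data_law n \<theta>0) = sets (PiM {..<n} (\<lambda>_. borel))"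
      unfolding data_law_def by (intro sets_PiM_cong) auto
    have comp [measurable]: "(\<lambda>X. X i) \<in> borel_measurable (data_law n \<theta>0)" if "i < n" for i
      using that by (simp add: measurable_cong_sets[OF sets refl])
    have [measurable]: "q \<in> borel_measurable (data_law n \<theta>0)"
      unfolding q_def
    proof (rule borel_measurable_prod_ennreal)
      fix j assume "j \<in> {..<n}"
      then have [measurable]: "(\<lambda>X. X j) \<in> borel_measurable (data_law n \<theta>0)" by (intro comp) simp
      show "(\<lambda>X. ennreal (exp (c * \<beta> * score \<beta> (X j)))) \<in> borel_measurable (data_law n \<theta>0)" by measurable
    qed
    \<comment> \<open>The right-hand side is free of \<open>ahat\<close>, so it can be integrated
      under the product law; the truncated squares have already been replaced by the constant
      \<open>M\<close>.\<close>
    have pointwise: "(\<integral>\<^sup>+ \<theta>. ennreal (\<Sum>i<n. (\<theta> i - \<theta>0 i)\<^sup>2) \<partial>posterior n (alpha_mod A n (ahat X)) X)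
        \<le> (\<Sum>i\<in>S. ennreal (1600 + 2 * (X i - \<theta>0 i)\<^sup>2)) + ennreal M
          + (\<Sum>i\<in>Sc. 64 * (fA (X i) + f1 (X i) + ennreal (1 + (X i)\<^sup>2) * q X))"
      if "X \<in> space (data_law n \<theta>0)" for X
    proof -
      have X: "X \<in> space (PiM {..<n} (\<lambda>_. lborel))"
        using that by (simp add: data_law_def space_PiM)
      define \<alpha> where "\<alpha> = alpha_mod A n (ahat X)"
      have \<alpha>: "0 < \<alpha>" "\<alpha> \<le> 1" using alpha_mod_bounds[OF mmle X n1] assms by (auto simp: \<alpha>_def)
      let ?R = "\<lambda>i. \<integral>\<^sup>+ u. ennreal ((u - \<theta>0 i)\<^sup>2) \<partial>post_coord \<alpha> (X i)"
      have "(\<Sum>i\<in>S. ?R i) \<le> (\<Sum>i\<in>S. ennreal (1600 + 2 * (X i - \<theta>0 i)\<^sup>2 + 1536 * min ((X i)\<^sup>2) ((thr \<alpha>)\<^sup>2)))"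
        by (intro sum_mono signal_risk_le \<alpha>)
      also have "\<dots> = (\<Sum>i\<in>S. ennreal (1600 + 2 * (X i - \<theta>0 i)\<^sup>2))
          + (\<Sum>i\<in>S. ennreal (1536 * min ((X i)\<^sup>2) ((thr \<alpha>)\<^sup>2)))"
        unfolding sum.distrib[symmetric] by (intro sum.cong refl ennreal_plus) auto
      also have "(\<Sum>i\<in>S. ennreal (1536 * min ((X i)\<^sup>2) ((thr \<alpha>)\<^sup>2)))
          = ennreal (\<Sum>i\<in>S. 1536 * min ((X i)\<^sup>2) ((thr \<alpha>)\<^sup>2))"
        by (rule sum_ennreal) simp
      also have "(\<Sum>i\<in>S. ennreal (1600 + 2 * (X i - \<theta>0 i)\<^sup>2))
          + ennreal (\<Sum>i\<in>S. 1536 * min ((X i)\<^sup>2) ((thr \<alpha>)\<^sup>2))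
        \<le> (\<Sum>i\<in>S. ennreal (1600 + 2 * (X i - \<theta>0 i)\<^sup>2)) + ennreal M"
      proof (intro add_left_mono ennreal_leI)
        show "(\<Sum>i\<in>S. 1536 * min ((X i)\<^sup>2) ((thr \<alpha>)\<^sup>2)) \<le> M"
          using signal_truncated_squares_le[OF mmle X n1 _ _ tn(2) S(1,3) s(1) s4(2), of A] assms tn(3)
          unfolding M_def \<alpha>_def y_def sum_distrib_left[symmetric] by (simp add: z_def)
      qed
      finally have 1: "(\<Sum>i\<in>S. ?R i) \<le> (\<Sum>i\<in>S. ennreal (1600 + 2 * (X i - \<theta>0 i)\<^sup>2)) + ennreal M" .
      have 2: "(\<Sum>i\<in>Sc. ?R i) \<le> (\<Sum>i\<in>Sc. 64 * (fA (X i) + f1 (X i) + ennreal (1 + (X i)\<^sup>2) * q X))"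
      proof (rule sum_mono)
        fix i assume i: "i \<in> Sc"
        define e where "e = exp (c * \<beta> * (\<Sum>j<n. score \<beta> (X j)))"
        have qe: "q X = ennreal e"
          unfolding q_def e_def sum_distrib_left by (simp add: prod_ennreal exp_sum)
        have "post_weight \<alpha> (X i) \<le> post_weight (alpha_A A n) (X i) + post_weight \<alpha>1 (X i) + e"
          unfolding \<alpha>_def e_def
          using assms tn \<alpha>1_pos \<alpha>1_le c alpha_low_le[OF large]
          by (intro noise_weight_le[OF mmle X n1]) (auto simp: \<beta>_def intro: order.trans[OF \<alpha>1_le])
        then have le: "post_weight \<alpha> (X i) * (1 + (X i)\<^sup>2)
            \<le> (post_weight (alpha_A A n) (X i) + post_weight \<alpha>1 (X i) + e) * (1 + (X i)\<^sup>2)"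
          by (rule mult_right_mono) (simp add: add_nonneg_nonneg)
        have nn: "0 \<le> post_weight (alpha_A A n) (X i) * (1 + (X i)\<^sup>2)" "0 \<le> post_weight \<alpha>1 (X i) * (1 + (X i)\<^sup>2)"
          "0 \<le> (1 + (X i)\<^sup>2) * e"
          using post_weight_bounds(1)[of "alpha_A A n"] post_weight_bounds(1)[of \<alpha>1] alpha_A_le[OF large]
            small_weight(1)[of "alpha_A A n"] small_weight(1)[OF \<alpha>1_pos \<alpha>1_le] \<alpha>1_pos
          by (auto intro!: mult_nonneg_nonneg add_nonneg_nonneg simp: e_def)
        have "?R i \<le> ennreal (64 * (post_weight \<alpha> (X i) * (1 + (X i)\<^sup>2)))"
          using noise_risk_le[OF \<alpha>, of "X i"] Sc[OF i] by simp
        also have "\<dots> \<le> ennreal (64 * (post_weight (alpha_A A n) (X i) * (1 + (X i)\<^sup>2) + post_weight \<alpha>1 (X i) * (1 + (X i)\<^sup>2) + (1 + (X i)\<^sup>2) * e))"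
          using le by (intro ennreal_leI) (simp add: algebra_simps)
        also have "\<dots> = 64 * (fA (X i) + f1 (X i) + ennreal (1 + (X i)\<^sup>2) * q X)"
        proof -
          have "ennreal (1 + (X i)\<^sup>2) * ennreal e = ennreal ((1 + (X i)\<^sup>2) * e)"
            by (rule ennreal_mult[symmetric]) (auto simp: e_def add_nonneg_nonneg)
          then show ?thesis unfolding fA_def f1_def qe by (simp only: collect[OF nn])
        qed
        finally show "?R i \<le> 64 * (fA (X i) + f1 (X i) + ennreal (1 + (X i)\<^sup>2) * q X)" .
      qed
      have "(\<integral>\<^sup>+ \<theta>. ennreal (\<Sum>i<n. (\<theta> i - \<theta>0 i)\<^sup>2) \<partial>posterior n \<alpha> X) = (\<Sum>i<n. ?R i)"
        by (rule posterior_risk_eq_sum[OF \<alpha>])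
      also have "\<dots> = (\<Sum>i\<in>Sc. ?R i) + (\<Sum>i\<in>S. ?R i)"
        unfolding Sc_def using S by (intro sum.subset_diff) auto
      also have "\<dots> \<le> (\<Sum>i\<in>Sc. 64 * (fA (X i) + f1 (X i) + ennreal (1 + (X i)\<^sup>2) * q X))
          + ((\<Sum>i\<in>S. ennreal (1600 + 2 * (X i - \<theta>0 i)\<^sup>2)) + ennreal M)"
        by (intro add_mono 1 2)
      finally show ?thesis by (simp add: \<alpha>_def add_ac)
    qed

    \<comment> \<open>Expected risk of single coordinates\<close>
    have signal: "(\<integral>\<^sup>+ X. ennreal (1600 + 2 * (X i - \<theta>0 i)\<^sup>2) \<partial>data_law n \<theta>0) = ennreal 1602" if "i < n" for i
    proof -
      have "(\<integral>\<^sup>+ X. ennreal (1600 + 2 * (X i - \<theta>0 i)\<^sup>2) \<partial>data_law n \<theta>0)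
          = (\<integral>\<^sup>+ x. ennreal (normal_density (\<theta>0 i) 1 x) * ennreal (1600 + 2 * (x - \<theta>0 i)\<^sup>2) \<partial>lborel)"
        by (rule nn_integral_data_law_component[OF that]) measurable
      also have "\<dots> = (\<integral>\<^sup>+ x. 1600 * ennreal (normal_density (\<theta>0 i) 1 x)
          + 2 * (ennreal (normal_density (\<theta>0 i) 1 x) * ennreal ((x - \<theta>0 i)\<^sup>2)) \<partial>lborel)"
        by (intro nn_integral_cong) (simp add: ennreal_plus ennreal_mult distrib_left mult_ac)
      also have "\<dots> = 1600 + 2"
        by (simp add: nn_integral_add nn_integral_cmult nn_integral_normal_density nn_integral_normal_density_sq)
      finally show ?thesis by simp
    qed
    have noise: "(\<integral>\<^sup>+ X. 64 * (fA (X i) + f1 (X i) + ennreal (1 + (X i)\<^sup>2) * q X) \<partial>data_law n \<theta>0)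
        \<le> ennreal (64 * (256 * alpha_A A n * log_scale (alpha_A A n) + 256 * \<alpha>1 * log_scale \<alpha>1 + exp (3 - z)))"
      if i: "i \<in> Sc" for i
    proof -
      note [measurable] = comp[OF Sc(1)[OF i]]
      have w: "(\<integral>\<^sup>+ X. ennreal (post_weight \<alpha> (X i) * (1 + (X i)\<^sup>2)) \<partial>data_law n \<theta>0)
          \<le> ennreal (256 * \<alpha> * log_scale \<alpha>)" if "0 < \<alpha>" "\<alpha> \<le> exp (-1)" for \<alpha>
      proof -
        have "(\<integral>\<^sup>+ X. ennreal (post_weight \<alpha> (X i) * (1 + (X i)\<^sup>2)) \<partial>data_law n \<theta>0)
            = (\<integral>\<^sup>+ x. ennreal (normal_density (\<theta>0 i) 1 x) * ennreal (post_weight \<alpha> x * (1 + x\<^sup>2)) \<partial>lborel)"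
          by (rule nn_integral_data_law_component[OF Sc(1)[OF i]]) measurable
        also have "\<dots> = (\<integral>\<^sup>+ x. ennreal (phi x * (post_weight \<alpha> x * (1 + x\<^sup>2))) \<partial>lborel)"
          using Sc(2)[OF i] by (simp add: phi_def ennreal_mult')
        also have "\<dots> \<le> ennreal (256 * \<alpha> * log_scale \<alpha>)" by (rule expectation_noise_weight[OF that])
        finally show ?thesis .
      qed
      have "(\<integral>\<^sup>+ X. ennreal (1 + (X i)\<^sup>2) * q X \<partial>data_law n \<theta>0)
          \<le> ennreal (exp (2 + \<rho> + real s * (c + \<rho>) - real n * \<rho>))"
        unfolding q_def
        by (rule data_law_exp_score_le[where \<theta>=\<theta>0])
          (use \<beta>_pos \<beta>_le c \<rho>_def \<rho>0 Sc[OF i] S(3) in \<open>auto simp: S_def\<close>)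
      also have "\<dots> \<le> ennreal (exp (3 - z))" using exponent by (intro ennreal_leI) simp
      finally have 3: "(\<integral>\<^sup>+ X. ennreal (1 + (X i)\<^sup>2) * q X \<partial>data_law n \<theta>0) \<le> ennreal (exp (3 - z))" .
      have "(\<integral>\<^sup>+ X. 64 * (fA (X i) + f1 (X i) + ennreal (1 + (X i)\<^sup>2) * q X) \<partial>data_law n \<theta>0)
          = 64 * ((\<integral>\<^sup>+ X. fA (X i) \<partial>data_law n \<theta>0) + (\<integral>\<^sup>+ X. f1 (X i) \<partial>data_law n \<theta>0)
            + (\<integral>\<^sup>+ X. ennreal (1 + (X i)\<^sup>2) * q X \<partial>data_law n \<theta>0))"
        by (simp add: nn_integral_cmult nn_integral_add)
      also have "\<dots> \<le> 64 * (ennreal (256 * alpha_A A n * log_scale (alpha_A A n))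
          + ennreal (256 * \<alpha>1 * log_scale \<alpha>1) + ennreal (exp (3 - z)))"
        unfolding fA_def f1_def
        by (intro mult_left_mono add_mono w 3 alpha_A_le[OF large] \<alpha>1_pos \<alpha>1_le) simp
      also have "\<dots> = ennreal (64 * (256 * alpha_A A n * log_scale (alpha_A A n) + 256 * \<alpha>1 * log_scale \<alpha>1 + exp (3 - z)))"
      proof -
        have "0 \<le> 256 * alpha_A A n * log_scale (alpha_A A n)" "0 \<le> 256 * \<alpha>1 * log_scale \<alpha>1"
          using small_weight(2)[OF aA(2,1)] small_weight(2)[OF \<alpha>1_pos \<alpha>1_le]
            alpha_A_le(2)[OF large] \<alpha>1_pos by auto
        then show ?thesis by (intro collect) auto
      qed
      finally show ?thesis .
    qed

    \<comment> \<open>Totals in units of s log(n / s)\<close>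
    define Q where "Q = real s * ln y"
    have Q: "real s \<le> Q" "1 \<le> Q"
    proof -
      have "real s * 1 \<le> real s * ln y" using lny by (intro mult_left_mono) auto
      then show "real s \<le> Q" by (simp add: Q_def)
      then show "1 \<le> Q" using s(1) by linarith
    qed
    define W where "W = 64 * (256 * alpha_A A n * log_scale (alpha_A A n) + 256 * \<alpha>1 * log_scale \<alpha>1 + exp (3 - z))"
    have W0: "0 \<le> W"
      unfolding W_def
      using small_weight(2)[OF aA(2,1)] small_weight(2)[OF \<alpha>1_pos \<alpha>1_le]
        alpha_A_le(2)[OF large] \<alpha>1_pos by (auto intro!: add_nonneg_nonneg)
    \<comment> \<open>The main term comes from \<open>\<alpha>1\<close>: its log scale is at most
      \<open>sqrt (ln y)\<close>, and \<open>n * \<alpha>1 * sqrt (ln y) = K * Q\<close>. The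
      default weight adds at most 256, and the Chernoff remainder at most \<open>exp 3\<close>,
      below 27.\<close>
    have W: "real n * W \<le> 64 * (283 + 256 * K) * Q"
    proof -
      have "log_scale \<alpha>1 \<le> sqrt (ln y)" by (rule log_scale_le[OF \<alpha>1_pos \<alpha>1_ge y(2)])
      then have "real n * (\<alpha>1 * log_scale \<alpha>1) \<le> real n * (\<alpha>1 * sqrt (ln y))"
        using \<alpha>1_pos by (intro mult_left_mono) auto
      also have "\<dots> = K * (real n / y * ln y)" using lny by (simp add: \<alpha>1_def)
      also have "\<dots> = K * Q" using n1 by (simp add: Q_def y_def)
      finally have 1: "real n * (\<alpha>1 * log_scale \<alpha>1) \<le> K * Q" .
      have "exp (3::real) = exp 1 ^ 3" by (simp add: exp_of_nat_mult[symmetric])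
      also have "\<dots> \<le> 3 ^ 3" using \<open>exp (1::real) \<le> 3\<close> by (intro power_mono) auto
      finally have 2: "real n * exp (3 - z) \<le> 27" by (simp add: nz exp_diff)
      have "real n * W = 64 * (256 * (real n * (alpha_A A n * log_scale (alpha_A A n)))
          + 256 * (real n * (\<alpha>1 * log_scale \<alpha>1)) + real n * exp (3 - z))"
        by (simp add: W_def algebra_simps)
      also have "\<dots> \<le> 64 * (256 * 1 + 256 * (K * Q) + 27)"
        by (intro mult_left_mono add_mono 1 2 alpha_A_log_scale_le[OF large]) auto
      also have "\<dots> \<le> 64 * (283 + 256 * K) * Q" using Q by (simp add: algebra_simps)
      finally show ?thesis .
    qed

    \<comment> \<open>Integration over the data\<close>
    have "(\<integral>\<^sup>+ X. (\<integral>\<^sup>+ \<theta>. ennreal (\<Sum>i<n. (\<theta> i - \<theta>0 i)\<^sup>2)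
        \<partial>posterior n (alpha_mod A n (ahat X)) X) \<partial>data_law n \<theta>0)
      \<le> (\<integral>\<^sup>+ X. (\<Sum>i\<in>S. ennreal (1600 + 2 * (X i - \<theta>0 i)\<^sup>2)) + ennreal M
          + (\<Sum>i\<in>Sc. 64 * (fA (X i) + f1 (X i) + ennreal (1 + (X i)\<^sup>2) * q X)) \<partial>data_law n \<theta>0)"
      by (intro nn_integral_mono pointwise)
    also have "\<dots> = (\<Sum>i\<in>S. \<integral>\<^sup>+ X. ennreal (1600 + 2 * (X i - \<theta>0 i)\<^sup>2) \<partial>data_law n \<theta>0) + ennreal M
          + (\<Sum>i\<in>Sc. \<integral>\<^sup>+ X. 64 * (fA (X i) + f1 (X i) + ennreal (1 + (X i)\<^sup>2) * q X) \<partial>data_law n \<theta>0)"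
    proof -
      have m1: "(\<lambda>X. ennreal (1600 + 2 * (X i - \<theta>0 i)\<^sup>2)) \<in> borel_measurable (data_law n \<theta>0)" if "i \<in> S" for i
        using comp[of i] that S(1) by (auto intro!: measurable_compose[OF comp])
      have m2: "(\<lambda>X. 64 * (fA (X i) + f1 (X i) + ennreal (1 + (X i)\<^sup>2) * q X)) \<in> borel_measurable (data_law n \<theta>0)" if "i \<in> Sc" for i
      proof -
        note [measurable] = comp[OF Sc(1)[OF that]]
        show ?thesis by measurable
      qed
      have "prob_space (data_law n \<theta>0)"
        unfolding data_law_def by (intro prob_space_PiM prob_space_normal_density) simp
      then have "emeasure (data_law n \<theta>0) (space (data_law n \<theta>0)) = 1" by (rule prob_space.emeasure_space_1)
      then have const: "(\<integral>\<^sup>+ X. ennreal M \<partial>data_law n \<theta>0) = ennreal M" by simp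
      have mS: "(\<lambda>X. \<Sum>i\<in>S. ennreal (1600 + 2 * (X i - \<theta>0 i)\<^sup>2)) \<in> borel_measurable (data_law n \<theta>0)"
        by (intro borel_measurable_sum m1)
      have mSc: "(\<lambda>X. \<Sum>i\<in>Sc. 64 * (fA (X i) + f1 (X i) + ennreal (1 + (X i)\<^sup>2) * q X)) \<in> borel_measurable (data_law n \<theta>0)"
        by (intro borel_measurable_sum m2)
      show ?thesis
        by (simp only: nn_integral_add[OF borel_measurable_add[OF mS borel_measurable_const] mSc]
            nn_integral_add[OF mS borel_measurable_const] const nn_integral_sum[OF m1] nn_integral_sum[OF m2])
    qed
    also have "\<dots> \<le> (\<Sum>i\<in>S. ennreal 1602) + ennreal M + (\<Sum>i\<in>Sc. ennreal W)"
      unfolding W_def using S(1) signal by (intro add_mono sum_mono noise) auto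
    also have "\<dots> = ennreal (real (card S) * 1602 + M + real (card Sc) * W)"
    proof -
      have "0 \<le> M" using assms lny by (simp add: M_def)
      then show ?thesis using W0
        by (simp add: ennreal_plus ennreal_mult' ennreal_of_nat_eq_real_of_nat)
    qed
    also have "\<dots> \<le> ennreal (C * rate n s)"
    proof (rule ennreal_leI)
      have "real (card S) * 1602 \<le> real s * 1602" using S(3) by simp
      also have "\<dots> \<le> 1602 * Q" using Q by simp
      finally have 1: "real (card S) * 1602 \<le> 1602 * Q" .
      have "real s * (ln y + 1600) \<le> 1601 * Q" using Q by (simp add: Q_def algebra_simps)
      then have "12288 * (1 + A) * (real s * (ln y + 1600)) \<le> 12288 * (1 + A) * (1601 * Q)"
        using assms by (intro mult_left_mono) auto
      then have 2: "M \<le> 12288 * (1 + A) * 1601 * Q" by (simp add: M_def algebra_simps)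
      have "real (card Sc) * W \<le> real n * W" using cardSc W0 by (intro mult_right_mono) auto
      then have 3: "real (card Sc) * W \<le> 64 * (283 + 256 * K) * Q" using W by simp
      have "real (card S) * 1602 + M + real (card Sc) * W \<le> C * Q"
        using 1 2 3 by (simp add: C_def algebra_simps)
      also have "\<dots> \<le> C * rate n s"
        using C Q by (intro mult_left_mono) (auto simp: rate_def Q_def y_def)
      finally show "real (card S) * 1602 + M + real (card Sc) * W \<le> C * rate n s" .
    qed
    finally show ?thesis .
  qed
  show ?thesis
  proof (intro exI conjI allI impI)
    show "C > 0" by (rule C)
    show "0 < 1 / (9 * K\<^sup>2)" using K by simp
    show "0 < max N 1" by simp
    fix n s :: nat and ahat
    assume *: "max N 1 \<le> n \<and> 1 \<le> s \<and> real s \<le> 1 / (9 * K\<^sup>2) * real n \<and> is_mmle n ahat"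
    show "(SUP \<theta>0 \<in> ell0 n s.
          \<integral>\<^sup>+ X. (\<integral>\<^sup>+ \<theta>. ennreal (\<Sum>i<n. (\<theta> i - \<theta>0 i)\<^sup>2)
                     \<partial>posterior n (alpha_mod A n (ahat X)) X) \<partial>data_law n \<theta>0)
       \<le> ennreal (C * rate n s)"
      by (rule SUP_least) (rule main, use * in auto)
  qed
qed

end
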